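(* The following three conditions are equivalent for a sequence of probability measures $(\mathbb P^\ell)_{\ell\in\mathbb N^*}$ supported on quadrangulations with a boundary of size $2\ell$: (1) there is a positive $q$ such that $(\mathbb P^\ell)_{\ell\in\mathbb N^*}$ is the law of the $q$-Boltzmann map (i.e. for every $\ell$, $\mathbb P^\ell$ is the law of the $q$-Boltzmann map with half-perimeter $\ell$); (2) $(\mathbb P^\ell)_{\ell\in\mathbb N^*}$ has the Markov property and for each $\ell$ the measure $\mathbb P^\ell$ is uniformly distributed when the number of faces is fixed; (3) $(\mathbb P^\ell)_{\ell\in\mathbb N^*}$ has the Markov property and for each $\ell$ the measure $\mathbb P^\ell$ is invariant under rerooting.
   Context: A planar map is a finite connected graph properly embedded in the sphere with a distinguished oriented edge (the root edge). Each edge consists of two semi-edges, one per side. The root face is the face to the right of the root edge; its degree is the perimeter. A quadrangulation with boundary is a planar map in which all faces, except possibly the root face, are surrounded by 4 semi-edges; $\mathcal Q^\ell$ denotes those of perimeter $2\ell$ (half-perimeter $\ell$), $\mathcal Q^{\ell,f}$ those having in addition $f$ interior (non-root) faces, and $|F(\mathfrak q)|$ is the number of interior faces. A quadrangulation with holes is a planar map with boundary which has distinguished faces, called holes, which need not be squares, each one with a marked oriented edge, all non-distinguished interior faces being surrounded by 4 semi-edges. $H(\mathfrak q)$ is the set of holes of $\mathfrak q$. Gluing: given $\mathfrak q$ with holes and, for each $h\in H(\mathfrak q)$, a map $\mathfrak u_h$ (possibly with holes) of perimeter $\deg h$, the map $\mathfrak q\odot(\mathfrak u_h)_{h}$ is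 obtained by identifying, for each $h$, the root edge of $\mathfrak u_h$ with the marked edge of $h$ and then, following the orientation, the edges of the boundary of $\mathfrak u_h$ with the edges of $h$; it keeps the root and boundary of $\mathfrak q$. Write $\mathfrak q\subset\mathfrak p$ if $\mathfrak p=\mathfrak q\odot(\mathfrak u_h)_h$ for some collection $(\mathfrak u_h)_h$, which is then uniquely defined and denoted $(\mathfrak p^{\mathfrak q}_h)_h$. $q$-Boltzmann map with half-perimeter $\ell$ ($q>0$): random element of $\mathcal Q^\ell$ with $\mathbb P^\ell(\mathfrak Q=\mathfrak q)=q^{|F(\mathfrak q)|}/W_q^\ell$ for all $\mathfrak q\in\mathcal Q^\ell$, where $W_q^\ell$ is the normalising constant, required to be finite (true for $q\le1/12$). Markov property: for any deterministic quadrangulation with holes $\mathfrak q$, the conditional law $\mathbb P^\ell(\,\cdot\mid\{\mathfrak q\subset\mathfrak Q\})$ can be described as $\mathfrak Q=\mathfrak q\odot(\mathfrak Q^{\mathfrak q}_h)_{h\in H(\mathfrak q)}$, where $(\mathfrak Q^{\mathfrak q}_h)_{h\in H(\mathfrak q)}$ is a collection of independent maps, $\mathfrak Q^{\mathfrak q}_h$ having law $\mathbb P^{\deg(h)/2}$. Uniformly distributed when the number of faces is fixed: for every $f$ and any $\mathfrak q_1,\mathfrak q_2\in\mathcal Q^{\ell,f}$, $\mathbb P^\ell(\mathfrak Q=\mathfrak q_1)=\mathbb P^\ell(\mathfrak Q=\mathfrak q_2)$. Invariance under rerooting: for any deterministic rooted quadrangulation $\mathfrak q_1$ and any copy $\mathfrak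 q_2$ of $\mathfrak q_1$ differing only in the position of the root edge (rerooting preserves the number of faces and the half-perimeter), $\mathbb P^\ell(\mathfrak Q=\mathfrak q_1)=\mathbb P^\ell(\mathfrak Q=\mathfrak q_2)$.
   Formalization: The Markov property is required only for quadrangulations with even holes for which every gluing is a planar map determining its fillings (false for e.g. holes sharing an edge), and it includes P(q ⊂ Q) > 0 for each such q; otherwise uniform plane trees (q = 0) satisfy (2), (3) but not (1). *)

theory Defs
  imports
    "HOL-Combinatorics.Combinatorics"
    "HOL-Probability.Probability"
    "HOL-Probability.Product_PMF"
begin

section \<open>Rooted planar maps\<close>

text \<open>
  A map is encoded by its semi-edges. A semi-edge lies on one side of one edge, hence in exactly
  one face, and it is identified with the orientation of its edge that has this face on its right.
  \<open>opp_semi\<close> sends a semi-edge to the one on the other side of the same edge; \<open>next_semi\<close> sends a semi-edge to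
  the one following it around its face, in the direction of its orientation. So \<open>next_semi \<circ> opp_semi\<close>
  permutes the semi-edges with a given starting vertex. The root edge, being an oriented edge,
  is the semi-edge on its right.
\<close>

record 'd cmap =
  semi :: "'d set"
  opp_semi :: "'d \<Rightarrow> 'd"
  next_semi :: "'d \<Rightarrow> 'd"
  root_semi :: 'd

definition face_at :: "'d cmap \<Rightarrow> 'd \<Rightarrow> 'd set" where
  "face_at M s = orbit (next_semi M) s"

definition faces :: "'d cmap \<Rightarrow> 'd set set" where
  "faces M = face_at M ` semi M"

definition edges :: "'d cmap \<Rightarrow> 'd set set" where
  "edges M = (\<lambda>s. {s, opp_semi M s}) ` semi M"

definition vertices :: "'d cmap \<Rightarrow> 'd set set" where
  "vertices M = orbit (next_semi M \<circ> opp_semi M) ` semi M"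

definition connected_map :: "'d cmap \<Rightarrow> bool" where
  "connected_map M \<longleftrightarrow>
     (\<forall>s\<in>semi M. \<forall>t\<in>semi M. (s, t) \<in> {(x, y). x \<in> semi M \<and> (y = opp_semi M x \<or> y = next_semi M x)}\<^sup>*)"

text \<open>The last condition is Euler's relation, i.e. the underlying surface is the sphere.\<close>

definition planar_cmap :: "'d cmap \<Rightarrow> bool" where
  "planar_cmap M \<longleftrightarrow>
     finite (semi M) \<and> root_semi M \<in> semi M \<and>
     opp_semi M permutes semi M \<and> (\<forall>s\<in>semi M. opp_semi M s \<noteq> s \<and> opp_semi M (opp_semi M s) = s) \<and>
     next_semi M permutes semi M \<and>
     connected_map M \<and>
     card (vertices M) + card (faces M) = card (edges M) + 2"

definition isomorphic :: "'d cmap \<Rightarrow> 'e cmap \<Rightarrow> bool" where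
  "isomorphic M N \<longleftrightarrow>
     (\<exists>b. bij_betw b (semi M) (semi N) \<and> b (root_semi M) = root_semi N \<and>
          (\<forall>s\<in>semi M. b (opp_semi M s) = opp_semi N (b s) \<and> b (next_semi M s) = next_semi N (b s)))"

definition root_face :: "'d cmap \<Rightarrow> 'd set" where
  "root_face M = face_at M (root_semi M)"

definition perimeter :: "'d cmap \<Rightarrow> nat" where
  "perimeter M = card (root_face M)"

definition interior_faces :: "'d cmap \<Rightarrow> 'd set set" where
  "interior_faces M = faces M - {root_face M}"

definition quadrangulation :: "'d cmap \<Rightarrow> bool" where
  "quadrangulation M \<longleftrightarrow> planar_cmap M \<and> (\<forall>F\<in>interior_faces M. card F = 4)"


subsection \<open>Planar maps up to root-preserving isomorphism\<close>

lemma isomorphic_sym: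
  assumes "planar_cmap M" "isomorphic M N"
  shows "isomorphic N M"
proof -
  obtain b where b: "bij_betw b (semi M) (semi N)" "b (root_semi M) = root_semi N"
    "\<And>s. s \<in> semi M \<Longrightarrow> b (opp_semi M s) = opp_semi N (b s) \<and> b (next_semi M s) = next_semi N (b s)"
    using assms(2) unfolding isomorphic_def by blast
  define c where "c = inv_into (semi M) b"
  have c: "bij_betw c (semi N) (semi M)"
    unfolding c_def using b(1) by (rule bij_betw_inv_into)
  have cb: "c (b s) = s" if "s \<in> semi M" for s
    using that b(1) unfolding c_def by (simp add: bij_betw_inv_into_left)
  have bc: "b (c t) = t" if "t \<in> semi N" for t
    using that b(1) unfolding c_def by (simp add: bij_betw_inv_into_right)
  have cm: "c t \<in> semi M" if "t \<in> semi N" for t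
    using c that bij_betwE by blast
  have cl: "opp_semi M s \<in> semi M \<and> next_semi M s \<in> semi M" if "s \<in> semi M" for s
    using assms(1) that unfolding planar_cmap_def by (auto simp: permutes_in_image)
  have "c (opp_semi N t) = opp_semi M (c t) \<and> c (next_semi N t) = next_semi M (c t)" if t: "t \<in> semi N" for t
    using b(3)[OF cm[OF t]] cl[OF cm[OF t]] bc[OF t] cb by metis
  moreover have "c (root_semi N) = root_semi M"
    using assms(1) cb b(2) unfolding planar_cmap_def by metis
  ultimately show ?thesis
    unfolding isomorphic_def using c by blast
qed

lemma isomorphic_trans:
  assumes "isomorphic M N" "isomorphic N K"
  shows "isomorphic M K"
proof -
  obtain b where b: "bij_betw b (semi M) (semi N)" "b (root_semi M) = root_semi N"
    "\<And>s. s \<in> semi M \<Longrightarrow> b (opp_semi M s) = opp_semi N (b s) \<and> b (next_semi M s) = next_semi N (b s)"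
    using assms(1) unfolding isomorphic_def by blast
  obtain c where c: "bij_betw c (semi N) (semi K)" "c (root_semi N) = root_semi K"
    "\<And>s. s \<in> semi N \<Longrightarrow> c (opp_semi N s) = opp_semi K (c s) \<and> c (next_semi N s) = next_semi K (c s)"
    using assms(2) unfolding isomorphic_def by blast
  have "b s \<in> semi N" if "s \<in> semi M" for s
    using that b(1) bij_betwE by blast
  then show ?thesis
    unfolding isomorphic_def
    using bij_betw_trans[OF b(1) c(1)] b(2,3) c(2,3) by (intro exI[of _ "c \<circ> b"]) auto
qed

lemma planar_cmap_single_edge:
  "planar_cmap \<lparr>semi = {0, 1 :: nat}, opp_semi = Transposition.transpose 0 1, next_semi = Transposition.transpose 0 1, root_semi = 0\<rparr>"
    (is "planar_cmap ?M")
proof -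
  let ?t = "Transposition.transpose (0 :: nat) 1"
  have o_id: "orbit id x = {x}" for x :: nat
    by (auto simp: orbit_altdef)
  have mem: "y \<in> orbit ?t x" if "x \<in> {0, 1}" "y \<in> {0, 1}" for x y
    using that orbit.base[of ?t x] orbit.step[OF orbit.base[of ?t x]] by auto
  have sub: "y \<in> {0, 1}" if "y \<in> orbit ?t x" "x \<in> {0, 1}" for x y
    using that by induction (auto simp: Transposition.transpose_def)
  have o_t: "orbit ?t x = {0, 1}" if "x \<in> {0, 1}" for x
    using mem[OF that] sub[OF _ that] by blast
  have v: "vertices ?M = {{0}, {1}}"
    by (simp add: vertices_def o_id[unfolded id_def] o_id)
  have f: "faces ?M = {{0, 1}}"
    using o_t by (simp add: faces_def face_at_def)
  have e: "edges ?M = {{0, 1}}"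
    by (auto simp: edges_def)
  have c: "connected_map ?M"
    unfolding connected_map_def by (auto intro!: r_into_rtrancl)
  have p: "?t permutes {0, 1}"
    by (rule permutes_swap_id) auto
  show ?thesis
    unfolding planar_cmap_def v f e using c p by auto
qed

quotient_type planar_map = "nat cmap" / partial:
  "\<lambda>M N. planar_cmap M \<and> planar_cmap N \<and> isomorphic M N"
proof (rule part_equivpI)
  have "isomorphic M M" for M :: "nat cmap"
    unfolding isomorphic_def by (intro exI[of _ id]) auto
  then show "\<exists>M :: nat cmap. planar_cmap M \<and> planar_cmap M \<and> isomorphic M M"
    using planar_cmap_single_edge by blast
  show "symp (\<lambda>M N :: nat cmap. planar_cmap M \<and> planar_cmap N \<and> isomorphic M N)"
    using isomorphic_sym by (auto intro!: sympI)
  show "transp (\<lambda>M N :: nat cmap. planar_cmap M \<and> planar_cmap N \<and> isomorphic M N)"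
    using isomorphic_trans by (auto intro!: transpI)
qed

text \<open>
  The notions below are evaluated on the representative \<open>rep_planar_map m\<close>; all of them are
  invariant under isomorphism, so the choice of representative is immaterial.
\<close>

definition Quad :: "nat \<Rightarrow> planar_map set" where
  "Quad l = {m. quadrangulation (rep_planar_map m) \<and> perimeter (rep_planar_map m) = 2 * l}"

definition num_faces :: "planar_map \<Rightarrow> nat" where
  "num_faces m = card (interior_faces (rep_planar_map m))"

definition Quad_faces :: "nat \<Rightarrow> nat \<Rightarrow> planar_map set" where
  "Quad_faces l f = {m \<in> Quad l. num_faces m = f}"

definition rerooting_of :: "planar_map \<Rightarrow> planar_map \<Rightarrow> bool" where
  "rerooting_of m m' \<longleftrightarrow>
     (\<exists>s\<in>semi (rep_planar_map m).
        isomorphic ((rep_planar_map m)\<lparr>root_semi := s\<rparr>) (rep_planar_map m'))"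


section \<open>Holes and gluing\<close>

text \<open>
  A map with holes is a map \<open>q\<close> together with a set \<open>H\<close> of semi-edges, one in each hole. The
  marked oriented edge of the hole \<open>face_at q h\<close> is the edge of \<open>h\<close>, oriented so that the hole
  is on its left (opposite to \<open>h\<close>); this is the side on which a map rooted there has its interior.
\<close>

definition quadrangulation_with_holes :: "'d cmap \<Rightarrow> 'd set \<Rightarrow> bool" where
  "quadrangulation_with_holes q H \<longleftrightarrow>
     planar_cmap q \<and> H \<subseteq> semi q \<and> inj_on (face_at q) H \<and> root_face q \<notin> face_at q ` H \<and>
     (\<forall>F \<in> interior_faces q - face_at q ` H. card F = 4)"

definition hole_degree :: "'d cmap \<Rightarrow> 'd \<Rightarrow> nat" where
  "hole_degree q h = card (face_at q h)"

text \<open>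
  In the gluing, semi-edges are \<open>Inl s\<close> with \<open>s\<close> in \<open>q\<close>, or \<open>Inr (h, s)\<close> with \<open>s\<close> in the map
  \<open>u h\<close> filling the hole \<open>h\<close>. The semi-edges of the holes and of the root faces of the \<open>u h\<close>
  disappear; the others keep their face. \<open>seam\<close> says which hole edge is identified with which
  boundary edge of the filling: the two faces lie on opposite sides of the seam, so they are
  followed in opposite directions.
\<close>

definition seam ::
  "'d cmap \<Rightarrow> 'd set \<Rightarrow> ('d \<Rightarrow> 'e cmap) \<Rightarrow> ('d + 'd \<times> 'e) \<Rightarrow> ('d + 'd \<times> 'e) \<Rightarrow> bool" where
  "seam q H u x y \<longleftrightarrow>
     (\<exists>h\<in>H. \<exists>i::nat. {x, y} = {Inl ((inv (next_semi q) ^^ i) h), Inr (h, (next_semi (u h) ^^ i) (root_semi (u h)))})"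

definition glue_semi :: "'d cmap \<Rightarrow> 'd set \<Rightarrow> ('d \<Rightarrow> 'e cmap) \<Rightarrow> ('d + 'd \<times> 'e) set" where
  "glue_semi q H u =
     Inl ` (semi q - (\<Union>h\<in>H. face_at q h)) \<union>
     Inr ` (SIGMA h:H. semi (u h) - root_face (u h))"

fun sum_opp :: "'d cmap \<Rightarrow> ('d \<Rightarrow> 'e cmap) \<Rightarrow> 'd + 'd \<times> 'e \<Rightarrow> 'd + 'd \<times> 'e" where
  "sum_opp q u (Inl s) = Inl (opp_semi q s)"
| "sum_opp q u (Inr (h, s)) = Inr (h, opp_semi (u h) s)"

fun sum_nxt :: "'d cmap \<Rightarrow> ('d \<Rightarrow> 'e cmap) \<Rightarrow> 'd + 'd \<times> 'e \<Rightarrow> 'd + 'd \<times> 'e" where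
  "sum_nxt q u (Inl s) = Inl (next_semi q s)"
| "sum_nxt q u (Inr (h, s)) = Inr (h, next_semi (u h) s)"

text \<open>
  To find the other side of an edge after gluing, cross the edge; if this leads to a semi-edge that
  has disappeared, pass to the edge identified with it and cross that one, until a surviving
  semi-edge is met. Several crossings occur when boundary edges of the filling coincide.
\<close>

definition glue_opp ::
  "'d cmap \<Rightarrow> 'd set \<Rightarrow> ('d \<Rightarrow> 'e cmap) \<Rightarrow> 'd + 'd \<times> 'e \<Rightarrow> 'd + 'd \<times> 'e" where
  "glue_opp q H u x =
     (THE y. y \<in> glue_semi q H u \<and>
             (sum_opp q u x, y) \<in> {(s, sum_opp q u t) | s t. seam q H u s t}\<^sup>*)"

definition glue :: "'d cmap \<Rightarrow> 'd set \<Rightarrow> ('d \<Rightarrow> 'e cmap) \<Rightarrow> ('d + 'd \<times> 'e) cmap" where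
  "glue q H u =
     \<lparr>semi = glue_semi q H u,
      opp_semi = (\<lambda>x. if x \<in> glue_semi q H u then glue_opp q H u x else x),
      next_semi = (\<lambda>x. if x \<in> glue_semi q H u then sum_nxt q u x else x),
      root_semi = Inl (root_semi q)\<rparr>"

text \<open>\<open>glues_to q H u p\<close> means \<open>p = q \<odot> (u h)\<^sub>h\<close> (and in particular that the right-hand side is a planar map).\<close>

definition glues_to :: "'d cmap \<Rightarrow> 'd set \<Rightarrow> ('d \<Rightarrow> planar_map) \<Rightarrow> planar_map \<Rightarrow> bool" where
  "glues_to q H u p \<longleftrightarrow>
     isomorphic (rep_planar_map p) (glue q H (\<lambda>h. rep_planar_map (u h)))"

text \<open>Families \<open>(u h)\<close> of quadrangulations with boundary with half-perimeters those of the holes.\<close>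

definition fillings :: "'d cmap \<Rightarrow> 'd set \<Rightarrow> ('d \<Rightarrow> planar_map) set" where
  "fillings q H = (\<Pi>\<^sub>E h\<in>H. Quad (hole_degree q h div 2))"

definition submap :: "'d cmap \<Rightarrow> 'd set \<Rightarrow> planar_map \<Rightarrow> bool" where
  "submap q H p \<longleftrightarrow> (\<exists>u\<in>fillings q H. glues_to q H u p)"

text \<open>The collection of the maps that \<open>p\<close> contains inside the holes of \<open>q\<close>.\<close>

definition hole_maps :: "'d cmap \<Rightarrow> 'd set \<Rightarrow> planar_map \<Rightarrow> 'd \<Rightarrow> planar_map" where
  "hole_maps q H p = (THE u. u \<in> fillings q H \<and> glues_to q H u p)"

text \<open>
  Filling the holes of \<open>q\<close> makes sense if the holes have even degree, every filling yields a planar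
  map, and this map determines the filling. This holds when the holes are bounded by disjoint simple
  cycles. It fails otherwise in general: if a vertex is visited twice by the same hole, a filling
  can pinch the sphere there; if two holes share an edge, that edge may not be recoverable after
  gluing. For such \<open>q\<close> the map \<open>q \<odot> (u h)\<^sub>h\<close>, respectively the collection \<open>hole_maps q H p\<close>, is
  not defined.
\<close>

definition gluable :: "'d cmap \<Rightarrow> 'd set \<Rightarrow> bool" where
  "gluable q H \<longleftrightarrow>
     (\<forall>h\<in>H. even (hole_degree q h)) \<and>
     (\<forall>u\<in>fillings q H. \<exists>p. glues_to q H u p) \<and>
     (\<forall>u\<in>fillings q H. \<forall>u'\<in>fillings q H. \<forall>p. glues_to q H u p \<and> glues_to q H u' p \<longrightarrow> u = u')"


section \<open>Families of laws on quadrangulations with boundary\<close>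

definition partition_function :: "real \<Rightarrow> nat \<Rightarrow> real" where
  "partition_function x l = (\<Sum>\<^sub>\<infinity>m\<in>Quad l. x ^ num_faces m)"

definition boltzmann :: "real \<Rightarrow> nat \<Rightarrow> planar_map pmf \<Rightarrow> bool" where
  "boltzmann x l p \<longleftrightarrow>
     (\<lambda>m. x ^ num_faces m) summable_on Quad l \<and>
     set_pmf p \<subseteq> Quad l \<and>
     (\<forall>m\<in>Quad l. pmf p m = x ^ num_faces m / partition_function x l)"

text \<open>
  The conditional law has to exist for every \<open>q\<close>, so the event \<open>q \<subset> Q\<close> must have positive
  probability. Without this, the uniform laws on plane trees (quadrangulations with no interior
  face, the excluded value 0 of the Boltzmann parameter) would have the Markov property.
\<close>

definition markov_property :: "(nat \<Rightarrow> planar_map pmf) \<Rightarrow> bool" where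
  "markov_property P \<longleftrightarrow>
     (\<forall>l\<ge>1. \<forall>(q :: nat cmap) H.
        quadrangulation_with_holes q H \<and> perimeter q = 2 * l \<and> gluable q H \<longrightarrow>
          measure_pmf.prob (P l) {p. submap q H p} > 0 \<and>
          map_pmf (hole_maps q H) (cond_pmf (P l) {p. submap q H p}) =
            Pi_pmf H undefined (\<lambda>h. P (hole_degree q h div 2)))"

definition uniform_given_faces :: "nat \<Rightarrow> planar_map pmf \<Rightarrow> bool" where
  "uniform_given_faces l p \<longleftrightarrow>
     (\<forall>f. \<forall>m1\<in>Quad_faces l f. \<forall>m2\<in>Quad_faces l f. pmf p m1 = pmf p m2)"

definition rerooting_invariant :: "nat \<Rightarrow> planar_map pmf \<Rightarrow> bool" where
  "rerooting_invariant l p \<longleftrightarrow>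
     (\<forall>m1\<in>Quad l. \<forall>m2\<in>Quad l. rerooting_of m1 m2 \<longrightarrow> pmf p m1 = pmf p m2)"

end

theory Submission
  imports Defs
begin

text \<open>
  Uniformity given the number of faces implies invariance under rerooting, and Boltzmann laws have
  both properties, since the number of faces is additive under gluing. The point is to recover the
  Boltzmann weights from the Markov property and invariance under rerooting.

  Two families of test maps suffice, each with one hole bounded by a simple cycle. Gluing \<open>u\<close> into
  the first one adds to \<open>u\<close> a root edge that cuts off a square; gluing \<open>u\<close> into the second one adds
  a pendant root edge. The Markov property says that each operation multiplies the probability of
  \<open>u\<close> by a constant that depends only on the perimeter. Normalise so that the constants of the
  pendant edges become 1. Adding a square and a pendant edge in either order gives the same map up
  to the position of the root, so the constants of the squares do not depend on the perimeter; their
  common value is the Boltzmann parameter. Every quadrangulation with boundary is obtained, up to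
  rerooting on its boundary, from a single edge by the two operations: remove a boundary edge that
  bounds an interior face or, if there is none, a leaf of a plane tree.
\<close>

section \<open>Orbits of permutations\<close>

text \<open>The Markov property fixes two roots: the glued map keeps the root of the test map, and
  the filling is attached by its own root. Both operations therefore act at the root only;
  invariance under rerooting is what lets the edge to be removed lie anywhere on the boundary and
  lets the two orders of insertion be compared. Removing an edge in front of a square raises the
  perimeter by 2, so the induction must run through all half-perimeters at once, on the number of
  semi-edges. Its base is the single edge, whose probability has to be positive; this comes from the
  positivity clause of \<open>markov_property\<close> for the single edge regarded as a map without
  holes. On the combinatorial side faces and vertices are cycles of permutations, and inserting an
  edge multiplies these permutations by transpositions: a transposition that involves a fixed point
  lengthens a cycle, one that links two cycles merges them. Euler's relation has to be transported
  in both directions, upwards for the extended maps and downwards because what remains after a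
  removal must again be planar.\<close>

abbreviation tr :: "'a \<Rightarrow> 'a \<Rightarrow> 'a \<Rightarrow> 'a" where "tr \<equiv> Transposition.transpose"

lemma self_in_orbit: "f permutes S \<Longrightarrow> finite S \<Longrightarrow> s \<in> orbit f s"
  by (rule permutation_self_in_orbit) (auto simp: permutation_permutes)

lemma orbit_eq_of_mem: "f permutes S \<Longrightarrow> finite S \<Longrightarrow> t \<in> orbit f s \<Longrightarrow> orbit f t = orbit f s"
  by (rule orbit_cyclic_eq3[OF cyclic_on_orbit])

text \<open>As \<open>x\<close> is a fixed point of \<open>f\<close>, the product with the
  transposition sends \<open>a\<close> to \<open>x\<close> and \<open>x\<close> to
  \<open>f a\<close>: the cycle through \<open>a\<close> is lengthened by \<open>x\<close> directly
  after \<open>a\<close>, and no other cycle changes.\<close>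

lemma orbit_insert_point:
  assumes f: "f permutes S" "finite S" and a: "a \<in> S" and x: "x \<notin> S" and s: "s \<in> S"
  defines "g \<equiv> f \<circ> tr a x"
  shows "orbit g s = orbit f s \<union> (if a \<in> orbit f s then {x} else {})"
proof -
  have ga: "g a = x" and gx: "g x = f a" and g: "\<And>z. z \<noteq> a \<Longrightarrow> z \<noteq> x \<Longrightarrow> g z = f z"
    using permutes_not_in[OF f(1) x] by (auto simp: g_def)
  have S: "orbit f s \<subseteq> S"
    using permutes_orbit_subset f s by metis
  have 1: "z \<in> orbit g s" if "z \<in> orbit f s" for z
    using that
  proof induction
    case base
    then show ?case
      using ga gx g[of s] s x orbit.base[of g s] orbit.step[of "g s" g s] by (cases "s = a"; cases "s = x") auto
  next
    case (step z)
    then show ?case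
      using ga gx g[of z] S x orbit.step[of z g s] orbit.step[of "g z" g s] by (cases "z = a"; cases "z = x") auto
  qed
  have 2: "z \<in> orbit f s \<or> (z = x \<and> a \<in> orbit f s)" if "z \<in> orbit g s" for z
    using that
  proof induction
    case base
    then show ?case
      using ga g[of s] s x orbit.base[of f s] self_in_orbit[OF f, of s] by (cases "s = a"; cases "s = x") auto
  next
    case (step z)
    then show ?case
      using ga gx g[of z] S x orbit.step[of z f s] orbit.step[of a f s] by (cases "z = a"; cases "z = x") auto
  qed
  have "x \<in> orbit g s" if "a \<in> orbit f s"
    using orbit.step[OF 1[OF that]] ga by simp
  with 1 2 show ?thesis by auto
qed

text \<open>The new point joins an existing cycle, and deleting it again inverts the correspondence
  between the cycles.\<close>

lemma card_orbits_insert_point: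
  assumes f: "f permutes S" "finite S" and a: "a \<in> S" and x: "x \<notin> S"
  defines "g \<equiv> f \<circ> tr a x"
  shows "card (orbit g ` insert x S) = card (orbit f ` S)"
proof -
  define k where "k X = X \<union> (if a \<in> X then {x} else {})" for X
  have perm: "g permutes insert x S"
    unfolding g_def using f a
    by (intro permutes_compose permutes_swap_id) (auto intro: permutes_subset)
  have "g a = x"
    using permutes_not_in[OF f(1) x] by (simp add: g_def)
  then have "orbit g x = orbit g a"
    using orbit_eq_of_mem[OF perm, of x a] f(2) orbit.base[of g a] by simp
  then have "orbit g ` insert x S = orbit g ` S"
    using a by auto
  also have "\<dots> = k ` orbit f ` S"
    using orbit_insert_point[OF f a x] unfolding image_image k_def g_def
    by (intro image_cong) auto
  also have "card \<dots> = card (orbit f ` S)"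
  proof (rule card_image, rule inj_on_inverseI)
    fix X assume "X \<in> orbit f ` S"
    then have "X \<subseteq> S" using permutes_orbit_subset[OF f(1)] by auto
    then show "k X - {x} = X" using x by (auto simp: k_def)
  qed
  finally show ?thesis .
qed

text \<open>The transposition exchanges the successors of \<open>x\<close> and \<open>y\<close>, so
  a walk that reaches \<open>x\<close> continues in the cycle of \<open>y\<close> and conversely;
  the two cycles are traversed one after the other.\<close>

lemma orbit_join:
  assumes f: "f permutes S" "finite S" and x: "x \<in> S" and y: "y \<in> S" and xy: "y \<notin> orbit f x"
  defines "g \<equiv> f \<circ> tr x y"
  shows "orbit g x = orbit f x \<union> orbit f y"
    and "s \<notin> orbit f x \<union> orbit f y \<Longrightarrow> orbit g s = orbit f s"
proof -
  have gx: "g x = f y" and gy: "g y = f x" and g: "\<And>z. z \<noteq> x \<Longrightarrow> z \<noteq> y \<Longrightarrow> g z = f z"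
    by (auto simp: g_def)
  have slf: "z \<in> orbit f z" for z
    using self_in_orbit[OF f] .
  have yx: "x \<notin> orbit f y"
    using xy orbit_eq_of_mem[OF f] slf by metis
  have y1: "z \<in> orbit g x" if "z \<in> orbit f y" for z
    using that
  proof induction
    case base
    show ?case using orbit.base[of g x] gx by simp
  next
    case (step z)
    then show ?case
      using orbit.step[of z g x] orbit.base[of g x] gx g[of z] yx by (cases "z = y"; cases "z = x") auto
  qed
  have x1: "z \<in> orbit g x" if "z \<in> orbit f x" for z
    using that
  proof induction
    case base
    show ?case using orbit.step[OF y1[OF slf]] gy by simp
  next
    case (step z)
    then show ?case
      using orbit.step[of z g x] orbit.step[OF y1[OF slf]] gy g[of z] xy by (cases "z = x"; cases "z = y") auto
  qed
  have "z \<in> orbit f x \<union> orbit f y" if "z \<in> orbit g x" for z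
    using that
  proof induction
    case base
    show ?case using gx orbit.base[of f y] by simp
  next
    case (step z)
    then show ?case
      using gx gy g[of z] orbit.base[of f x] orbit.base[of f y] orbit.step[of z f x] orbit.step[of z f y]
      by (cases "z = x"; cases "z = y") auto
  qed
  with x1 y1 show "orbit g x = orbit f x \<union> orbit f y" by blast
  show "orbit g s = orbit f s" if s: "s \<notin> orbit f x \<union> orbit f y"
  proof (rule orbit_cong[OF slf])
    fix z assume "z \<in> orbit f s"
    then have "orbit f z = orbit f s" using orbit_eq_of_mem[OF f] by blast
    then have "z \<noteq> x" "z \<noteq> y" using s slf[of s] by auto
    then show "g z = f z" using g by simp
  qed
qed

text \<open>The equation is solved for the cycles of \<open>f\<close> because in the application to
  an inserted edge \<open>f\<close> is the face permutation of the larger map, where the two faces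
  are still separate.\<close>

lemma card_orbits_join:
  assumes f: "f permutes S" "finite S" and x: "x \<in> S" and y: "y \<in> S" and xy: "y \<notin> orbit f x"
  defines "g \<equiv> f \<circ> tr x y"
  shows "orbit f ` S = {orbit f x, orbit f y} \<union> (orbit g ` S - {orbit f x \<union> orbit f y})"
    and "card (orbit g ` S) + 1 = card (orbit f ` S)"
proof -
  have gp: "g permutes S"
    unfolding g_def using f x y by (intro permutes_compose permutes_swap_id)
  have slf: "z \<in> orbit f z" for z
    using self_in_orbit[OF f] .
  have gslf: "z \<in> orbit g z" for z
    using self_in_orbit[OF gp f(2)] .
  have ne: "orbit f x \<noteq> orbit f y"
    using xy slf[of y] by auto
  have gx: "orbit g x = orbit f x \<union> orbit f y"
    and g: "\<And>s. s \<notin> orbit f x \<union> orbit f y \<Longrightarrow> orbit g s = orbit f s"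
    unfolding g_def using orbit_join[OF f x y xy] by auto
  have g': "orbit g s = orbit f x \<union> orbit f y" if "s \<in> orbit f x \<union> orbit f y" for s
    using orbit_eq_of_mem[OF gp f(2), of s x] that gx by simp
  have inS: "orbit f x \<subseteq> S" "orbit f y \<subseteq> S"
    using permutes_orbit_subset[OF f(1)] x y by auto
  have fs: "orbit f s \<in> {orbit f x, orbit f y}" if "s \<in> orbit f x \<union> orbit f y" for s
    using that orbit_eq_of_mem[OF f] by auto
  show eq: "orbit f ` S = {orbit f x, orbit f y} \<union> (orbit g ` S - {orbit f x \<union> orbit f y})"
    (is "_ = _ \<union> ?R")
  proof (intro subset_antisym subsetI)
    fix X assume "X \<in> orbit f ` S"
    then obtain s where s: "s \<in> S" "X = orbit f s" by auto
    show "X \<in> {orbit f x, orbit f y} \<union> ?R"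
    proof (cases "s \<in> orbit f x \<union> orbit f y")
      case True
      then show ?thesis using fs s by auto
    next
      case False
      then show ?thesis using g[of s] s gslf[of s] by auto
    qed
  next
    fix X assume X: "X \<in> {orbit f x, orbit f y} \<union> ?R"
    show "X \<in> orbit f ` S"
    proof (cases "X \<in> {orbit f x, orbit f y}")
      case True
      then show ?thesis using x y by auto
    next
      case False
      then obtain s where s: "s \<in> S" "X = orbit g s" "X \<noteq> orbit f x \<union> orbit f y" using X by auto
      then show ?thesis using g[of s] g'[of s] by auto
    qed
  qed
  have "orbit f x \<notin> ?R" "orbit f y \<notin> ?R"
  proof -
    have "X \<notin> orbit g ` S - {orbit f x \<union> orbit f y}" if "z \<in> X" "z \<in> orbit f x \<union> orbit f y" for X z
    proof
      assume "X \<in> orbit g ` S - {orbit f x \<union> orbit f y}"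
      then obtain s where "X = orbit g s" "X \<noteq> orbit f x \<union> orbit f y" by auto
      then show False using orbit_eq_of_mem[OF gp f(2), of z s] g'[OF that(2)] that(1) by auto
    qed
    then show "orbit f x \<notin> ?R" "orbit f y \<notin> ?R" using slf[of x] slf[of y] by blast+
  qed
  then have "card ({orbit f x, orbit f y} \<union> ?R) = card ?R + 2"
    using ne f(2) by simp
  moreover have "card ?R + 1 = card (orbit g ` S)"
  proof -
    have "orbit f x \<union> orbit f y \<in> orbit g ` S"
      using gx x by (metis imageI)
    then show ?thesis
      using f(2) by (metis Suc_eq_plus1 card_Suc_Diff1 finite_imageI)
  qed
  ultimately show "card (orbit g ` S) + 1 = card (orbit f ` S)"
    using eq by simp
qed

section \<open>Surface maps\<close>

text \<open>The local axioms of \<open>planar_cmap\<close>, without root, connectedness and Euler's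
  relation: the part that is checked directly when an edge is inserted or removed, before the global
  conditions are transferred.\<close>

definition surface_map :: "'d cmap \<Rightarrow> bool" where
  "surface_map M \<longleftrightarrow> finite (semi M) \<and> opp_semi M permutes semi M \<and>
     (\<forall>s\<in>semi M. opp_semi M s \<noteq> s \<and> opp_semi M (opp_semi M s) = s) \<and> next_semi M permutes semi M"

lemma planar_cmap_iff:
  "planar_cmap M \<longleftrightarrow> surface_map M \<and> root_semi M \<in> semi M \<and> connected_map M \<and>
     card (vertices M) + card (faces M) = card (edges M) + 2"
  by (auto simp: planar_cmap_def surface_map_def)

text \<open>The set of semi-edges reachable from a given one is closed under both permutations, and
  a closed set contains all that is reachable from its members. In this form a closed set can be
  carried over to a map with one edge more or less.\<close>

lemma connected_map_iff:
  assumes "surface_map M"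
  shows "connected_map M \<longleftrightarrow>
    (\<forall>A\<subseteq>semi M. A \<noteq> {} \<longrightarrow> (\<forall>s\<in>A. opp_semi M s \<in> A \<and> next_semi M s \<in> A) \<longrightarrow> A = semi M)"
    (is "_ \<longleftrightarrow> ?R")
proof
  let ?E = "{(x, y). x \<in> semi M \<and> (y = opp_semi M x \<or> y = next_semi M x)}"
  assume c: "connected_map M"
  show ?R
  proof (intro allI impI subset_antisym subsetI)
    fix A t assume A: "A \<subseteq> semi M" "A \<noteq> {}" "\<forall>s\<in>A. opp_semi M s \<in> A \<and> next_semi M s \<in> A" and t: "t \<in> semi M"
    obtain s where s: "s \<in> A" using A by auto
    have "(s, t) \<in> ?E\<^sup>*" using c s A t unfolding connected_map_def by blast
    then show "t \<in> A" by induction (use s A in auto)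
  qed auto
next
  let ?E = "{(x, y). x \<in> semi M \<and> (y = opp_semi M x \<or> y = next_semi M x)}"
  assume R: ?R
  show "connected_map M"
    unfolding connected_map_def
  proof (intro ballI)
    fix s t assume st: "s \<in> semi M" "t \<in> semi M"
    let ?A = "{z \<in> semi M. (s, z) \<in> ?E\<^sup>*}"
    have cl: "opp_semi M z \<in> semi M" "next_semi M z \<in> semi M" if "z \<in> semi M" for z
      using that assms by (auto simp: surface_map_def permutes_in_image)
    have "?A = semi M"
      by (rule R[rule_format]) (use st cl in \<open>auto intro: rtrancl_into_rtrancl\<close>)
    then show "(s, t) \<in> ?E\<^sup>*" using st by blast
  qed
qed

lemma surface_map_in:
  assumes "surface_map M"
  shows "next_semi M s \<in> semi M \<longleftrightarrow> s \<in> semi M" "opp_semi M s \<in> semi M \<longleftrightarrow> s \<in> semi M"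
  using assms by (auto simp: surface_map_def permutes_in_image)

lemma surface_map_opp_opp: "surface_map M \<Longrightarrow> opp_semi M (opp_semi M s) = s"
  by (cases "s \<in> semi M") (auto simp: surface_map_def permutes_not_in)

lemma surface_map_next_inj: "surface_map M \<Longrightarrow> next_semi M s = next_semi M t \<longleftrightarrow> s = t"
  by (meson surface_map_def inj_eq permutes_inj)

lemma surface_map_permutes:
  assumes "surface_map M"
  shows "next_semi M permutes semi M" "opp_semi M permutes semi M" "finite (semi M)"
    "next_semi M \<circ> opp_semi M permutes semi M"
  using assms by (auto simp: surface_map_def permutes_compose)

lemma self_in_face: "surface_map M \<Longrightarrow> s \<in> face_at M s"
  unfolding face_at_def using self_in_orbit surface_map_permutes by metis

lemma face_at_eq: "surface_map M \<Longrightarrow> t \<in> face_at M s \<Longrightarrow> face_at M t = face_at M s"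
  unfolding face_at_def using orbit_eq_of_mem surface_map_permutes by metis

lemma face_at_subset: "surface_map M \<Longrightarrow> s \<in> semi M \<Longrightarrow> face_at M s \<subseteq> semi M"
  unfolding face_at_def using permutes_orbit_subset surface_map_permutes by metis

lemma next_in_face: "surface_map M \<Longrightarrow> t \<in> face_at M s \<Longrightarrow> next_semi M t \<in> face_at M s"
  unfolding face_at_def by (rule orbit.step)

lemma finite_face: "surface_map M \<Longrightarrow> finite (face_at M s)"
  unfolding face_at_def by (metis surface_map_permutes(1,3) finite_orbit self_in_orbit)

text \<open>The edges are pairs that partition the semi-edges. Since only \<open>surface_map\<close>
  is assumed, the count applies to any fixed-point-free involution put in the place of
  \<open>opp_semi\<close>; the vertices of a cycle are counted in this way later.\<close>

lemma card_edges:
  assumes "surface_map M"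
  shows "2 * card (edges M) = card (semi M)"
proof -
  have cl: "opp_semi M s \<in> semi M" "s \<noteq> opp_semi M s" "opp_semi M (opp_semi M s) = s" if "s \<in> semi M" for s
    using that assms surface_map_in[OF assms] by (force simp: surface_map_def)+
  have "2 * card (edges M) = card (\<Union>(edges M))"
  proof (rule card_partition)
    show "finite (edges M)" "finite (\<Union>(edges M))"
      using assms by (auto simp: edges_def surface_map_def)
    show "card e = 2" if "e \<in> edges M" for e
      using that cl by (auto simp: edges_def)
    show "e \<inter> e' = {}" if "e \<in> edges M" "e' \<in> edges M" "e \<noteq> e'" for e e'
      using that cl by (auto simp: edges_def) metis+
  qed
  also have "\<Union>(edges M) = semi M"
    using cl by (auto simp: edges_def)
  finally show ?thesis .
qed

subsection \<open>Inserting an edge into a face\<close>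

text \<open>The new edge has the two sides \<open>x\<close> and \<open>y\<close>; it joins the corner following \<open>p\<close> to the one
  following \<open>q\<close>. If \<open>p\<close> and \<open>q\<close> lie in one face, it splits this face.\<close>

definition add_edge :: "'d \<Rightarrow> 'd \<Rightarrow> 'd \<Rightarrow> 'd \<Rightarrow> 'd cmap \<Rightarrow> 'd cmap" where
  "add_edge x y p q U =
     \<lparr>semi = insert x (insert y (semi U)), opp_semi = opp_semi U \<circ> tr x y,
      next_semi = next_semi U \<circ> tr p q \<circ> tr p x \<circ> tr q y, root_semi = x\<rparr>"

locale edge_insertion =
  fixes U :: "'d cmap" and x y p q :: 'd
  assumes U: "surface_map U" and new: "x \<notin> semi U" "y \<notin> semi U" "x \<noteq> y"
    and pq: "p \<in> semi U" "q \<in> semi U" "p \<noteq> q"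
begin

abbreviation "M \<equiv> add_edge x y p q U"

lemma distinct: "p \<noteq> x" "p \<noteq> y" "q \<noteq> x" "q \<noteq> y"
  using new pq by auto

text \<open>Of the three transpositions, \<open>tr p q\<close> exchanges the successors of
  \<open>p\<close> and \<open>q\<close>, and the other two insert \<open>x\<close> after
  \<open>p\<close> and \<open>y\<close> after \<open>q\<close>. Hence \<open>x\<close> is followed
  by what followed \<open>q\<close>, and \<open>y\<close> by what followed \<open>p\<close>.\<close>

lemma next_simps:
  "next_semi M p = x" "next_semi M q = y" "next_semi M x = next_semi U q" "next_semi M y = next_semi U p"
  "s \<notin> {p, q, x, y} \<Longrightarrow> next_semi M s = next_semi U s"
  using new pq distinct surface_map_permutes[OF U] permutes_not_in[of "next_semi U" "semi U"]
  by (auto simp: add_edge_def Transposition.transpose_def)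

lemma opp_simps:
  "opp_semi M x = y" "opp_semi M y = x" "s \<notin> {x, y} \<Longrightarrow> opp_semi M s = opp_semi U s"
  using new surface_map_permutes[OF U] permutes_not_in[of "opp_semi U" "semi U"]
  by (auto simp: add_edge_def Transposition.transpose_def)

lemma semi_add: "semi M = insert x (insert y (semi U))" and root_add: "root_semi M = x"
  by (simp_all add: add_edge_def)

lemma closed: "surface_map M"
proof -
  have "opp_semi M permutes semi M" "next_semi M permutes semi M"
    unfolding add_edge_def using surface_map_permutes[OF U] pq
    by (auto intro!: permutes_compose permutes_swap_id intro: permutes_subset)
  moreover have "opp_semi M s \<noteq> s \<and> opp_semi M (opp_semi M s) = s" if "s \<in> semi M" for s
  proof (cases "s \<in> {x, y}")
    case True
    then show ?thesis using opp_simps new by auto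
  next
    case False
    then have "s \<in> semi U" using that semi_add by auto
    then have "opp_semi U s \<in> semi U" "opp_semi U s \<noteq> s" "opp_semi U (opp_semi U s) = s"
      using U surface_map_in[OF U] by (auto simp: surface_map_def)
    moreover from this have "opp_semi U s \<notin> {x, y}" using new by auto
    ultimately show ?thesis using False opp_simps by auto
  qed
  ultimately show ?thesis
    using U by (auto simp: surface_map_def semi_add)
qed

lemma card_edges_add: "card (edges M) = card (edges U) + 1"
  using card_edges[OF U] card_edges[OF closed] new surface_map_permutes[OF U] by (simp add: semi_add)

text \<open>Both sides of the new edge start at existing vertices: in the rotation
  \<open>next_semi U \<circ> opp_semi U\<close>, \<open>x\<close> is inserted after
  \<open>opp_semi U p\<close> and \<open>y\<close> after \<open>opp_semi U q\<close>.\<close>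

lemma card_vertices_add: "card (vertices M) = card (vertices U)"
proof -
  let ?n = "next_semi U \<circ> opp_semi U"
  let ?a = "opp_semi U p" and ?b = "opp_semi U q"
  have ab: "?a \<in> semi U" "?b \<in> semi U" using pq surface_map_in[OF U] by auto
  have oo: "opp_semi U (opp_semi U s) = s" for s using surface_map_opp_opp[OF U] .
  have abn: "?a \<noteq> ?b" "?a \<noteq> x" "?a \<noteq> y" "?b \<noteq> x" "?b \<noteq> y"
    using ab new pq oo by metis+
  have fixd: "next_semi U x = x" "next_semi U y = y" "opp_semi U x = x" "opp_semi U y = y"
    using new surface_map_permutes[OF U] permutes_not_in by metis+
  have eq: "next_semi M \<circ> opp_semi M = ?n \<circ> tr ?a x \<circ> tr ?b y"
  proof
    fix s
    consider "s = x" | "s = y" | "s = ?a" | "s = ?b" | "s \<notin> {x, y, ?a, ?b}" by blast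
    then show "(next_semi M \<circ> opp_semi M) s = (?n \<circ> tr ?a x \<circ> tr ?b y) s"
    proof cases
      case 5
      then have "opp_semi U s \<notin> {p, q, x, y}" using oo fixd by (metis insert_iff singletonD)
      then show ?thesis using 5 opp_simps(3) next_simps(5) by (simp add: Transposition.transpose_def)
    qed (use abn new in \<open>auto simp: opp_simps next_simps oo fixd Transposition.transpose_def\<close>)
  qed
  have n: "?n permutes semi U" "finite (semi U)"
    using surface_map_permutes[OF U] by auto
  have n2: "?n \<circ> tr ?a x permutes insert x (semi U)"
    using ab by (intro permutes_compose[OF permutes_swap_id permutes_subset[OF n(1)]]) auto
  have "card (vertices M) = card (orbit (?n \<circ> tr ?a x \<circ> tr ?b y) ` insert y (insert x (semi U)))"
    unfolding vertices_def eq semi_add by (simp add: insert_commute)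
  also have "\<dots> = card (orbit (?n \<circ> tr ?a x) ` insert x (semi U))"
    by (rule card_orbits_insert_point[OF n2]) (use n ab new in auto)
  also have "\<dots> = card (orbit ?n ` semi U)"
    by (rule card_orbits_insert_point[OF n]) (use ab new in auto)
  finally show ?thesis unfolding vertices_def .
qed

text \<open>The face permutation of \<open>U\<close> with \<open>x\<close> inserted after
  \<open>p\<close> and \<open>y\<close> after \<open>q\<close>, but with no exchange of successors.
  It is also the face permutation of \<open>M\<close> times \<open>tr x y\<close>, so it is an
  intermediate term through which the faces of \<open>U\<close> and \<open>M\<close> are
  compared.\<close>

definition "joined = next_semi U \<circ> tr p x \<circ> tr q y"

lemma joined_eq: "joined = next_semi M \<circ> tr x y"
  using new pq distinct by (auto simp: joined_def add_edge_def Transposition.transpose_def fun_eq_iff)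

lemma orbit_joined:
  assumes "s \<in> semi U"
  shows "orbit joined s = face_at U s \<union> {z. z = x \<and> p \<in> face_at U s \<or> z = y \<and> q \<in> face_at U s}"
proof -
  have n: "next_semi U permutes semi U" "finite (semi U)"
    using surface_map_permutes[OF U] by auto
  have n2: "next_semi U \<circ> tr p x permutes insert x (semi U)"
    using n pq by (intro permutes_compose permutes_swap_id) (auto intro: permutes_subset)
  have "orbit (next_semi U \<circ> tr p x) s = face_at U s \<union> (if p \<in> face_at U s then {x} else {})"
    unfolding face_at_def using orbit_insert_point[OF n pq(1) new(1) assms] .
  moreover have "orbit joined s = orbit (next_semi U \<circ> tr p x) s \<union> (if q \<in> orbit (next_semi U \<circ> tr p x) s then {y} else {})"
    unfolding joined_def by (rule orbit_insert_point[OF n2]) (use assms pq new n in auto)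
  ultimately show ?thesis
    using distinct by auto
qed

lemma card_orbits_joined: "card (orbit joined ` semi M) = card (faces U)"
proof -
  have n: "next_semi U permutes semi U" "finite (semi U)"
    using surface_map_permutes[OF U] by auto
  have n2: "next_semi U \<circ> tr p x permutes insert x (semi U)"
    using n pq by (intro permutes_compose permutes_swap_id) (auto intro: permutes_subset)
  have "card (orbit joined ` semi M) = card (orbit joined ` insert y (insert x (semi U)))"
    by (simp add: semi_add insert_commute)
  also have "\<dots> = card (orbit (next_semi U \<circ> tr p x) ` insert x (semi U))"
    unfolding joined_def by (rule card_orbits_insert_point[OF n2]) (use n pq new in auto)
  also have "\<dots> = card (orbit (next_semi U) ` semi U)"
    by (rule card_orbits_insert_point[OF n]) (use pq new in auto)
  finally show ?thesis unfolding faces_def face_at_def by simp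
qed

lemma joined_permutes: "joined permutes semi M"
  unfolding joined_eq using surface_map_permutes[OF closed] semi_add
  by (intro permutes_compose permutes_swap_id) auto

text \<open>If \<open>x\<close> and \<open>y\<close> lie on different faces of \<open>M\<close>,
  these two merge into one cycle of \<open>joined\<close>. There \<open>x\<close> comes directly
  after \<open>p\<close> and \<open>y\<close> directly after \<open>q\<close>, and deleting
  \<open>x\<close> and \<open>y\<close> leaves one face of \<open>U\<close>.\<close>

lemma face_union:
  assumes "y \<notin> face_at M x"
  shows "q \<in> face_at U p" and "face_at M x \<union> face_at M y = insert x (insert y (face_at U p))"
proof -
  have m: "next_semi M permutes semi M" "finite (semi M)" "x \<in> semi M" "y \<in> semi M"
    using surface_map_permutes[OF closed] semi_add by auto
  have J: "orbit joined x = face_at M x \<union> face_at M y"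
    unfolding joined_eq face_at_def using orbit_join(1)[OF m] assms by (simp add: face_at_def)
  have "joined p = x" unfolding joined_eq using next_simps distinct by (simp add: Transposition.transpose_def)
  then have px: "orbit joined x = orbit joined p"
    using orbit_eq_of_mem[OF joined_permutes m(2), of x p] orbit.base[of joined p] by simp
  have y: "y \<in> orbit joined p" using px J self_in_face[OF closed, of y] by auto
  then show "q \<in> face_at U p"
    using orbit_joined[OF pq(1)] face_at_subset[OF U pq(1)] new by auto
  then show "face_at M x \<union> face_at M y = insert x (insert y (face_at U p))"
    using J px orbit_joined[OF pq(1)] self_in_face[OF U, of p] by auto
qed

text \<open>Apart from the merged cycle, the cycles of \<open>joined\<close> contain neither
  \<open>x\<close> nor \<open>y\<close>; they are faces of \<open>U\<close> as well as of
  \<open>M\<close>.\<close>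

lemma faces_split:
  assumes "y \<notin> face_at M x"
  shows "faces M = {face_at M x, face_at M y} \<union> (faces U - {face_at U p})"
    and "card (faces M) = card (faces U) + 1"
proof -
  have m: "next_semi M permutes semi M" "finite (semi M)" "x \<in> semi M" "y \<in> semi M" "y \<notin> orbit (next_semi M) x"
    using surface_map_permutes[OF closed] semi_add assms by (auto simp: face_at_def)
  show "card (faces M) = card (faces U) + 1"
    using card_orbits_join(2)[OF m] card_orbits_joined unfolding joined_eq faces_def face_at_def by simp
  let ?O = "face_at M x \<union> face_at M y"
  have slf: "z \<in> face_at U z" for z by (rule self_in_face[OF U])
  have slfj: "z \<in> orbit joined z" for z by (rule self_in_orbit[OF joined_permutes m(2)])
  have O: "?O = orbit joined x" unfolding joined_eq face_at_def using orbit_join(1)[OF m] by simp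
  have "orbit joined ` semi M - {?O} = faces U - {face_at U p}"
  proof (intro subset_antisym subsetI)
    fix X assume X: "X \<in> orbit joined ` semi M - {?O}"
    then obtain s where s: "s \<in> semi M" "X = orbit joined s" "X \<noteq> ?O" by auto
    have "s \<notin> ?O" using s O orbit_eq_of_mem[OF joined_permutes m(2)] by auto
    then have sn: "s \<notin> face_at U p" "s \<in> semi U"
      using face_union(2)[OF assms] s semi_add by auto
    then have "p \<notin> face_at U s" "q \<notin> face_at U s"
      using face_at_eq[OF U] slf face_union(1)[OF assms] by metis+
    then have "X = face_at U s" using orbit_joined[OF sn(2)] s by auto
    then show "X \<in> faces U - {face_at U p}" using sn slf[of s] by (auto simp: faces_def)
  next
    fix X assume X: "X \<in> faces U - {face_at U p}"
    then obtain s where s: "s \<in> semi U" "X = face_at U s" "X \<noteq> face_at U p" by (auto simp: faces_def)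
    then have "p \<notin> face_at U s" "q \<notin> face_at U s"
      using face_at_eq[OF U] face_union(1)[OF assms] by metis+
    then have eq: "X = orbit joined s" using orbit_joined[OF s(1)] s by auto
    have "s \<notin> ?O" using face_union(2)[OF assms] s face_at_eq[OF U] new by auto
    then have "X \<noteq> ?O" using eq slfj[of s] by auto
    then show "X \<in> orbit joined ` semi M - {?O}" using eq s semi_add by auto
  qed
  then show "faces M = {face_at M x, face_at M y} \<union> (faces U - {face_at U p})"
    using card_orbits_join(1)[OF m] unfolding joined_eq faces_def face_at_def by simp
qed

lemma connected_add:
  assumes "connected_map U"
  shows "connected_map M"
  unfolding connected_map_iff[OF closed]
proof (intro allI impI)
  fix A assume A: "A \<subseteq> semi M" "A \<noteq> {}" "\<forall>s\<in>A. opp_semi M s \<in> A \<and> next_semi M s \<in> A"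
  let ?B = "A \<inter> semi U"
  have nU: "next_semi U s \<in> semi U \<longleftrightarrow> s \<in> semi U" "opp_semi U s \<in> semi U \<longleftrightarrow> s \<in> semi U" for s
    using surface_map_in[OF U] by auto
  have ne: "?B \<noteq> {}"
  proof -
    obtain s where s: "s \<in> A" using A by auto
    have "next_semi M x \<in> semi U" "next_semi M y \<in> semi U" using next_simps nU pq by auto
    moreover have "s \<in> {x, y} \<or> s \<in> semi U" using s A semi_add by auto
    ultimately show ?thesis using s A(3) by auto
  qed
  have xyA: "x \<in> A \<longleftrightarrow> y \<in> A" using A(3) opp_simps by metis
  have "opp_semi U s \<in> ?B \<and> next_semi U s \<in> ?B" if "s \<in> ?B" for s
  proof -
    have s: "s \<in> A" "s \<in> semi U" "s \<notin> {x, y}" using that new by auto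
    have 1: "opp_semi M s \<in> A" "next_semi M s \<in> A" using s A(3) by auto
    have 2: "next_semi M x \<in> A" "next_semi M y \<in> A" if "x \<in> A" using that xyA A(3) by auto
    have "next_semi U s \<in> A"
      using 1 2 xyA s next_simps by (cases "s = p"; cases "s = q") auto
    then show ?thesis using 1 s opp_simps nU by auto
  qed
  then have B: "?B = semi U"
    using assms ne unfolding connected_map_iff[OF U] by auto
  then have "x \<in> A" using A(3) next_simps(1) pq(1) by force
  then show "A = semi M" using B A(1) xyA semi_add by auto
qed

text \<open>The hypothesis on \<open>q\<close> excludes that the edge links two components: a closed
  set of \<open>U\<close> contains both \<open>p\<close> and \<open>q\<close> or neither, so adding
  \<open>x\<close> and \<open>y\<close> in the first case gives a closed set of
  \<open>M\<close>.\<close>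

lemma connected_remove:
  assumes "connected_map M" "q \<in> face_at U p"
  shows "connected_map U"
  unfolding connected_map_iff[OF U]
proof (intro allI impI)
  fix A assume A: "A \<subseteq> semi U" "A \<noteq> {}" "\<forall>s\<in>A. opp_semi U s \<in> A \<and> next_semi U s \<in> A"
  have orb: "z \<in> A" if "z \<in> face_at U s" "s \<in> A" for z s
    using that(1) unfolding face_at_def by induction (use that A in auto)
  have pqA: "p \<in> A \<longleftrightarrow> q \<in> A"
    using orb assms(2) face_at_eq[OF U assms(2)] self_in_face[OF U] by metis
  define B where "B = A \<union> (if p \<in> A then {x, y} else {})"
  have "opp_semi M s \<in> B \<and> next_semi M s \<in> B" if "s \<in> B" for s
  proof (cases "s \<in> {x, y}")
    case True
    then have "p \<in> A" using that A new by (auto simp: B_def split: if_splits)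
    then have "next_semi U p \<in> A" "next_semi U q \<in> A" using A pqA by auto
    then show ?thesis using True \<open>p \<in> A\<close> by (auto simp: B_def next_simps opp_simps)
  next
    case False
    then have s: "s \<in> A" using that by (auto simp: B_def split: if_splits)
    then have "opp_semi U s \<in> A" "next_semi U s \<in> A" using A by auto
    moreover have "opp_semi M s = opp_semi U s"
      using False opp_simps(3) by simp
    moreover have "next_semi M s \<in> B"
    proof -
      consider "s = p" | "s = q" | "s \<notin> {p, q, x, y}" using False by auto
      then show ?thesis
        using s pqA next_simps(1,2,5) calculation by cases (simp_all add: B_def)
    qed
    ultimately show ?thesis
      by (simp add: B_def)
  qed
  moreover have "B \<subseteq> semi M" "B \<noteq> {}" using A semi_add by (auto simp: B_def)
  ultimately have "B = semi M"
    using assms(1) unfolding connected_map_iff[OF closed] by auto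
  moreover have "A = B - {x, y}"
    using A(1) new by (auto simp: B_def)
  ultimately show "A = semi U"
    using new semi_add by auto
qed

text \<open>Vertices are kept while edges and faces each gain one, so Euler's relation passes in
  both directions.\<close>

lemma planar_add_iff:
  assumes "y \<notin> face_at M x" "root_semi U \<in> semi U"
  shows "planar_cmap M \<longleftrightarrow> planar_cmap U"
  using connected_add connected_remove[OF _ face_union(1)[OF assms(1)]] assms(2)
    card_vertices_add card_edges_add faces_split(2)[OF assms(1)] U closed root_add semi_add
  unfolding planar_cmap_iff by auto

end

subsection \<open>Inserting a pendant edge\<close>

text \<open>Both transpositions involve \<open>p\<close>, so \<open>y\<close> is inserted between
  \<open>p\<close> and \<open>x\<close>. Around the face \<open>y\<close> runs to the new vertex and
  \<open>x\<close> comes back from it; the root edge is thus oriented away from the leaf.\<close>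

definition add_leaf :: "'d \<Rightarrow> 'd \<Rightarrow> 'd \<Rightarrow> 'd cmap \<Rightarrow> 'd cmap" where
  "add_leaf x y p U =
     \<lparr>semi = insert x (insert y (semi U)), opp_semi = opp_semi U \<circ> tr x y,
      next_semi = next_semi U \<circ> tr p x \<circ> tr p y, root_semi = x\<rparr>"

locale leaf_insertion =
  fixes U :: "'d cmap" and x y p :: 'd
  assumes U: "surface_map U" and new: "x \<notin> semi U" "y \<notin> semi U" "x \<noteq> y" and p: "p \<in> semi U"
begin

abbreviation "M \<equiv> add_leaf x y p U"

lemma distinct: "p \<noteq> x" "p \<noteq> y"
  using new p by auto

lemma next_simps:
  "next_semi M p = y" "next_semi M y = x" "next_semi M x = next_semi U p"
  "s \<notin> {p, x, y} \<Longrightarrow> next_semi M s = next_semi U s"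
  using new p distinct surface_map_permutes[OF U] permutes_not_in[of "next_semi U" "semi U"]
  by (auto simp: add_leaf_def Transposition.transpose_def)

lemma opp_simps:
  "opp_semi M x = y" "opp_semi M y = x" "s \<notin> {x, y} \<Longrightarrow> opp_semi M s = opp_semi U s"
  using new surface_map_permutes[OF U] permutes_not_in[of "opp_semi U" "semi U"]
  by (auto simp: add_leaf_def Transposition.transpose_def)

lemma semi_add: "semi M = insert x (insert y (semi U))" and root_add: "root_semi M = x"
  by (simp_all add: add_leaf_def)

lemma closed: "surface_map M"
proof -
  have "opp_semi M permutes semi M" "next_semi M permutes semi M"
    unfolding add_leaf_def using surface_map_permutes[OF U] p
    by (auto intro!: permutes_compose permutes_swap_id intro: permutes_subset)
  moreover have "opp_semi M s \<noteq> s \<and> opp_semi M (opp_semi M s) = s" if "s \<in> semi M" for s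
  proof (cases "s \<in> {x, y}")
    case True
    then show ?thesis using opp_simps new by auto
  next
    case False
    then have "s \<in> semi U" using that semi_add by auto
    then have "opp_semi U s \<in> semi U" "opp_semi U s \<noteq> s" "opp_semi U (opp_semi U s) = s"
      using U surface_map_in[OF U] by (auto simp: surface_map_def)
    moreover from this have "opp_semi U s \<notin> {x, y}" using new by auto
    ultimately show ?thesis using False opp_simps by auto
  qed
  ultimately show ?thesis
    using U by (auto simp: surface_map_def semi_add)
qed

lemma card_edges_add: "card (edges M) = card (edges U) + 1"
  using card_edges[OF U] card_edges[OF closed] new surface_map_permutes[OF U] by (simp add: semi_add)

text \<open>The rotation fixes \<open>x\<close>, which forms the new vertex alone, while
  \<open>y\<close> is inserted after \<open>opp_semi U p\<close> in an old vertex.\<close>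

lemma card_vertices_add: "card (vertices M) = card (vertices U) + 1"
proof -
  let ?n = "next_semi U \<circ> opp_semi U"
  let ?a = "opp_semi U p"
  have ab: "?a \<in> semi U" using p surface_map_in[OF U] by auto
  have oo: "opp_semi U (opp_semi U s) = s" for s using surface_map_opp_opp[OF U] .
  have abn: "?a \<noteq> x" "?a \<noteq> y"
    using ab new by auto
  have fixd: "next_semi U x = x" "next_semi U y = y" "opp_semi U x = x" "opp_semi U y = y"
    using new surface_map_permutes[OF U] permutes_not_in by metis+
  have eq: "next_semi M \<circ> opp_semi M = ?n \<circ> tr ?a y"
  proof
    fix s
    consider "s = x" | "s = y" | "s = ?a" | "s \<notin> {x, y, ?a}" by blast
    then show "(next_semi M \<circ> opp_semi M) s = (?n \<circ> tr ?a y) s"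
    proof cases
      case 4
      then have "opp_semi U s \<notin> {p, x, y}" using oo fixd by (metis insert_iff singletonD)
      then show ?thesis using 4 opp_simps(3) next_simps(4) by (simp add: Transposition.transpose_def)
    qed (use abn new in \<open>auto simp: opp_simps next_simps oo fixd Transposition.transpose_def\<close>)
  qed
  have n: "?n permutes semi U" "finite (semi U)"
    using surface_map_permutes[OF U] by auto
  let ?g = "?n \<circ> tr ?a y"
  have gx: "orbit ?g x = {x}"
    unfolding orbit_eq_singleton_iff using abn new fixd by (simp add: Transposition.transpose_def)
  have gp: "?g permutes insert y (semi U)"
    using ab by (intro permutes_compose[OF permutes_swap_id permutes_subset[OF n(1)]]) auto
  have "vertices M = insert {x} (orbit ?g ` insert y (semi U))"
    unfolding vertices_def eq semi_add using gx by auto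
  moreover have "{x} \<notin> orbit ?g ` insert y (semi U)"
    using permutes_orbit_subset[OF gp] new by blast
  ultimately have "card (vertices M) = card (orbit ?g ` insert y (semi U)) + 1"
    using n by simp
  also have "card (orbit ?g ` insert y (semi U)) = card (orbit ?n ` semi U)"
    by (rule card_orbits_insert_point[OF n]) (use ab new in auto)
  finally show ?thesis unfolding vertices_def .
qed

lemma face_old:
  assumes "s \<in> semi U"
  shows "face_at M s = face_at U s \<union> (if p \<in> face_at U s then {x, y} else {})"
proof -
  have n: "next_semi U permutes semi U" "finite (semi U)"
    using surface_map_permutes[OF U] by auto
  have n2: "next_semi U \<circ> tr p x permutes insert x (semi U)"
    using n p by (intro permutes_compose permutes_swap_id) (auto intro: permutes_subset)
  have "orbit (next_semi U \<circ> tr p x) s = face_at U s \<union> (if p \<in> face_at U s then {x} else {})"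
    unfolding face_at_def using orbit_insert_point[OF n p new(1) assms] .
  moreover have "face_at M s = orbit (next_semi U \<circ> tr p x) s \<union> (if p \<in> orbit (next_semi U \<circ> tr p x) s then {y} else {})"
    unfolding face_at_def add_leaf_def cmap.simps
    by (rule orbit_insert_point[OF n2]) (use assms p new n in auto)
  ultimately show ?thesis
    using distinct by auto
qed

lemma face_new: "face_at M x = insert x (insert y (face_at U p))" "face_at M y = face_at M x"
proof -
  have p': "face_at M p = insert x (insert y (face_at U p))"
    using face_old[OF p] self_in_face[OF U, of p] by auto
  then show "face_at M x = insert x (insert y (face_at U p))" "face_at M y = face_at M x"
    using face_at_eq[OF closed, of x p] face_at_eq[OF closed, of y p] by auto
qed

lemma faces_add:
  shows "faces M = insert (face_at M x) (faces U - {face_at U p})" "card (faces M) = card (faces U)"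
proof -
  have 1: "face_at M s = (if face_at U s = face_at U p then face_at M x else face_at U s)" if "s \<in> semi U" for s
  proof (cases "p \<in> face_at U s")
    case True
    then show ?thesis using face_old[OF that] face_new(1) face_at_eq[OF U, of p s] by auto
  next
    case False
    then have "face_at U s \<noteq> face_at U p" using self_in_face[OF U, of p] by auto
    then show ?thesis using face_old[OF that] False by simp
  qed
  have "faces M = insert (face_at M x) (face_at M ` semi U)"
    unfolding faces_def semi_add using face_new by auto
  also have "face_at M ` semi U = (\<lambda>X. if X = face_at U p then face_at M x else X) ` faces U"
    unfolding faces_def image_image using 1 by (intro image_cong) auto
  finally show eq: "faces M = insert (face_at M x) (faces U - {face_at U p})"
    by (auto split: if_splits)
  have "x \<notin> X" if "X \<in> faces U" for X
    using that face_at_subset[OF U] new by (auto simp: faces_def)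
  then have "face_at M x \<notin> faces U" using face_new by auto
  moreover have "finite (faces U)" "face_at U p \<in> faces U"
    using surface_map_permutes[OF U] p by (auto simp: faces_def)
  ultimately show "card (faces M) = card (faces U)"
    unfolding eq by (metis card_Suc_Diff1 card_insert_disjoint finite_Diff Diff_iff)
qed

lemma connected_add:
  assumes "connected_map U"
  shows "connected_map M"
  unfolding connected_map_iff[OF closed]
proof (intro allI impI)
  fix A assume A: "A \<subseteq> semi M" "A \<noteq> {}" "\<forall>s\<in>A. opp_semi M s \<in> A \<and> next_semi M s \<in> A"
  let ?B = "A \<inter> semi U"
  have nU: "next_semi U s \<in> semi U \<longleftrightarrow> s \<in> semi U" "opp_semi U s \<in> semi U \<longleftrightarrow> s \<in> semi U" for s
    using surface_map_in[OF U] by auto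
  have xyA: "x \<in> A \<longleftrightarrow> y \<in> A" using A(3) opp_simps by metis
  have ne: "?B \<noteq> {}"
  proof -
    obtain s where s: "s \<in> A" using A by auto
    have "next_semi M x \<in> semi U" using next_simps nU p by auto
    moreover have "s \<in> {x, y} \<or> s \<in> semi U" using s A semi_add by auto
    ultimately show ?thesis using s A(3) xyA by auto
  qed
  have "opp_semi U s \<in> ?B \<and> next_semi U s \<in> ?B" if "s \<in> ?B" for s
  proof -
    have s: "s \<in> A" "s \<in> semi U" "s \<notin> {x, y}" using that new by auto
    have 1: "opp_semi M s \<in> A" "next_semi M s \<in> A" using s A(3) by auto
    have 2: "next_semi M x \<in> A" if "x \<in> A" using that xyA A(3) by auto
    have "next_semi U s \<in> A"
      using 1 2 xyA s next_simps by (cases "s = p") auto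
    then show ?thesis using 1 s opp_simps nU by auto
  qed
  then have B: "?B = semi U"
    using assms ne unfolding connected_map_iff[OF U] by auto
  then have "y \<in> A" using A(3) next_simps(1) p by force
  then show "A = semi M" using B A(1) xyA semi_add by auto
qed

lemma connected_remove:
  assumes "connected_map M"
  shows "connected_map U"
  unfolding connected_map_iff[OF U]
proof (intro allI impI)
  fix A assume A: "A \<subseteq> semi U" "A \<noteq> {}" "\<forall>s\<in>A. opp_semi U s \<in> A \<and> next_semi U s \<in> A"
  define B where "B = A \<union> (if p \<in> A then {x, y} else {})"
  have "opp_semi M s \<in> B \<and> next_semi M s \<in> B" if "s \<in> B" for s
  proof (cases "s \<in> {x, y}")
    case True
    then have "p \<in> A" using that A new by (auto simp: B_def split: if_splits)
    then have "next_semi U p \<in> A" using A by auto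
    then show ?thesis using True \<open>p \<in> A\<close> by (auto simp: B_def next_simps opp_simps)
  next
    case False
    then have s: "s \<in> A" using that by (auto simp: B_def split: if_splits)
    then have "opp_semi U s \<in> A" "next_semi U s \<in> A" using A by auto
    then show ?thesis
      using False s next_simps opp_simps by (cases "s = p") (auto simp: B_def)
  qed
  moreover have "B \<subseteq> semi M" "B \<noteq> {}" using A semi_add by (auto simp: B_def)
  ultimately have "B = semi M"
    using assms(1) unfolding connected_map_iff[OF closed] by auto
  moreover have "A = B - {x, y}"
    using A(1) new by (auto simp: B_def)
  ultimately show "A = semi U"
    using new semi_add by auto
qed

text \<open>The vertex gained balances the edge gained, and the number of faces stays the
  same.\<close>

lemma planar_add_iff:
  assumes "root_semi U \<in> semi U"
  shows "planar_cmap M \<longleftrightarrow> planar_cmap U"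
  using connected_add connected_remove assms
    card_vertices_add card_edges_add faces_add(2) U closed root_add semi_add
  unfolding planar_cmap_iff by auto

end

section \<open>Extensions at the root\<close>

lemma card_orbit_funpow:
  assumes "x \<in> orbit f x"
  shows "(f ^^ card (orbit f x)) x = x"
    and "bij_betw (\<lambda>n. (f ^^ n) x) {..<card (orbit f x)} (orbit f x)"
proof -
  have 1: "bij_betw (\<lambda>n. (f ^^ n) x) {0..<funpow_dist1 f x x} (orbit f x)"
    unfolding bij_betw_def using orbit_conv_funpow_dist1[OF assms] inj_on_funpow_dist1[OF assms] by simp
  then have 2: "card (orbit f x) = funpow_dist1 f x x"
    using bij_betw_same_card by fastforce
  show "(f ^^ card (orbit f x)) x = x"
    unfolding 2 by (rule funpow_dist1_prop[OF assms])
  show "bij_betw (\<lambda>n. (f ^^ n) x) {..<card (orbit f x)} (orbit f x)"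
    using 1 unfolding 2 by (simp add: atLeast0LessThan)
qed

lemma card_orbit_le_period:
  assumes "(f ^^ n) x = x" "0 < n"
  shows "card (orbit f x) \<le> n"
proof -
  have "orbit f x = (\<lambda>m. (f ^^ m) x) ` {..<n}"
    using orbit_altdef_bounded[OF assms] by auto
  then show ?thesis using card_image_le[of "{..<n}"] by simp
qed

lemma planar_surface_map: "planar_cmap M \<Longrightarrow> surface_map M"
  by (simp add: planar_cmap_iff)

lemma planar_root: "planar_cmap M \<Longrightarrow> root_semi M \<in> semi M"
  by (simp add: planar_cmap_iff)

definition before_root :: "'d cmap \<Rightarrow> 'd" where
  "before_root M = inv (next_semi M) (root_semi M)"

lemma next_before_root: "surface_map M \<Longrightarrow> next_semi M (before_root M) = root_semi M"
  unfolding before_root_def by (meson surface_map_def permutes_inverses(1))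

lemma before_root_eqI: "surface_map M \<Longrightarrow> next_semi M s = root_semi M \<Longrightarrow> before_root M = s"
  using next_before_root surface_map_next_inj by metis

lemma before_root_in: "planar_cmap M \<Longrightarrow> before_root M \<in> semi M"
  using next_before_root surface_map_in(1) planar_surface_map planar_root by metis

lemma face_before_root: "planar_cmap M \<Longrightarrow> face_at M (before_root M) = root_face M"
  unfolding root_face_def
  by (metis face_at_eq next_before_root next_in_face planar_surface_map self_in_face)

text \<open>The new root edge \<open>x\<close> cuts off the square formed by \<open>y\<close> and three semi-edges of the old root
  face.\<close>

definition edge_ext :: "'d \<Rightarrow> 'd \<Rightarrow> 'd cmap \<Rightarrow> 'd cmap" where
  "edge_ext x y U = add_edge x y (before_root U) (next_semi U (next_semi U (root_semi U))) U"

text \<open>The corner just before the root is chosen so that the old root is the semi-edge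
  following the new one in the root face, and can be recovered from the extension.\<close>

definition leaf_ext :: "'d \<Rightarrow> 'd \<Rightarrow> 'd cmap \<Rightarrow> 'd cmap" where
  "leaf_ext x y U = add_leaf x y (before_root U) U"

lemma face_no_short_period:
  assumes "surface_map U" "0 < n" "n < card (face_at U t)"
  shows "(next_semi U ^^ n) t \<noteq> t"
  using card_orbit_le_period[of n "next_semi U" t] assms by (auto simp: face_at_def)

text \<open>The new face runs through \<open>y\<close>, the old root and the next two semi-edges.
  Perimeter at least 4 keeps these three and \<open>before_root U\<close> distinct, as
  \<open>edge_insertion\<close> requires. The root face loses three semi-edges and gains
  \<open>x\<close>, hence the 2 in the perimeter.\<close>

lemma edge_ext:
  assumes plU: "planar_cmap U" and new: "x \<notin> semi U" "y \<notin> semi U" "x \<noteq> y" and per: "perimeter U \<ge> 4"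
  defines "M \<equiv> edge_ext x y U" and "t \<equiv> root_semi U"
  shows edge_ext_insertion: "edge_insertion U x y (before_root U) (next_semi U (next_semi U t))"
    and edge_ext_card_other: "card (face_at M y) = 4"
    and edge_ext_planar: "planar_cmap M"
    and edge_ext_root_face: "root_face M = insert x (root_face U - {t, next_semi U t, next_semi U (next_semi U t)})"
    and edge_ext_perimeter: "perimeter M = perimeter U - 2"
    and edge_ext_interior: "interior_faces M = insert (face_at M y) (interior_faces U)"
    and edge_ext_card_interior: "card (interior_faces M) = card (interior_faces U) + 1"
proof -
  let ?n = "next_semi U" and ?p = "before_root U" and ?t1 = "next_semi U t" and ?q = "next_semi U (next_semi U t)"
  have c: "surface_map U" and t: "t \<in> semi U"
    using plU planar_surface_map planar_root unfolding t_def by auto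
  have np: "?n ?p = t" using next_before_root[OF c] t_def by simp
  have per': "card (face_at U t) \<ge> 4" using per by (simp add: perimeter_def root_face_def t_def)
  have k1: "?n t \<noteq> t" and k2: "?n (?n t) \<noteq> t" and k3: "?n (?n (?n t)) \<noteq> t"
    using face_no_short_period[OF c, of 1 t] face_no_short_period[OF c, of 2 t]
      face_no_short_period[OF c, of 3 t] per' by (auto simp: numeral_eq_Suc)
  have pq: "?p \<in> semi U" "?q \<in> semi U" "?p \<noteq> ?q"
    using surface_map_in(1)[OF c] np t k3 by auto
  show ins: "edge_insertion U x y ?p ?q"
    by unfold_locales (use c new pq in auto)
  then interpret edge_insertion U x y ?p ?q .
  have M: "M = add_edge x y ?p ?q U" unfolding M_def edge_ext_def t_def by simp
  have dist: "t \<noteq> ?p" "t \<noteq> ?q" "?t1 \<noteq> ?p" "?t1 \<noteq> ?q" "t \<noteq> ?t1"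
    using k1 k2 np surface_map_next_inj[OF c] by metis+
  have tin: "t \<in> semi U" "?t1 \<in> semi U" using t surface_map_in(1)[OF c] by auto
  then have txy: "t \<noteq> x" "t \<noteq> y" "?t1 \<noteq> x" "?t1 \<noteq> y" using new by auto
  have nx: "next_semi M y = t" "next_semi M t = ?t1" "next_semi M ?t1 = ?q" "next_semi M ?q = y"
    using next_simps dist txy np unfolding M by auto
  have "orbit (next_semi M) y = {(next_semi M ^^ m) y |m. m < 4}"
    by (rule orbit_altdef_bounded) (simp_all add: numeral_eq_Suc nx)
  also have "\<dots> = {y, t, ?t1, ?q}"
  proof -
    have "{(next_semi M ^^ m) y |m. m < 4} = (\<lambda>m. (next_semi M ^^ m) y) ` {..<4}"
      by auto
    also have "{..<4} = {0, 1, 2, 3 :: nat}" by auto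
    finally show ?thesis by (simp add: numeral_eq_Suc nx)
  qed
  finally have fy: "face_at M y = {y, t, ?t1, ?q}" by (simp add: face_at_def)
  show c4: "card (face_at M y) = 4"
    unfolding fy using dist txy distinct by auto
  have cM: "surface_map M" using closed M by simp
  have "x \<notin> face_at M y" using fy txy new distinct by auto
  then have yx: "y \<notin> face_at M x" using face_at_eq[OF cM, of y x] self_in_face[OF cM, of x] by auto
  show pl: "planar_cmap M"
    using planar_add_iff yx plU planar_root M by auto
  have rM: "root_face M = face_at M x" unfolding root_face_def M root_add ..
  have rU: "face_at U ?p = root_face U" by (rule face_before_root[OF plU])
  have un: "face_at M x \<union> face_at M y = insert x (insert y (root_face U))"
    using face_union(2) yx M rU by simp
  have disj: "face_at M x \<inter> face_at M y = {}"
    using face_at_eq[OF cM] yx self_in_face[OF cM] by (metis disjoint_iff)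
  have rsub: "root_face U \<subseteq> semi U" using face_at_subset[OF c] t by (simp add: root_face_def t_def)
  show rf: "root_face M = insert x (root_face U - {t, ?t1, ?q})"
    using un disj rsub new self_in_face[OF cM, of x] unfolding rM fy by auto
  have tr: "{t, ?t1, ?q} \<subseteq> root_face U"
    using self_in_face[OF c, of t] next_in_face[OF c] by (auto simp: root_face_def t_def)
  have finr: "finite (root_face U)" using finite_face[OF c] by (simp add: root_face_def)
  have "card {t, ?t1, ?q} = 3" using dist by simp
  then have "card (root_face U - {t, ?t1, ?q}) = perimeter U - 3"
    using card_Diff_subset[OF _ tr] by (simp add: perimeter_def)
  moreover have "x \<notin> root_face U - {t, ?t1, ?q}" using rsub new by auto
  ultimately show "perimeter M = perimeter U - 2"
    using per finr unfolding perimeter_def rf by simp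
  have fM: "faces M = {face_at M x, face_at M y} \<union> interior_faces U"
    using faces_split(1) yx M rU by (simp add: interior_faces_def)
  have notin: "face_at M x \<notin> faces U" "face_at M y \<notin> faces U"
    using self_in_face[OF cM, of x] self_in_face[OF cM, of y] face_at_subset[OF c] new by (auto simp: faces_def)
  have ne: "face_at M x \<noteq> face_at M y" using disj self_in_face[OF cM, of x] by auto
  show int: "interior_faces M = insert (face_at M y) (interior_faces U)"
    using fM notin ne unfolding interior_faces_def rM by auto
  have "finite (interior_faces U)"
    using surface_map_permutes[OF c] by (simp add: interior_faces_def faces_def)
  then show "card (interior_faces M) = card (interior_faces U) + 1"
    unfolding int using notin by (simp add: interior_faces_def)
qed

lemma leaf_ext:
  assumes plU: "planar_cmap U" and new: "x \<notin> semi U" "y \<notin> semi U" "x \<noteq> y"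
  defines "M \<equiv> leaf_ext x y U"
  shows leaf_ext_insertion: "leaf_insertion U x y (before_root U)"
    and leaf_ext_planar: "planar_cmap M"
    and leaf_ext_root_face: "root_face M = insert x (insert y (root_face U))"
    and leaf_ext_perimeter: "perimeter M = perimeter U + 2"
    and leaf_ext_interior: "interior_faces M = interior_faces U"
proof -
  have c: "surface_map U" and t: "root_semi U \<in> semi U"
    using plU planar_surface_map planar_root by auto
  show ins: "leaf_insertion U x y (before_root U)"
    by unfold_locales (use c new before_root_in[OF plU] in auto)
  then interpret leaf_insertion U x y "before_root U" .
  have M: "M = add_leaf x y (before_root U) U" unfolding M_def leaf_ext_def by simp
  show "planar_cmap M" using planar_add_iff[OF t] plU M by simp
  have rU: "face_at U (before_root U) = root_face U" by (rule face_before_root[OF plU])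
  have rM: "root_face M = face_at M x" unfolding root_face_def M root_add ..
  show rf: "root_face M = insert x (insert y (root_face U))"
    using face_new(1) rU M rM by simp
  have rsub: "root_face U \<subseteq> semi U" using face_at_subset[OF c] t by (simp add: root_face_def)
  show "perimeter M = perimeter U + 2"
  proof -
    have "x \<notin> root_face U" "y \<notin> root_face U" "finite (root_face U)"
      using new rsub finite_face[OF c] by (auto simp: root_face_def)
    then show ?thesis unfolding perimeter_def rf using new by simp
  qed
  have "x \<notin> X" if "X \<in> faces U" for X
    using that face_at_subset[OF c] new by (auto simp: faces_def)
  then have "root_face M \<notin> faces U" using rf by auto
  then show "interior_faces M = interior_faces U"
    using faces_add(1) rU M rM by (auto simp: interior_faces_def)
qed

section \<open>Removing the root edge of a map\<close>

lemma permutes_remove_fixed: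
  assumes "f permutes S" "f x = x" "f y = y"
  shows "f permutes (S - {x, y})"
  using permutes_superset[OF assms(1), of "S - {x, y}"] assms by auto

lemma opp_remove:
  assumes M: "surface_map M" and x: "x \<in> semi M"
  defines "y \<equiv> opp_semi M x"
  shows "y \<in> semi M" "x \<noteq> y" "opp_semi M y = x" "opp_semi M \<circ> tr x y permutes (semi M - {x, y})"
    "\<And>s. s \<notin> {x, y} \<Longrightarrow> opp_semi M s \<notin> {x, y}"
proof -
  show y: "y \<in> semi M" using surface_map_in(2)[OF M] x by (simp add: y_def)
  have "opp_semi M x \<noteq> x" using M x unfolding surface_map_def by blast
  then show xy: "x \<noteq> y" by (auto simp: y_def)
  show yx: "opp_semi M y = x" using surface_map_opp_opp[OF M] by (simp add: y_def)
  have "opp_semi M \<circ> tr x y permutes semi M"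
    using surface_map_permutes[OF M] x y by (intro permutes_compose permutes_swap_id)
  then show "opp_semi M \<circ> tr x y permutes (semi M - {x, y})"
    by (rule permutes_remove_fixed) (use yx in \<open>auto simp: y_def\<close>)
  show "opp_semi M s \<notin> {x, y}" if "s \<notin> {x, y}" for s
    using that surface_map_opp_opp[OF M] yx y_def by (metis insert_iff singletonD)
qed

text \<open>This inverts \<open>edge_ext\<close>: the edge is deleted and the root moved to the
  semi-edge that follows \<open>y\<close> in the square, so that the extension cuts off the same
  three semi-edges again. Perimeter at least 2 ensures that the root \<open>x\<close> has a
  predecessor \<open>p\<close> other than itself.\<close>

lemma remove_edge:
  assumes M: "planar_cmap M" and y: "opp_semi M (root_semi M) \<notin> root_face M"
    and f4: "card (face_at M (opp_semi M (root_semi M))) = 4" and per: "perimeter M \<ge> 2"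
  obtains U x y where "planar_cmap U" "x \<notin> semi U" "y \<notin> semi U" "x \<noteq> y"
    "M = edge_ext x y U" "perimeter U = perimeter M + 2"
proof -
  define x where "x = root_semi M"
  define y where "y = opp_semi M x"
  have c: "surface_map M" and x: "x \<in> semi M"
    using M planar_surface_map planar_root x_def by auto
  let ?n = "next_semi M"
  have xy: "y \<in> semi M" "x \<noteq> y" and yx: "opp_semi M y = x"
    and op: "opp_semi M \<circ> tr x y permutes (semi M - {x, y})"
    and oxy: "\<And>s. s \<notin> {x, y} \<Longrightarrow> opp_semi M s \<notin> {x, y}"
    using opp_remove[OF c x] unfolding y_def by auto
  have f4': "card (face_at M y) = 4" and yr: "y \<notin> face_at M x"
    using f4 y by (simp_all add: x_def y_def root_face_def)
  have k: "?n y \<noteq> y" "?n (?n y) \<noteq> y" "?n (?n (?n y)) \<noteq> y"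
    using face_no_short_period[OF c, of 1 y] face_no_short_period[OF c, of 2 y]
      face_no_short_period[OF c, of 3 y] f4' by (auto simp: numeral_eq_Suc)
  have k4: "?n (?n (?n (?n y))) = y"
    using card_orbit_funpow(1)[of y ?n] f4' self_in_face[OF c, of y] by (simp add: face_at_def numeral_eq_Suc)
  have kx: "?n x \<noteq> x"
    using face_no_short_period[OF c, of 1 x] per by (simp add: perimeter_def root_face_def x_def)
  have xf: "x \<notin> face_at M y" using face_at_eq[OF c, of x y] yr self_in_face[OF c] by metis
  have fy: "y \<in> face_at M y" "?n y \<in> face_at M y" "?n (?n y) \<in> face_at M y" "?n (?n (?n y)) \<in> face_at M y"
    using self_in_face[OF c] next_in_face[OF c] by auto
  define p where "p = inv ?n x"
  define q where "q = ?n (?n (?n y))"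
  define t where "t = ?n y"
  have np: "?n p = x" unfolding p_def by (meson surface_map_def c permutes_inverses(1))
  have nq: "?n q = y" using k4 by (simp add: q_def)
  have qf: "q \<in> face_at M y" using fy by (simp add: q_def)
  have pf: "p \<notin> face_at M y" using next_in_face[OF c, of p y] np xf by auto
  have pin: "p \<in> semi M" "q \<in> semi M" using np nq x xy surface_map_in(1)[OF c] by metis+
  have pq: "p \<noteq> q" "p \<noteq> x" "p \<noteq> y" "q \<noteq> x" "q \<noteq> y"
    using pf qf xf fy np nq kx k by auto
  \<comment> \<open>The transpositions of \<open>add_edge\<close> in reverse order, so that they
    cancel one by one.\<close>
  define g where "g = ?n \<circ> tr q y \<circ> tr p x \<circ> tr p q"
  define U where "U = \<lparr>semi = semi M - {x, y}, opp_semi = opp_semi M \<circ> tr x y, next_semi = g, root_semi = t\<rparr>"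
  have gp: "g permutes semi M"
    unfolding g_def using surface_map_permutes[OF c] x xy pin by (intro permutes_compose permutes_swap_id)
  have gv: "g p = t" "g q = ?n x" "g x = x" "g y = y" "\<And>s. s \<notin> {p, q, x, y} \<Longrightarrow> g s = ?n s"
    using pq xy np nq by (auto simp: g_def t_def Transposition.transpose_def)
  have gU: "g permutes (semi M - {x, y})"
    by (rule permutes_remove_fixed[OF gp gv(3,4)])
  have tU: "t \<in> semi M - {x, y}"
    using surface_map_in(1)[OF c] xy fy(2) xf k(1) by (auto simp: t_def)
  have cU: "surface_map U"
  proof -
    have "(opp_semi M \<circ> tr x y) s \<noteq> s \<and> (opp_semi M \<circ> tr x y) ((opp_semi M \<circ> tr x y) s) = s"
      if "s \<in> semi M - {x, y}" for s
    proof -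
      have "opp_semi M s \<noteq> s" using that c unfolding surface_map_def by auto
      then show ?thesis
        using that surface_map_opp_opp[OF c, of s] oxy[of s] by (auto simp: Transposition.transpose_def)
    qed
    then show ?thesis
      using op gU surface_map_permutes[OF c] unfolding surface_map_def U_def by simp
  qed
  have new: "x \<notin> semi U" "y \<notin> semi U" by (auto simp: U_def)
  have pqU: "p \<in> semi U" "q \<in> semi U" using pin pq by (auto simp: U_def)
  interpret edge_insertion U x y p q
    by unfold_locales (use cU new xy pqU pq in auto)
  have rU: "root_semi U = t" and nU: "next_semi U = g" by (simp_all add: U_def)
  have eq: "M = add_edge x y p q U"
  proof -
    have "opp_semi M \<circ> tr x y \<circ> tr x y = opp_semi M"
      by (simp add: fun_eq_iff)
    moreover have "g \<circ> tr p q \<circ> tr p x \<circ> tr q y = ?n"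
      by (simp add: g_def fun_eq_iff)
    moreover have "insert x (insert y (semi M - {x, y})) = semi M" using x xy by auto
    ultimately show ?thesis unfolding add_edge_def U_def x_def by simp
  qed
  have br: "before_root U = p"
    by (rule before_root_eqI[OF cU]) (simp add: rU nU gv)
  have "t \<notin> {p, q, x, y}" "?n t \<notin> {p, q, x, y}"
    using fy xf pf k surface_map_next_inj[OF c] by (auto simp: t_def q_def)
  then have qe: "next_semi U (next_semi U (root_semi U)) = q"
    unfolding rU nU by (simp add: gv(5)) (simp add: t_def q_def)
  have Mext: "M = edge_ext x y U" unfolding edge_ext_def br qe by (rule eq)
  have yrA: "y \<notin> face_at (add_edge x y p q U) x"
    by (subst eq[symmetric]) (rule yr)
  have plA: "planar_cmap (add_edge x y p q U)"
    by (subst eq[symmetric]) (rule M)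
  have rin: "root_semi U \<in> semi U"
    using tU by (simp add: U_def)
  have pl: "planar_cmap U"
    using planar_add_iff[OF yrA rin] plA by simp
  \<comment> \<open>The root face of \<open>U\<close> consists of both faces without
    \<open>x\<close> and \<open>y\<close>; as the square has 4 semi-edges, the perimeter grows by 4
    - 2.\<close>
  have "face_at M x \<union> face_at M y = insert x (insert y (root_face U))"
    using face_union(2)[OF yrA, folded eq] face_before_root[OF pl] br by simp
  moreover have "face_at M x \<inter> face_at M y = {}"
    using face_at_eq[OF c] yr self_in_face[OF c] by (metis disjoint_iff)
  moreover have "x \<notin> root_face U" "y \<notin> root_face U"
    using face_at_subset[OF cU] tU new by (auto simp: root_face_def rU U_def)
  moreover have "finite (face_at M x)" "finite (face_at M y)" "finite (root_face U)"
    using finite_face c cU by (auto simp: root_face_def)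
  ultimately have "card (face_at M x) + card (face_at M y) = card (root_face U) + 2"
    using xy by (subst card_Un_disjoint[symmetric]) auto
  then have "perimeter U = perimeter M + 2"
    using f4' by (simp add: perimeter_def root_face_def x_def)
  then show ?thesis using that pl new xy Mext by blast
qed

text \<open>By the first condition \<open>next_semi M \<circ> opp_semi M\<close> fixes the root, so
  the root edge starts at a vertex of degree 1. The second one excludes the single edge, from which
  nothing would remain.\<close>

lemma remove_leaf:
  assumes M: "planar_cmap M" and leaf: "next_semi M (opp_semi M (root_semi M)) = root_semi M"
    and ne: "next_semi M (root_semi M) \<noteq> opp_semi M (root_semi M)"
  obtains U x y where "planar_cmap U" "x \<notin> semi U" "y \<notin> semi U" "x \<noteq> y" "M = leaf_ext x y U"
proof -
  define x where "x = root_semi M"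
  define y where "y = opp_semi M x"
  have c: "surface_map M" and x: "x \<in> semi M"
    using M planar_surface_map planar_root x_def by auto
  let ?n = "next_semi M"
  have xy: "y \<in> semi M" "x \<noteq> y" and yx: "opp_semi M y = x"
    and op: "opp_semi M \<circ> tr x y permutes (semi M - {x, y})"
    and oxy: "\<And>s. s \<notin> {x, y} \<Longrightarrow> opp_semi M s \<notin> {x, y}"
    using opp_remove[OF c x] unfolding y_def by auto
  have ny: "?n y = x" and nx: "?n x \<noteq> y"
    using leaf ne by (simp_all add: x_def y_def)
  define p where "p = inv ?n y"
  define t where "t = ?n x"
  have np: "?n p = y" unfolding p_def by (meson surface_map_def c permutes_inverses(1))
  have pin: "p \<in> semi M" using np xy surface_map_in(1)[OF c] by metis
  have pn: "p \<noteq> x" "p \<noteq> y" using np ny nx xy by auto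
  define g where "g = ?n \<circ> tr p y \<circ> tr p x"
  define U where "U = \<lparr>semi = semi M - {x, y}, opp_semi = opp_semi M \<circ> tr x y, next_semi = g, root_semi = t\<rparr>"
  have gp: "g permutes semi M"
    unfolding g_def using surface_map_permutes[OF c] x xy pin by (intro permutes_compose permutes_swap_id)
  have gv: "g p = t" "g x = x" "g y = y"
    using pn xy np ny by (auto simp: g_def t_def Transposition.transpose_def)
  have gU: "g permutes (semi M - {x, y})"
    by (rule permutes_remove_fixed[OF gp gv(2,3)])
  have "t \<noteq> x" using surface_map_next_inj[OF c, of x y] ny xy by (auto simp: t_def)
  then have tU: "t \<in> semi M - {x, y}"
    using surface_map_in(1)[OF c] x nx by (auto simp: t_def)
  have cU: "surface_map U"
  proof -
    have "(opp_semi M \<circ> tr x y) s \<noteq> s \<and> (opp_semi M \<circ> tr x y) ((opp_semi M \<circ> tr x y) s) = s"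
      if "s \<in> semi M - {x, y}" for s
    proof -
      have "opp_semi M s \<noteq> s" using that c unfolding surface_map_def by auto
      then show ?thesis
        using that surface_map_opp_opp[OF c, of s] oxy[of s] by (auto simp: Transposition.transpose_def)
    qed
    then show ?thesis
      using op gU surface_map_permutes[OF c] unfolding surface_map_def U_def by simp
  qed
  have new: "x \<notin> semi U" "y \<notin> semi U" by (auto simp: U_def)
  have pU: "p \<in> semi U" using pin pn by (auto simp: U_def)
  interpret leaf_insertion U x y p
    by unfold_locales (use cU new xy pU in auto)
  have rU: "root_semi U = t" and nU: "next_semi U = g" by (simp_all add: U_def)
  have eq: "M = add_leaf x y p U"
  proof -
    have "opp_semi M \<circ> tr x y \<circ> tr x y = opp_semi M"
      by (simp add: fun_eq_iff)
    moreover have "g \<circ> tr p x \<circ> tr p y = ?n"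
      by (simp add: g_def fun_eq_iff)
    moreover have "insert x (insert y (semi M - {x, y})) = semi M" using x xy by auto
    ultimately show ?thesis unfolding add_leaf_def U_def x_def by simp
  qed
  have br: "before_root U = p"
    by (rule before_root_eqI[OF cU]) (simp add: rU nU gv)
  have "M = leaf_ext x y U" unfolding leaf_ext_def br by (rule eq)
  moreover have "planar_cmap U"
  proof -
    have "planar_cmap (add_leaf x y p U)"
      by (subst eq[symmetric]) (rule M)
    moreover have "root_semi U \<in> semi U"
      using tU by (simp add: U_def)
    ultimately show ?thesis using planar_add_iff by simp
  qed
  ultimately show ?thesis using that new xy by blast
qed

text \<open>The root face is closed under both permutations, so by connectedness it is the only face
  and Euler's relation reads V = E + 1. If all vertices had degree at least 2, counting semi-edges
  by their starting vertex would give 2 V \<le> 2 E.\<close>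

lemma exists_leaf:
  assumes M: "planar_cmap M" and tree: "\<And>s. s \<in> root_face M \<Longrightarrow> opp_semi M s \<in> root_face M"
  obtains s where "s \<in> semi M" "root_face M = semi M" "next_semi M (opp_semi M s) = s"
proof -
  have c: "surface_map M" using M planar_surface_map by auto
  have "root_face M \<subseteq> semi M" "root_face M \<noteq> {}"
    using face_at_subset[OF c planar_root[OF M]] self_in_face[OF c] by (auto simp: root_face_def)
  then have rf: "root_face M = semi M"
    using M tree next_in_face[OF c, of _ "root_semi M"] unfolding planar_cmap_iff connected_map_iff[OF c]
    by (auto simp: root_face_def)
  have "face_at M s = semi M" if "s \<in> semi M" for s
    using face_at_eq[OF c, of s "root_semi M"] that rf by (simp add: root_face_def)
  then have "faces M = {semi M}" using planar_root[OF M] by (auto simp: faces_def)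
  then have V: "card (vertices M) = card (edges M) + 1"
    using M unfolding planar_cmap_iff by simp
  let ?nu = "next_semi M \<circ> opp_semi M"
  note np = surface_map_permutes(4)[OF c] and fin = surface_map_permutes(3)[OF c]
  have "\<exists>s\<in>semi M. ?nu s = s"
  proof (rule ccontr)
    assume no: "\<not> ?thesis"
    have fo: "finite (orbit ?nu s)" for s
      using self_in_orbit[OF np fin] finite_orbit by metis
    have "card v \<ge> 2" if v: "v \<in> vertices M" for v
    proof -
      obtain s where s: "s \<in> semi M" "v = orbit ?nu s" using v unfolding vertices_def by blast
      have "{s, ?nu s} \<subseteq> v" unfolding s(2) using self_in_orbit[OF np fin, of s] orbit.base[of ?nu s] by blast
      moreover have "card {s, ?nu s} = 2" using no s by (simp add: card_2_iff) metis
      ultimately show ?thesis using card_mono[of v "{s, ?nu s}"] fo s by simp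
    qed
    then have "2 * card (vertices M) \<le> (\<Sum>v\<in>vertices M. card v)"
      using sum_mono[of "vertices M" "\<lambda>_. 2" card] by simp
    also have "\<dots> = card (\<Union>(vertices M))"
    proof (rule card_Union_disjoint[symmetric])
      show "pairwise disjnt (vertices M)"
        unfolding pairwise_def disjnt_def vertices_def using orbit_eq_of_mem[OF np fin] by blast
    qed (use fo in \<open>auto simp: vertices_def\<close>)
    also have "\<dots> \<le> card (semi M)"
      using fin permutes_orbit_subset[OF np] by (intro card_mono) (auto simp: vertices_def)
    also have "\<dots> = 2 * card (edges M)" using card_edges[OF c] by simp
    finally show False using V by simp
  qed
  then show ?thesis using that rf by auto
qed

section \<open>Isomorphisms and rerooting\<close>

definition iso_via :: "('d \<Rightarrow> 'e) \<Rightarrow> 'd cmap \<Rightarrow> 'e cmap \<Rightarrow> bool" where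
  "iso_via b M N \<longleftrightarrow> bij_betw b (semi M) (semi N) \<and> b (root_semi M) = root_semi N \<and>
     (\<forall>s\<in>semi M. b (opp_semi M s) = opp_semi N (b s) \<and> b (next_semi M s) = next_semi N (b s))"

lemma isomorphic_iff: "isomorphic M N \<longleftrightarrow> (\<exists>b. iso_via b M N)"
  by (auto simp: isomorphic_def iso_via_def)

lemma iso_via_faces:
  assumes "iso_via b M N" "planar_cmap M"
  shows "s \<in> semi M \<Longrightarrow> face_at N (b s) = b ` face_at M s"
    and "root_face N = b ` root_face M"
    and "faces N = (`) b ` faces M"
    and "interior_faces N = (`) b ` interior_faces M"
    and "inj_on ((`) b) (faces M)"
    and "\<And>F. F \<in> faces M \<Longrightarrow> card (b ` F) = card F"
proof -
  have c: "surface_map M" and r: "root_semi M \<in> semi M"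
    using assms(2) planar_surface_map planar_root by auto
  have b: "bij_betw b (semi M) (semi N)" "b (root_semi M) = root_semi N"
    "\<And>s. s \<in> semi M \<Longrightarrow> b (next_semi M s) = next_semi N (b s)"
    using assms(1) by (auto simp: iso_via_def)
  show 1: "face_at N (b s) = b ` face_at M s" if "s \<in> semi M" for s
  proof -
    have "b ` orbit (next_semi M) s = orbit (next_semi N) (b s)"
    proof (rule orbit_inverse)
      show "s \<in> orbit (next_semi M) s" using self_in_face[OF c] by (simp add: face_at_def)
      show "next_semi N (b z) = b (next_semi M z)" if "z \<in> orbit (next_semi M) s" for z
        using that face_at_subset[OF c \<open>s \<in> semi M\<close>] b(3)[of z] by (auto simp: face_at_def)
    qed
    then show ?thesis by (simp add: face_at_def)
  qed
  show 2: "root_face N = b ` root_face M"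
    using 1[OF r] b(2) by (simp add: root_face_def)
  have sN: "semi N = b ` semi M" using b(1) by (simp add: bij_betw_def)
  show 3: "faces N = (`) b ` faces M"
    unfolding faces_def sN image_image by (rule image_cong) (use 1 in auto)
  have sub: "F \<subseteq> semi M" if "F \<in> faces M" for F
    using that face_at_subset[OF c] by (auto simp: faces_def)
  have inj: "inj_on b (semi M)" using b(1) by (simp add: bij_betw_def)
  show 4: "inj_on ((`) b) (faces M)"
    using inj_on_image_Pow[OF inj] by (rule inj_on_subset) (use sub in auto)
  show "card (b ` F) = card F" if "F \<in> faces M" for F
    using sub[OF that] inj by (simp add: card_image inj_on_subset)
  have "root_face M \<in> faces M" using r by (auto simp: root_face_def faces_def)
  then show "interior_faces N = (`) b ` interior_faces M"
    using 4 unfolding interior_faces_def 2 3 by (auto dest: inj_onD)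
qed

lemma isomorphic_invariants:
  assumes "isomorphic M N" "planar_cmap M"
  shows "perimeter N = perimeter M" "card (interior_faces N) = card (interior_faces M)"
    "(\<forall>F\<in>interior_faces N. card F = 4) \<longleftrightarrow> (\<forall>F\<in>interior_faces M. card F = 4)"
    "card (semi N) = card (semi M)"
proof -
  obtain b where b: "iso_via b M N" using assms(1) by (auto simp: isomorphic_iff)
  note f = iso_via_faces[OF b assms(2)]
  have "root_face M \<in> faces M" using planar_root[OF assms(2)] by (auto simp: root_face_def faces_def)
  then show "perimeter N = perimeter M" using f by (simp add: perimeter_def)
  have "inj_on ((`) b) (interior_faces M)"
    using f(5) by (rule inj_on_subset) (auto simp: interior_faces_def)
  then show "card (interior_faces N) = card (interior_faces M)"
    unfolding f(4) by (rule card_image)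
  show "(\<forall>F\<in>interior_faces N. card F = 4) \<longleftrightarrow> (\<forall>F\<in>interior_faces M. card F = 4)"
    unfolding f(4) using f(6) by (auto simp: interior_faces_def)
  show "card (semi N) = card (semi M)"
    using b unfolding iso_via_def by (metis bij_betw_same_card)
qed

lemma isomorphic_refl: "isomorphic M M"
  unfolding isomorphic_def by (intro exI[of _ id]) auto

section \<open>Isomorphism classes, their representatives and rerooting\<close>

lemma rep_planar: "planar_cmap (rep_planar_map m)"
  using Quotient3_rep_reflp[OF Quotient3_planar_map] by blast

lemma abs_rep: "abs_planar_map (rep_planar_map m) = m"
  using Quotient3_abs_rep[OF Quotient3_planar_map] .

lemma abs_eqI:
  "planar_cmap M \<Longrightarrow> planar_cmap N \<Longrightarrow> isomorphic M N \<Longrightarrow> abs_planar_map M = abs_planar_map N"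
  using Quotient3_rel[OF Quotient3_planar_map] isomorphic_refl by blast

lemma rep_abs: "planar_cmap M \<Longrightarrow> isomorphic (rep_planar_map (abs_planar_map M)) M"
  using Quotient3_rep_abs[OF Quotient3_planar_map] isomorphic_refl by blast

lemma eq_absI:
  assumes "planar_cmap M" "isomorphic (rep_planar_map m) M"
  shows "m = abs_planar_map M"
  using abs_eqI[OF rep_planar assms] abs_rep by metis

lemma abs_in_Quad:
  assumes "planar_cmap M"
  shows "abs_planar_map M \<in> Quad l \<longleftrightarrow> (\<forall>F\<in>interior_faces M. card F = 4) \<and> perimeter M = 2 * l"
    and "num_faces (abs_planar_map M) = card (interior_faces M)"
  using isomorphic_invariants[OF rep_abs[OF assms] rep_planar] rep_planar
  by (auto simp: Quad_def num_faces_def quadrangulation_def)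

lemma planar_rerootI: "planar_cmap M \<Longrightarrow> s \<in> semi M \<Longrightarrow> planar_cmap (M\<lparr>root_semi := s\<rparr>)"
  by (auto simp: planar_cmap_def connected_map_def vertices_def faces_def edges_def face_at_def)

text \<open>The representative chosen for the class of \<open>M\<close> has its own labels, so the
  new root is pulled back along an isomorphism.\<close>

lemma rerooting_abs:
  assumes M: "planar_cmap M" and s: "s \<in> semi M"
  shows "rerooting_of (abs_planar_map M) (abs_planar_map (M\<lparr>root_semi := s\<rparr>))"
proof -
  let ?R = "rep_planar_map (abs_planar_map M)"
  obtain b where b: "iso_via b ?R M" using rep_abs[OF M] isomorphic_iff by blast
  then obtain z where z: "z \<in> semi ?R" "b z = s" using s unfolding iso_via_def bij_betw_def by (metis imageE)
  have "iso_via b (?R\<lparr>root_semi := z\<rparr>) (M\<lparr>root_semi := s\<rparr>)"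
    using b z by (simp add: iso_via_def)
  moreover have "isomorphic (M\<lparr>root_semi := s\<rparr>) (rep_planar_map (abs_planar_map (M\<lparr>root_semi := s\<rparr>)))"
    using isomorphic_sym[OF rep_planar rep_abs[OF planar_rerootI[OF M s]]] .
  ultimately show ?thesis
    unfolding rerooting_of_def using isomorphic_iff isomorphic_trans z(1) by metis
qed

section \<open>Insertions of edges preserve and reflect isomorphism\<close>

lemma iso_add_edge:
  assumes "edge_insertion U x y p q" "edge_insertion U' x' y' p' q'"
    and b: "iso_via b U U'" and bp: "b p = p'" "b q = q'"
  shows "isomorphic (add_edge x y p q U) (add_edge x' y' p' q' U')"
proof -
  interpret i: edge_insertion U x y p q by fact
  interpret j: edge_insertion U' x' y' p' q' by fact
  define c where "c s = (if s = x then x' else if s = y then y' else b s)" for s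
  have bb: "bij_betw b (semi U) (semi U')" using b by (simp add: iso_via_def)
  have bs: "b (opp_semi U s) = opp_semi U' (b s)" "b (next_semi U s) = next_semi U' (b s)" "b s \<in> semi U'"
    if "s \<in> semi U" for s
    using b that by (auto simp: iso_via_def bij_betw_def)
  have cU: "c s = b s" if "s \<in> semi U" for s
    using that i.new by (auto simp: c_def)
  have cxy: "c x = x'" "c y = y'" using i.new by (auto simp: c_def)
  have nU: "next_semi U s \<in> semi U" "opp_semi U s \<in> semi U" if "s \<in> semi U" for s
    using that surface_map_in[OF i.U] by auto
  have bij: "bij_betw c (semi i.M) (semi j.M)"
  proof -
    have "bij_betw c (semi U) (semi U')" using bb cU by (metis bij_betw_cong)
    moreover have "bij_betw c {x, y} {x', y'}"
      using cxy i.new j.new by (auto simp: bij_betw_def)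
    ultimately have "bij_betw c ({x, y} \<union> semi U) ({x', y'} \<union> semi U')"
      using i.new j.new by (intro bij_betw_combine) auto
    then show ?thesis unfolding i.semi_add j.semi_add by simp
  qed
  have "c (opp_semi i.M s) = opp_semi j.M (c s) \<and> c (next_semi i.M s) = next_semi j.M (c s)"
    if "s \<in> semi i.M" for s
  proof -
    consider "s = x" | "s = y" | "s = p" | "s = q" | "s \<in> semi U" "s \<notin> {p, q}"
      using \<open>s \<in> semi i.M\<close> i.semi_add by auto
    then show ?thesis
    proof cases
      case 5
      have "b s \<in> semi U'" "b s \<noteq> p'" "b s \<noteq> q'"
        using 5 bs bp bb i.pq by (auto simp: bij_betw_def dest: inj_onD)
      then have "b s \<notin> {p', q', x', y'}" using j.new by auto
      moreover have "s \<notin> {p, q, x, y}" using 5 i.new by auto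
      ultimately show ?thesis
        using 5 cU[OF nU(1)] cU[OF nU(2)] cU bs[of s] by (simp add: i.next_simps(5) j.next_simps(5) i.opp_simps(3) j.opp_simps(3))
    qed (use cxy cU nU bs i.pq bp i.distinct j.distinct in
        \<open>auto simp: i.next_simps(1-4) j.next_simps(1-4) i.opp_simps j.opp_simps\<close>)
  qed
  then have "iso_via c i.M j.M"
    unfolding iso_via_def using bij cxy i.root_add j.root_add by simp
  then show ?thesis using isomorphic_iff by blast
qed

text \<open>An isomorphism of the larger maps respects the root \<open>x\<close>, hence its opposite
  \<open>y\<close> and the predecessors \<open>p\<close> and \<open>q\<close> of the two, and so it
  restricts to the old semi-edges. The larger map does not store the old root; the last hypotheses
  recover it as the successor of \<open>y\<close>.\<close>

lemma iso_add_edge_cancel: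
  assumes "edge_insertion U x y p q" "edge_insertion U' x' y' p' q'"
    and iso: "isomorphic (add_edge x y p q U) (add_edge x' y' p' q' U')"
    and r: "root_semi U = next_semi U p" "root_semi U' = next_semi U' p'"
  shows "isomorphic U U'"
proof -
  interpret i: edge_insertion U x y p q by fact
  interpret j: edge_insertion U' x' y' p' q' by fact
  obtain b where b: "iso_via b i.M j.M" using iso isomorphic_iff by blast
  have bb: "bij_betw b (semi i.M) (semi j.M)" and bx: "b x = x'"
    using b i.root_add j.root_add by (auto simp: iso_via_def)
  have bs: "b (opp_semi i.M s) = opp_semi j.M (b s)" "b (next_semi i.M s) = next_semi j.M (b s)"
    if "s \<in> semi i.M" for s
    using b that by (auto simp: iso_via_def)
  have by': "b y = y'" using bs(1)[of x] bx i.semi_add i.opp_simps j.opp_simps by auto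
  have bU: "bij_betw b (semi U) (semi U')"
  proof -
    have "bij_betw b (semi i.M - {x, y}) (semi j.M - b ` {x, y})"
      using bb i.semi_add by (intro bij_betw_DiffI) (auto simp: bij_betw_def inj_on_def)
    then show ?thesis using bx by' i.new j.new i.semi_add j.semi_add by (simp add: insert_Diff_if)
  qed
  have inM: "s \<in> semi i.M" if "s \<in> semi U" for s using that i.semi_add by auto
  have bp: "b p = p'"
    using bs(2)[OF inM[OF i.pq(1)]] bx surface_map_next_inj[OF j.closed] i.next_simps(1) j.next_simps(1) by metis
  have bq: "b q = q'"
    using bs(2)[OF inM[OF i.pq(2)]] by' surface_map_next_inj[OF j.closed] i.next_simps(2) j.next_simps(2) by metis
  have xyM: "x \<in> semi i.M" "y \<in> semi i.M" using i.semi_add by auto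
  have np: "b (next_semi U p) = next_semi U' p'" using bs(2)[OF xyM(2)] by' i.next_simps j.next_simps by simp
  have nq: "b (next_semi U q) = next_semi U' q'" using bs(2)[OF xyM(1)] bx i.next_simps j.next_simps by simp
  have "b (opp_semi U s) = opp_semi U' (b s) \<and> b (next_semi U s) = next_semi U' (b s)" if s: "s \<in> semi U" for s
  proof
    have bsU: "b s \<in> semi U'" using bU s by (auto simp: bij_betw_def)
    then have nbs: "b s \<notin> {x', y'}" "s \<notin> {x, y}" using s i.new j.new by auto
    then show "b (opp_semi U s) = opp_semi U' (b s)"
      using bs(1)[OF inM[OF s]] i.opp_simps j.opp_simps by simp
    show "b (next_semi U s) = next_semi U' (b s)"
    proof (cases "s \<in> {p, q}")
      case True
      then show ?thesis using np nq bp bq by auto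
    next
      case False
      then have "b s \<noteq> p'" "b s \<noteq> q'"
        using s bp bq bU i.pq by (auto simp: bij_betw_def dest: inj_onD)
      then show ?thesis
        using False nbs bs(2)[OF inM[OF s]] i.next_simps(5) j.next_simps(5) by simp
    qed
  qed
  then have "iso_via b U U'" using bU np r by (simp add: iso_via_def)
  then show ?thesis using isomorphic_iff by blast
qed

lemma iso_add_leaf:
  assumes "leaf_insertion U x y p" "leaf_insertion U' x' y' p'"
    and b: "iso_via b U U'" and bp: "b p = p'"
  shows "isomorphic (add_leaf x y p U) (add_leaf x' y' p' U')"
proof -
  interpret i: leaf_insertion U x y p by fact
  interpret j: leaf_insertion U' x' y' p' by fact
  define c where "c s = (if s = x then x' else if s = y then y' else b s)" for s
  have bb: "bij_betw b (semi U) (semi U')" using b by (simp add: iso_via_def)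
  have bs: "b (opp_semi U s) = opp_semi U' (b s)" "b (next_semi U s) = next_semi U' (b s)" "b s \<in> semi U'"
    if "s \<in> semi U" for s
    using b that by (auto simp: iso_via_def bij_betw_def)
  have cU: "c s = b s" if "s \<in> semi U" for s
    using that i.new by (auto simp: c_def)
  have cxy: "c x = x'" "c y = y'" using i.new by (auto simp: c_def)
  have nU: "next_semi U s \<in> semi U" "opp_semi U s \<in> semi U" if "s \<in> semi U" for s
    using that surface_map_in[OF i.U] by auto
  have bij: "bij_betw c (semi i.M) (semi j.M)"
  proof -
    have "bij_betw c (semi U) (semi U')" using bb cU by (metis bij_betw_cong)
    moreover have "bij_betw c {x, y} {x', y'}"
      using cxy i.new j.new by (auto simp: bij_betw_def)
    ultimately have "bij_betw c ({x, y} \<union> semi U) ({x', y'} \<union> semi U')"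
      using i.new j.new by (intro bij_betw_combine) auto
    then show ?thesis unfolding i.semi_add j.semi_add by simp
  qed
  have "c (opp_semi i.M s) = opp_semi j.M (c s) \<and> c (next_semi i.M s) = next_semi j.M (c s)"
    if "s \<in> semi i.M" for s
  proof -
    consider "s = x" | "s = y" | "s = p" | "s \<in> semi U" "s \<noteq> p"
      using \<open>s \<in> semi i.M\<close> i.semi_add by auto
    then show ?thesis
    proof cases
      case 4
      have "b s \<in> semi U'" "b s \<noteq> p'"
        using 4 bs bp bb i.p by (auto simp: bij_betw_def dest: inj_onD)
      then have "b s \<notin> {p', x', y'}" using j.new by auto
      moreover have "s \<notin> {p, x, y}" using 4 i.new by auto
      ultimately show ?thesis
        using 4 cU[OF nU(1)] cU[OF nU(2)] cU bs[of s] by (simp add: i.next_simps(4) j.next_simps(4) i.opp_simps(3) j.opp_simps(3))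
    qed (use cxy cU nU bs i.p bp i.distinct j.distinct in
        \<open>auto simp: i.next_simps(1-3) j.next_simps(1-3) i.opp_simps j.opp_simps\<close>)
  qed
  then have "iso_via c i.M j.M"
    unfolding iso_via_def using bij cxy i.root_add j.root_add by simp
  then show ?thesis using isomorphic_iff by blast
qed

text \<open>The argument for an edge applies with one corner: \<open>p\<close> is now the
  predecessor of \<open>y\<close>, and the old root is the successor of \<open>x\<close>.\<close>

lemma iso_add_leaf_cancel:
  assumes "leaf_insertion U x y p" "leaf_insertion U' x' y' p'"
    and iso: "isomorphic (add_leaf x y p U) (add_leaf x' y' p' U')"
    and r: "root_semi U = next_semi U p" "root_semi U' = next_semi U' p'"
  shows "isomorphic U U'"
proof -
  interpret i: leaf_insertion U x y p by fact
  interpret j: leaf_insertion U' x' y' p' by fact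
  obtain b where b: "iso_via b i.M j.M" using iso isomorphic_iff by blast
  have bb: "bij_betw b (semi i.M) (semi j.M)" and bx: "b x = x'"
    using b i.root_add j.root_add by (auto simp: iso_via_def)
  have bs: "b (opp_semi i.M s) = opp_semi j.M (b s)" "b (next_semi i.M s) = next_semi j.M (b s)"
    if "s \<in> semi i.M" for s
    using b that by (auto simp: iso_via_def)
  have by': "b y = y'" using bs(1)[of x] bx i.semi_add i.opp_simps j.opp_simps by auto
  have bU: "bij_betw b (semi U) (semi U')"
  proof -
    have "bij_betw b (semi i.M - {x, y}) (semi j.M - b ` {x, y})"
      using bb i.semi_add by (intro bij_betw_DiffI) (auto simp: bij_betw_def inj_on_def)
    then show ?thesis using bx by' i.new j.new i.semi_add j.semi_add by (simp add: insert_Diff_if)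
  qed
  have inM: "s \<in> semi i.M" if "s \<in> semi U" for s using that i.semi_add by auto
  have bp: "b p = p'"
    using bs(2)[OF inM[OF i.p]] by' surface_map_next_inj[OF j.closed] i.next_simps(1) j.next_simps(1) by metis
  have xM: "x \<in> semi i.M" using i.semi_add by auto
  have np: "b (next_semi U p) = next_semi U' p'" using bs(2)[OF xM] bx i.next_simps j.next_simps by simp
  have "b (opp_semi U s) = opp_semi U' (b s) \<and> b (next_semi U s) = next_semi U' (b s)" if s: "s \<in> semi U" for s
  proof
    have bsU: "b s \<in> semi U'" using bU s by (auto simp: bij_betw_def)
    then have nbs: "b s \<notin> {x', y'}" "s \<notin> {x, y}" using s i.new j.new by auto
    then show "b (opp_semi U s) = opp_semi U' (b s)"
      using bs(1)[OF inM[OF s]] i.opp_simps j.opp_simps by simp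
    show "b (next_semi U s) = next_semi U' (b s)"
    proof (cases "s = p")
      case True
      then show ?thesis using np bp by auto
    next
      case False
      then have "b s \<noteq> p'"
        using s bp bU i.p by (auto simp: bij_betw_def dest: inj_onD)
      then show ?thesis
        using False nbs bs(2)[OF inM[OF s]] i.next_simps(4) j.next_simps(4) by simp
    qed
  qed
  then have "iso_via b U U'" using bU np r by (simp add: iso_via_def)
  then show ?thesis using isomorphic_iff by blast
qed

lemma iso_before_root:
  assumes b: "iso_via b U U'" and U: "planar_cmap U" "planar_cmap U'"
  shows "b (before_root U) = before_root U'"
proof -
  have "next_semi U' (b (before_root U)) = root_semi U'"
    using b before_root_in[OF U(1)] next_before_root[OF planar_surface_map[OF U(1)]] by (auto simp: iso_via_def)
  then show ?thesis using before_root_eqI[OF planar_surface_map[OF U(2)]] by simp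
qed

text \<open>Read from right to left, this makes the extension well defined on isomorphism classes;
  read from left to right, injective, so that the filling of the test map can be recovered.\<close>

lemma isomorphic_edge_ext_iff:
  assumes U: "planar_cmap U" "x \<notin> semi U" "y \<notin> semi U" "x \<noteq> y" "perimeter U \<ge> 4"
    and U': "planar_cmap U'" "x' \<notin> semi U'" "y' \<notin> semi U'" "x' \<noteq> y'" "perimeter U' \<ge> 4"
  shows "isomorphic (edge_ext x y U) (edge_ext x' y' U') \<longleftrightarrow> isomorphic U U'"
proof
  note i = edge_ext_insertion[OF U] and j = edge_ext_insertion[OF U']
  {
    assume "isomorphic (edge_ext x y U) (edge_ext x' y' U')"
    then show "isomorphic U U'"
      unfolding edge_ext_def
      by (rule iso_add_edge_cancel[OF i j])
        (simp_all add: next_before_root planar_surface_map U U')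
  next
    assume "isomorphic U U'"
    then obtain b where b: "iso_via b U U'" using isomorphic_iff by blast
    have "b (next_semi U (next_semi U (root_semi U))) = next_semi U' (next_semi U' (root_semi U'))"
      using b surface_map_in(1)[OF planar_surface_map[OF U(1)]] planar_root[OF U(1)] by (simp add: iso_via_def)
    then show "isomorphic (edge_ext x y U) (edge_ext x' y' U')"
      unfolding edge_ext_def using iso_add_edge[OF i j b] iso_before_root[OF b U(1) U'(1)] by simp
  }
qed

lemma isomorphic_leaf_ext_iff:
  assumes U: "planar_cmap U" "x \<notin> semi U" "y \<notin> semi U" "x \<noteq> y"
    and U': "planar_cmap U'" "x' \<notin> semi U'" "y' \<notin> semi U'" "x' \<noteq> y'"
  shows "isomorphic (leaf_ext x y U) (leaf_ext x' y' U') \<longleftrightarrow> isomorphic U U'"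
proof
  note i = leaf_ext_insertion[OF U] and j = leaf_ext_insertion[OF U']
  {
    assume "isomorphic (leaf_ext x y U) (leaf_ext x' y' U')"
    then show "isomorphic U U'"
      unfolding leaf_ext_def
      by (rule iso_add_leaf_cancel[OF i j])
        (simp_all add: next_before_root planar_surface_map U U')
  next
    assume "isomorphic U U'"
    then obtain b where b: "iso_via b U U'" using isomorphic_iff by blast
    then show "isomorphic (leaf_ext x y U) (leaf_ext x' y' U')"
      unfolding leaf_ext_def using iso_add_leaf[OF i j b] iso_before_root[OF b U(1) U'(1)] by simp
  }
qed

section \<open>Peeling\<close>

definition fresh_semi :: "nat cmap \<Rightarrow> nat" where
  "fresh_semi U = Suc (Max (semi U))"

lemma fresh_semi:
  assumes "planar_cmap U"
  shows "fresh_semi U + k \<notin> semi U"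
proof
  assume "fresh_semi U + k \<in> semi U"
  then have "fresh_semi U + k \<le> Max (semi U)"
    using surface_map_permutes(3)[OF planar_surface_map[OF assms]] by simp
  then show False by (simp add: fresh_semi_def)
qed

text \<open>The value has its intended meaning from perimeter 4 on, since the square takes three
  boundary semi-edges and one more must remain. The lemmas below apply it to half-perimeter at least
  2.\<close>

definition plus_edge :: "planar_map \<Rightarrow> planar_map" where
  "plus_edge u = (let U = rep_planar_map u; x = fresh_semi U in abs_planar_map (edge_ext x (Suc x) U))"

definition plus_leaf :: "planar_map \<Rightarrow> planar_map" where
  "plus_leaf u = (let U = rep_planar_map u; x = fresh_semi U in abs_planar_map (leaf_ext x (Suc x) U))"

lemma fresh_rep:
  fixes u :: planar_map
  defines "U \<equiv> rep_planar_map u"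
  shows "planar_cmap U" "fresh_semi U \<notin> semi U" "Suc (fresh_semi U) \<notin> semi U"
    "fresh_semi U \<noteq> Suc (fresh_semi U)"
  using rep_planar[of u] fresh_semi[of U 0] fresh_semi[of U 1] by (auto simp: U_def)

text \<open>Neither the representative nor the labels of the new edge matter, so later arguments may
  choose both to suit.\<close>

lemma abs_edge_ext:
  assumes U: "planar_cmap U" "x \<notin> semi U" "y \<notin> semi U" "x \<noteq> y" "perimeter U \<ge> 4"
  shows "abs_planar_map (edge_ext x y U) = plus_edge (abs_planar_map U)"
proof -
  let ?V = "rep_planar_map (abs_planar_map U)"
  have iso: "isomorphic ?V U" using rep_abs[OF U(1)] .
  have per: "perimeter ?V \<ge> 4"
    using isomorphic_invariants(1)[OF iso rep_planar] U(5) by simp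
  note V = fresh_rep[of "abs_planar_map U"] per
  show ?thesis
    unfolding plus_edge_def Let_def
    by (rule abs_eqI[symmetric, OF edge_ext_planar[OF V] edge_ext_planar[OF U]])
      (simp add: isomorphic_edge_ext_iff[OF V U] iso)
qed

lemma abs_leaf_ext:
  assumes U: "planar_cmap U" "x \<notin> semi U" "y \<notin> semi U" "x \<noteq> y"
  shows "abs_planar_map (leaf_ext x y U) = plus_leaf (abs_planar_map U)"
proof -
  let ?V = "rep_planar_map (abs_planar_map U)"
  have iso: "isomorphic ?V U" using rep_abs[OF U(1)] .
  note V = fresh_rep[of "abs_planar_map U"]
  show ?thesis
    unfolding plus_leaf_def Let_def
    by (rule abs_eqI[symmetric, OF leaf_ext_planar[OF V] leaf_ext_planar[OF U]])
      (simp add: isomorphic_leaf_ext_iff[OF V U] iso)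
qed

lemma Quad_rep: "u \<in> Quad l \<Longrightarrow> perimeter (rep_planar_map u) = 2 * l"
  by (simp add: Quad_def)

lemma plus_edge:
  assumes "u \<in> Quad (Suc l)" "l \<ge> 1"
  shows "plus_edge u \<in> Quad l" "num_faces (plus_edge u) = num_faces u + 1"
proof -
  have "perimeter (rep_planar_map u) \<ge> 4" using assms Quad_rep by fastforce
  note V = fresh_rep[of u] this
  show "plus_edge u \<in> Quad l"
    unfolding plus_edge_def Let_def abs_in_Quad(1)[OF edge_ext_planar[OF V]]
    using edge_ext_card_other[OF V] edge_ext_interior[OF V] edge_ext_perimeter[OF V] assms(1)
    by (auto simp: Quad_def quadrangulation_def)
  show "num_faces (plus_edge u) = num_faces u + 1"
    unfolding plus_edge_def Let_def abs_in_Quad(2)[OF edge_ext_planar[OF V]]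
    using edge_ext_card_interior[OF V] by (simp add: num_faces_def)
qed

lemma plus_leaf:
  assumes "u \<in> Quad l"
  shows "plus_leaf u \<in> Quad (Suc l)" "num_faces (plus_leaf u) = num_faces u"
proof -
  note V = fresh_rep[of u]
  show "plus_leaf u \<in> Quad (Suc l)"
    unfolding plus_leaf_def Let_def abs_in_Quad(1)[OF leaf_ext_planar[OF V]]
    using leaf_ext_interior[OF V] leaf_ext_perimeter[OF V] assms
    by (auto simp: Quad_def quadrangulation_def)
  show "num_faces (plus_leaf u) = num_faces u"
    unfolding plus_leaf_def Let_def abs_in_Quad(2)[OF leaf_ext_planar[OF V]]
    using leaf_ext_interior[OF V] by (simp add: num_faces_def)
qed

text \<open>The set of all faces does not depend on the root, and exactly one face is the root face
  wherever the root is.\<close>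

lemma num_faces_rerooting:
  assumes r: "rerooting_of m1 m2" and Q: "m1 \<in> Quad l" "m2 \<in> Quad l"
  shows "num_faces m1 = num_faces m2"
proof -
  let ?M = "rep_planar_map m1" and ?N = "rep_planar_map m2"
  obtain s where s: "s \<in> semi ?M" "isomorphic (?M\<lparr>root_semi := s\<rparr>) ?N"
    using r by (auto simp: rerooting_of_def)
  have int: "card (interior_faces L) + 1 = card (faces L)" if "planar_cmap L" for L :: "nat cmap"
  proof -
    have "root_face L \<in> faces L" "finite (faces L)"
      using planar_root[OF that] surface_map_permutes(3)[OF planar_surface_map[OF that]]
      by (auto simp: faces_def root_face_def)
    then show ?thesis unfolding interior_faces_def by (metis Suc_eq_plus1 card_Suc_Diff1)
  qed
  have "card (interior_faces ?N) = card (interior_faces (?M\<lparr>root_semi := s\<rparr>))"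
    using isomorphic_invariants(2)[OF s(2) planar_rerootI[OF rep_planar s(1)]] .
  moreover have "faces (?M\<lparr>root_semi := s\<rparr>) = faces ?M"
    by (simp add: faces_def face_at_def)
  ultimately show ?thesis
    using int[OF rep_planar[of m1]] int[OF planar_rerootI[OF rep_planar s(1)]] by (simp add: num_faces_def)
qed

definition single_edge :: planar_map where
  "single_edge = abs_planar_map \<lparr>semi = {0, 1}, opp_semi = tr 0 1, next_semi = tr 0 1, root_semi = 0\<rparr>"

text \<open>An edge bounding an interior face can be removed; if there is none on the boundary, the map
  is a plane tree, which has a leaf.\<close>

lemma peeling:
  assumes m: "m \<in> Quad l" "l \<ge> 1"
  obtains m' where "m' \<in> Quad l" "rerooting_of m m'"
    "(\<exists>u\<in>Quad (Suc l). m' = plus_edge u \<and> card (semi (rep_planar_map u)) < card (semi (rep_planar_map m)))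
      \<or> (\<exists>k u. k \<ge> 1 \<and> l = Suc k \<and> u \<in> Quad k \<and> m' = plus_leaf u \<and>
              card (semi (rep_planar_map u)) < card (semi (rep_planar_map m)))
      \<or> m' = single_edge \<and> l = 1"
proof -
  define M where "M = rep_planar_map m"
  have M: "planar_cmap M" "perimeter M = 2 * l" "\<And>F. F \<in> interior_faces M \<Longrightarrow> card F = 4"
    using rep_planar m(1) by (auto simp: M_def Quad_def quadrangulation_def)
  have c: "surface_map M" using planar_surface_map[OF M(1)] .
  have mM: "m = abs_planar_map M" by (simp add: M_def abs_rep)
  define N where "N s = M\<lparr>root_semi := s\<rparr>" for s
  have N: "planar_cmap (N s)" "rerooting_of m (abs_planar_map (N s))" "root_face (N s) = root_face M"
    "abs_planar_map (N s) \<in> Quad l" if "s \<in> root_face M" for s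
  proof -
    have s: "s \<in> semi M" using that face_at_subset[OF c planar_root[OF M(1)]] by (auto simp: root_face_def)
    show 1: "planar_cmap (N s)" unfolding N_def using planar_rerootI[OF M(1) s] .
    show "rerooting_of m (abs_planar_map (N s))"
      unfolding mM N_def using rerooting_abs[OF M(1) s] .
    show 2: "root_face (N s) = root_face M"
      using face_at_eq[OF c] that by (simp add: root_face_def N_def face_at_def)
    show "abs_planar_map (N s) \<in> Quad l"
      unfolding abs_in_Quad(1)[OF 1] using M 2 by (simp add: perimeter_def interior_faces_def faces_def face_at_def N_def)
  qed
  have simps: "semi (N s) = semi M" "root_semi (N s) = s" "opp_semi (N s) = opp_semi M"
    "next_semi (N s) = next_semi M" "face_at (N s) = face_at M" "interior_faces (N s) = faces M - {face_at M s}" for s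
    by (auto simp: N_def face_at_def interior_faces_def faces_def root_face_def)
  have cardabs: "card (semi (rep_planar_map (abs_planar_map U))) = card (semi U)" if "planar_cmap U" for U
    using isomorphic_invariants(4)[OF rep_abs[OF that] rep_planar] by simp
  show ?thesis
  proof (cases "\<exists>s\<in>root_face M. opp_semi M s \<notin> root_face M")
    case True
    then obtain s where s: "s \<in> root_face M" "opp_semi M s \<notin> root_face M" by auto
    have sM: "s \<in> semi M" "opp_semi M s \<in> semi M"
      using s(1) face_at_subset[OF c planar_root[OF M(1)]] surface_map_in[OF c] by (auto simp: root_face_def)
    have "face_at M (opp_semi M s) \<in> interior_faces M"
      using s sM self_in_face[OF c, of "opp_semi M s"] by (auto simp: interior_faces_def faces_def)
    then have f4: "card (face_at M (opp_semi M s)) = 4" using M(3) by blast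
    have per: "perimeter (N s) = 2 * l" using N(3)[OF s(1)] M(2) by (simp add: perimeter_def)
    obtain U x y where U: "planar_cmap U" "x \<notin> semi U" "y \<notin> semi U" "x \<noteq> y"
      "N s = edge_ext x y U" "perimeter U = perimeter (N s) + 2"
      by (rule remove_edge[OF N(1)[OF s(1)]]) (use s N(3)[OF s(1)] f4 per m(2) in \<open>auto simp: simps\<close>)
    have V: "perimeter U \<ge> 4" using U per m(2) by simp
    note W = U(1-4) V
    have "abs_planar_map U \<in> Quad (Suc l)"
    proof -
      have "\<forall>F\<in>interior_faces (N s). card F = 4" using N(4)[OF s(1)] abs_in_Quad(1)[OF N(1)[OF s(1)]] by simp
      then show ?thesis
        unfolding abs_in_Quad(1)[OF U(1)] using U(5,6) per edge_ext_interior[OF W] by simp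
    qed
    moreover have "abs_planar_map (N s) = plus_edge (abs_planar_map U)"
      unfolding U(5) using abs_edge_ext[OF W] .
    moreover have "card (semi U) < card (semi M)"
    proof -
      have "semi M = insert x (insert y (semi U))"
        using simps(1)[of s] unfolding U(5) by (simp add: edge_ext_def add_edge_def)
      then show ?thesis using U(1-4) surface_map_permutes(3)[OF planar_surface_map[OF U(1)]] by simp
    qed
    ultimately have "\<exists>u\<in>Quad (Suc l). abs_planar_map (N s) = plus_edge u \<and>
        card (semi (rep_planar_map u)) < card (semi (rep_planar_map m))"
      using cardabs[OF U(1)] by (intro bexI[of _ "abs_planar_map U"]) (simp_all add: M_def)
    then show ?thesis
      using that[OF N(4,2)[OF s(1)]] by blast
  next
    case False
    then obtain s where s: "s \<in> semi M" "root_face M = semi M" "next_semi M (opp_semi M s) = s"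
      using exists_leaf[OF M(1)] by blast
    then have sr: "s \<in> root_face M" by simp
    show ?thesis
    \<comment> \<open>If equality holds, both ends of the edge are leaves; its two sides form a
      closed set, and by connectedness they are the whole map.\<close>
    proof (cases "next_semi M s = opp_semi M s")
      case True
      define y where "y = opp_semi M s"
      have y: "y \<in> semi M" "s \<noteq> y" "opp_semi M y = s" "opp_semi M s = y" "next_semi M s = y" "next_semi M y = s"
        using opp_remove[OF c s(1)] s(3) True by (auto simp: y_def)
      have "\<forall>A\<subseteq>semi M. A \<noteq> {} \<longrightarrow> (\<forall>z\<in>A. opp_semi M z \<in> A \<and> next_semi M z \<in> A) \<longrightarrow> A = semi M"
        using M(1) unfolding planar_cmap_iff connected_map_iff[OF c] by simp
      from this[rule_format, of "{s, y}"] have sy: "{s, y} = semi M"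
        using s(1) y by auto
      have "iso_via (\<lambda>z. if z = s then 0 else 1 :: nat) (N s) \<lparr>semi = {0, 1}, opp_semi = tr 0 1, next_semi = tr 0 1, root_semi = 0\<rparr>"
        using y unfolding iso_via_def simps bij_betw_def sy[symmetric] by (auto simp: inj_on_def)
      then have "abs_planar_map (N s) = single_edge"
        unfolding single_edge_def using N(1)[OF sr] planar_cmap_single_edge isomorphic_iff
        by (intro abs_eqI) blast+
      moreover have "l = 1"
      proof -
        have "perimeter M = card {s, y}" using sy s(2) by (simp add: perimeter_def)
        then show ?thesis using M(2) y by simp
      qed
      ultimately show ?thesis using that[OF N(4,2)[OF sr]] by auto
    next
      case False
      obtain U x y where U: "planar_cmap U" "x \<notin> semi U" "y \<notin> semi U" "x \<noteq> y" "N s = leaf_ext x y U"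
        by (rule remove_leaf[OF N(1)[OF sr]]) (use s False in \<open>auto simp: simps\<close>)
      note W = U(1-4)
      have per: "perimeter U + 2 = 2 * l"
        using leaf_ext_perimeter[OF W] U(5) N(3)[OF sr] M(2) by (simp add: perimeter_def)
      \<comment> \<open>The root face of \<open>U\<close> is not empty, so \<open>k\<close> is at
        least 1, the range in which the laws are defined.\<close>
      define k where "k = l - 1"
      have "perimeter U > 0"
        using self_in_face[OF planar_surface_map[OF U(1)]] finite_face[OF planar_surface_map[OF U(1)]]
        by (auto simp: perimeter_def root_face_def card_gt_0_iff)
      then have k: "k \<ge> 1" "l = Suc k" "perimeter U = 2 * k" using per by (auto simp: k_def)
      have "abs_planar_map U \<in> Quad k"
      proof -
        have "\<forall>F\<in>interior_faces (N s). card F = 4" using N(4)[OF sr] abs_in_Quad(1)[OF N(1)[OF sr]] by simp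
        then show ?thesis
          unfolding abs_in_Quad(1)[OF U(1)] using U(5) k leaf_ext_interior[OF W] by simp
      qed
      moreover have "abs_planar_map (N s) = plus_leaf (abs_planar_map U)"
        unfolding U(5) using abs_leaf_ext[OF W] .
      moreover have "card (semi U) < card (semi M)"
      proof -
        have "semi M = insert x (insert y (semi U))"
          using simps(1)[of s] unfolding U(5) by (simp add: leaf_ext_def add_leaf_def)
        then show ?thesis using U(1-4) surface_map_permutes(3)[OF planar_surface_map[OF U(1)]] by simp
      qed
      ultimately have "\<exists>k u. k \<ge> 1 \<and> l = Suc k \<and> u \<in> Quad k \<and> abs_planar_map (N s) = plus_leaf u \<and>
          card (semi (rep_planar_map u)) < card (semi (rep_planar_map m))"
        using cardabs[OF U(1)] k by (intro exI[of _ k] exI[of _ "abs_planar_map U"]) (simp add: M_def)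
      then show ?thesis
        using that[OF N(4,2)[OF sr]] by blast
    qed
  qed
qed

text \<open>The pendant edge sits in the corner before the old root \<open>t\<close>. Once the root
  of \<open>plus_leaf u\<close> is moved back to \<open>t\<close>, the square cuts off the same
  three semi-edges as in \<open>u\<close>. Both orders therefore insert the same two edges in the
  same places and differ only in which new semi-edge is the root.\<close>

lemma edge_leaf_commute:
  assumes u: "u \<in> Quad l" "l \<ge> 2"
  obtains u' where "u' \<in> Quad (Suc l)" "rerooting_of (plus_leaf u) u'"
    "rerooting_of (plus_leaf (plus_edge u)) (plus_edge u')"
proof -
  define U where "U = rep_planar_map u"
  define x where "x = fresh_semi U"
  define y where "y = fresh_semi U + 1"
  define x' where "x' = fresh_semi U + 2"
  define y' where "y' = fresh_semi U + 3"
  have plU: "planar_cmap U" by (simp add: U_def rep_planar)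
  have uU: "u = abs_planar_map U" by (simp add: U_def abs_rep)
  have new: "x \<notin> semi U" "y \<notin> semi U" "x' \<notin> semi U" "y' \<notin> semi U" "distinct [x, y, x', y']"
    using fresh_semi[OF plU, of 0] fresh_semi[OF plU, of 1] fresh_semi[OF plU, of 2] fresh_semi[OF plU, of 3]
    by (auto simp: x_def y_def x'_def y'_def)
  have per: "perimeter U = 2 * l" using u Quad_rep by (simp add: U_def)
  define t where "t = root_semi U"
  define p where "p = before_root U"
  define q where "q = next_semi U (next_semi U t)"
  define L where "L = leaf_ext x' y' U"
  define L' where "L' = L\<lparr>root_semi := t\<rparr>"
  define V where "V = edge_ext x y U"
  define M where "M = leaf_ext x' y' V"
  have nU1: "x \<noteq> y" and nU2: "x' \<noteq> y'" using new by auto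
  have per4: "perimeter U \<ge> 4" using per u by simp
  note eU = plU new(1,2) nU1 per4 and lU = plU new(3,4) nU2
  interpret i: edge_insertion U x y p q
    using edge_ext_insertion[OF eU] by (simp add: p_def q_def t_def)
  interpret j: leaf_insertion U x' y' p
    using leaf_ext_insertion[OF lU] by (simp add: p_def)
  have V: "V = i.M" by (simp add: V_def edge_ext_def p_def q_def t_def)
  have L: "L = j.M" by (simp add: L_def leaf_ext_def p_def)
  have plV: "planar_cmap V" using edge_ext_planar[OF eU] by (simp add: V_def)
  have lV: "planar_cmap V" "x' \<notin> semi V" "y' \<notin> semi V" "x' \<noteq> y'"
    using plV new i.semi_add by (auto simp: V)
  have plL: "planar_cmap L" using leaf_ext_planar[OF lU] by (simp add: L_def)
  have tU: "t \<in> semi U" using planar_root[OF plU] by (simp add: t_def)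
  then have tL: "t \<in> semi L" using j.semi_add by (simp add: L)
  have plL': "planar_cmap L'" unfolding L'_def using planar_rerootI[OF plL tL] .
  have nL': "next_semi L' = next_semi j.M" "root_semi L' = t" "semi L' = semi j.M" "opp_semi L' = opp_semi j.M"
    by (simp_all add: L'_def L)
  have cU: "surface_map U" by (rule planar_surface_map[OF plU])
  have np: "next_semi U p = t" using next_before_root[OF cU] by (simp add: p_def t_def)
  have per': "card (face_at U t) \<ge> 4" using per4 by (simp add: perimeter_def root_face_def t_def)
  have k: "next_semi U t \<noteq> t" "next_semi U (next_semi U t) \<noteq> t"
    using face_no_short_period[OF cU, of 1 t] face_no_short_period[OF cU, of 2 t] per' by (auto simp: numeral_eq_Suc)
  \<comment> \<open>In \<open>L\<close> the semi-edge before \<open>t\<close> is no longer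
    \<open>p\<close> but \<open>x'\<close>, so the edge that cuts off the square is now attached
    after \<open>x'\<close>.\<close>
  have br': "before_root L' = x'"
    by (rule before_root_eqI[OF planar_surface_map[OF plL']]) (simp add: nL' j.next_simps np)
  have tp: "t \<notin> {p, x', y'}" "next_semi U t \<notin> {p, x', y'}"
    using k np tU new surface_map_in(1)[OF cU, of t] by auto
  have q': "next_semi L' (next_semi L' (root_semi L')) = q"
    using tp by (simp add: nL' j.next_simps(4) q_def)
  have brV: "before_root V = p"
    by (rule before_root_eqI[OF planar_surface_map[OF plV]]) (simp add: V i.next_simps i.root_add)
  have rL': "root_face L' = root_face L"
  proof -
    have "t \<in> root_face L"
      using leaf_ext_root_face[OF lU] self_in_face[OF cU] by (simp add: root_face_def L_def t_def)
    then show ?thesis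
      using face_at_eq[OF planar_surface_map[OF plL]] by (simp add: root_face_def L'_def face_at_def)
  qed
  have perL: "perimeter L = 2 * l + 2" using leaf_ext_perimeter[OF lU] per by (simp add: L_def)
  then have perL': "perimeter L' = 2 * l + 2" using rL' by (simp add: perimeter_def)
  have eL: "planar_cmap L'" "x \<notin> semi L'" "y \<notin> semi L'" "x \<noteq> y" "perimeter L' \<ge> 4"
    using new u(2) by (simp_all add: plL' nL'(3) j.semi_add perL')
  \<comment> \<open>With common labels the two maps are equal up to the root and not merely
    isomorphic: the claim reduces to identities between products of transpositions, checked on the
    six labels involved.\<close>
  have key: "edge_ext x y L' = M\<lparr>root_semi := x\<rparr>"
  proof -
    have d: "distinct [p, q, x, y, x', y']"
      using new i.distinct j.distinct i.pq by auto
    have dd: "p \<noteq> q" "p \<noteq> x" "p \<noteq> y" "p \<noteq> x'" "p \<noteq> y'" 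
      "q \<noteq> p" "q \<noteq> x" "q \<noteq> y" "q \<noteq> x'" "q \<noteq> y'" "x \<noteq> p" "x \<noteq> q" "x \<noteq> y" "x \<noteq> x'" "x \<noteq> y'" 
      "y \<noteq> p" "y \<noteq> q" "y \<noteq> x" "y \<noteq> x'" "y \<noteq> y'" "x' \<noteq> p" "x' \<noteq> q" "x' \<noteq> x" "x' \<noteq> y" "x' \<noteq> y'" 
      "y' \<noteq> p" "y' \<noteq> q" "y' \<noteq> x" "y' \<noteq> y" "y' \<noteq> x'"
      using d by auto
    have "tr x' y' \<circ> tr x y = tr x y \<circ> tr x' y'"
      using d by (auto simp: fun_eq_iff Transposition.transpose_def)
    moreover have "tr p x' \<circ> tr p y' \<circ> tr x' q \<circ> tr x' x \<circ> tr q y = tr p q \<circ> tr p x \<circ> tr q y \<circ> tr p x' \<circ> tr p y'"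
      (is "?l = ?r")
    proof
      fix s
      consider "s = p" | "s = q" | "s = x" | "s = y" | "s = x'" | "s = y'" | "s \<notin> {p, q, x, y, x', y'}" by blast
      then show "?l s = ?r s"
        by cases (simp_all add: Transposition.transpose_def dd)
    qed
    ultimately show ?thesis
      unfolding edge_ext_def br' q' M_def leaf_ext_def brV
      by (simp add: add_edge_def add_leaf_def nL' V insert_commute comp_assoc)
  qed
  have plM: "planar_cmap M" using leaf_ext_planar[OF lV] by (simp add: M_def)
  have xM: "x \<in> semi M" by (simp add: M_def leaf_ext_def add_leaf_def V i.semi_add)
  show ?thesis
  proof
    show "abs_planar_map L' \<in> Quad (Suc l)"
    proof -
      have "plus_leaf u = abs_planar_map L"
        unfolding uU L_def using abs_leaf_ext[OF lU] by simp
      then have "abs_planar_map L \<in> Quad (Suc l)" using plus_leaf(1)[OF u(1)] by simp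
      then show ?thesis
        unfolding abs_in_Quad(1)[OF plL] abs_in_Quad(1)[OF plL'] using perL' rL'
        by (simp add: interior_faces_def faces_def face_at_def L'_def)
    qed
    show "rerooting_of (plus_leaf u) (abs_planar_map L')"
      using rerooting_abs[OF plL tL] abs_leaf_ext[OF lU] by (simp add: uU L_def L'_def)
    have "plus_leaf (plus_edge u) = abs_planar_map M"
      unfolding uU M_def abs_leaf_ext[OF lV] unfolding V_def abs_edge_ext[OF eU] ..
    moreover have "plus_edge (abs_planar_map L') = abs_planar_map (M\<lparr>root_semi := x\<rparr>)"
      using abs_edge_ext[OF eL] key by simp
    ultimately show "rerooting_of (plus_leaf (plus_edge u)) (plus_edge (abs_planar_map L'))"
      using rerooting_abs[OF plM xM] by simp
  qed
qed

section \<open>Gluing along one hole\<close>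

lemma funpow_eq_iff_mod:
  assumes "x \<in> orbit f x"
  shows "(f ^^ i) x = (f ^^ j) x \<longleftrightarrow> i mod card (orbit f x) = j mod card (orbit f x)"
proof -
  let ?n = "card (orbit f x)"
  have n: "0 < ?n" using finite_orbit[OF assms] orbit_nonempty[of f x] by (simp add: card_gt_0_iff)
  have m: "(f ^^ i) x = (f ^^ (i mod ?n)) x" for i
    using funpow_mod_eq[OF card_orbit_funpow(1)[OF assms]] by simp
  have "inj_on (\<lambda>n. (f ^^ n) x) {..<?n}" using card_orbit_funpow(2)[OF assms] by (simp add: bij_betw_def)
  then have "(f ^^ (i mod ?n)) x = (f ^^ (j mod ?n)) x \<longleftrightarrow> i mod ?n = j mod ?n"
    using n by (auto dest: inj_onD)
  then show ?thesis using m by metis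
qed

lemma funpow_in_face: "surface_map M \<Longrightarrow> (next_semi M ^^ i) s \<in> face_at M s"
  unfolding face_at_def by (rule funpow_in_orbit) (metis surface_map_permutes(1,3) self_in_orbit)

lemma face_eq_funpow: "surface_map M \<Longrightarrow> z \<in> face_at M s \<Longrightarrow> \<exists>i. z = (next_semi M ^^ i) s"
  unfolding face_at_def by (auto simp: orbit_altdef)

lemma face_inv:
  assumes "surface_map M"
  shows "face_at M s = orbit (inv (next_semi M)) s"
  unfolding face_at_def
  using orbit_inv_eq[of "next_semi M"] surface_map_permutes(1,3)[OF assms] permutation_permutes by blast

text \<open>When no edge of the hole has the hole on both sides, filling it with \<open>U\<close> replaces the root
  face of \<open>U\<close> by the other sides of the edges of the hole.\<close>

lemma glue_one_hole:
  fixes Q :: "'d cmap" and U :: "'e cmap" and M :: "'e cmap"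
  assumes Q: "surface_map Q" and U: "planar_cmap U" and uh: "u h = U"
    and deg: "card (face_at Q h) = perimeter U"
    and hole: "\<And>s. s \<in> face_at Q h \<Longrightarrow> opp_semi Q s \<notin> face_at Q h"
    and M: "semi M = semi U \<union> X" "X \<inter> semi U = {}" "root_semi M \<in> X"
    and b0: "bij_betw b0 (root_face U \<union> X) (semi Q - face_at Q h)" "b0 (root_semi M) = root_semi Q"
    and oppU: "\<And>s. s \<in> semi U \<Longrightarrow> opp_semi M s = opp_semi U s"
    and oppX: "\<And>s. s \<in> X \<Longrightarrow> opp_semi M s \<in> X \<and> b0 (opp_semi M s) = opp_semi Q (b0 s)"
    and bt: "\<And>i. b0 ((next_semi U ^^ i) (root_semi U)) = opp_semi Q ((inv (next_semi Q) ^^ i) h)"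
    and nextU: "\<And>s. s \<in> semi U - root_face U \<Longrightarrow> next_semi M s = next_semi U s"
    and nextX: "\<And>s. s \<in> root_face U \<union> X \<Longrightarrow> next_semi M s \<in> root_face U \<union> X \<and> b0 (next_semi M s) = next_semi Q (b0 s)"
  shows "isomorphic M (glue Q {h} u)"
proof -
  define W where "W = face_at Q h"
  define b where "b s = (if s \<in> semi U - root_face U then Inr (h, s) else Inl (b0 s))" for s
  define R where "R = {(s, sum_opp Q u t) | s t. seam Q {h} u s t}"
  let ?t = "\<lambda>i. (next_semi U ^^ i) (root_semi U)" and ?h = "\<lambda>i. (inv (next_semi Q) ^^ i) h"
  have cU: "surface_map U" by (rule planar_surface_map[OF U])
  have rsub: "root_face U \<subseteq> semi U"
    using face_at_subset[OF cU planar_root[OF U]] by (simp add: root_face_def)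
  have gs: "glue_semi Q {h} u = Inl ` (semi Q - W) \<union> Inr ` ({h} \<times> (semi U - root_face U))"
    by (auto simp: glue_semi_def uh W_def)
  have oo: "opp_semi Q (opp_semi Q s) = s" for s using surface_map_opp_opp[OF Q] .
  have hW: "?h i \<in> W" for i
  proof -
    have "h \<in> orbit (inv (next_semi Q)) h"
      using self_in_face[OF Q, of h] face_inv[OF Q] by simp
    then show ?thesis unfolding W_def face_inv[OF Q] by (rule funpow_in_orbit)
  qed
  have tr: "?t i \<in> root_face U" for i
    unfolding root_face_def by (rule funpow_in_face[OF cU])
  \<comment> \<open>The boundary of \<open>U\<close> and the hole have the same length, so both
    walks have the same period and the seam is a bijection.\<close>
  have th: "?t i = ?t j \<longleftrightarrow> ?h i = ?h j" for i j
  proof -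
    have "root_semi U \<in> orbit (next_semi U) (root_semi U)" "h \<in> orbit (inv (next_semi Q)) h"
      using self_in_face[OF cU] self_in_face[OF Q, of h] face_inv[OF Q, of h] by (auto simp: face_at_def)
    then show ?thesis
      using funpow_eq_iff_mod deg face_inv[OF Q, of h] by (metis perimeter_def root_face_def face_at_def)
  qed
  have seam: "seam Q {h} u x y \<longleftrightarrow> (\<exists>i. (x = Inl (?h i) \<and> y = Inr (h, ?t i)) \<or> (x = Inr (h, ?t i) \<and> y = Inl (?h i)))" for x y
    by (auto simp: seam_def uh doubleton_eq_iff)
  have Rh: "(Inl (?h i), Inr (h, opp_semi U (?t i))) \<in> R" for i
    unfolding R_def using seam uh by force
  have Rt: "(Inr (h, ?t i), Inl (opp_semi Q (?h i))) \<in> R" for i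
    unfolding R_def using seam by force
  have Rcases: "(\<exists>i. x = Inl (?h i) \<and> y = Inr (h, opp_semi U (?t i))) \<or> (\<exists>i. x = Inr (h, ?t i) \<and> y = Inl (opp_semi Q (?h i)))"
    if "(x, y) \<in> R" for x y
    using that unfolding R_def seam by (auto simp: uh)
  \<comment> \<open>Each vanished semi-edge has one partner on the seam, so the walk that looks for
    the other side of an edge is deterministic. Surviving semi-edges lie outside the domain of
    \<open>R\<close> and end it, which makes the description in \<open>glue_opp\<close>
    unique.\<close>
  have sv: "single_valued R"
    unfolding single_valued_def
  proof (intro allI impI)
    fix x y z assume "(x, y) \<in> R" "(x, z) \<in> R"
    from Rcases[OF this(1)] Rcases[OF this(2)] show "y = z"
      using th by (elim disjE exE) (simp_all, metis+)
  qed
  have dom: "y \<notin> Domain R" if "y \<in> glue_semi Q {h} u" for y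
  proof
    assume "y \<in> Domain R"
    then obtain z where "(y, z) \<in> R" by auto
    from Rcases[OF this] show False
      using that hW tr unfolding gs by auto
  qed
  have opp_eq: "glue_opp Q {h} u x = y"
    if "y \<in> glue_semi Q {h} u" "(sum_opp Q u x, y) \<in> R\<^sup>*" for x y
    unfolding glue_opp_def R_def[symmetric]
  proof (rule the_equality)
    fix z assume z: "z \<in> glue_semi Q {h} u \<and> (sum_opp Q u x, z) \<in> R\<^sup>*"
    then have "(z, y) \<in> R\<^sup>* \<or> (y, z) \<in> R\<^sup>*"
      using single_valued_confluent[OF sv] that by blast
    then show "z = y" using dom[OF that(1)] dom[of z] z by (metis Not_Domain_rtrancl)
  qed (use that in auto)
  have bin: "b s \<in> glue_semi Q {h} u" if "s \<in> semi M" for s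
  proof (cases "s \<in> semi U - root_face U")
    case False
    then have "s \<in> root_face U \<union> X" using that M(1) by auto
    then have "b0 s \<in> semi Q - W" using b0(1) by (auto simp: bij_betw_def W_def)
    then show ?thesis using False by (auto simp: b_def gs)
  qed (simp add: b_def gs)
  have reach: "(Inr (h, z), b z) \<in> R\<^sup>*" if z: "z \<in> semi U" for z
  proof (cases "z \<in> root_face U")
    case True
    then obtain i where "z = ?t i" using face_eq_funpow[OF cU] unfolding root_face_def by blast
    then show ?thesis using Rt[of i] bt[of i] True by (auto simp: b_def)
  next
    case False
    then show ?thesis using z by (simp add: b_def)
  qed
  have XU: "s \<notin> semi U" if "s \<in> X" for s using that M(2) by auto
  have opp: "glue_opp Q {h} u (b s) = b (opp_semi M s)" if s: "s \<in> semi M" for s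
  proof (rule opp_eq)
    have osM: "opp_semi M s \<in> semi M"
      using s M(1) oppU oppX surface_map_in(2)[OF cU] by (metis Un_iff)
    show "b (opp_semi M s) \<in> glue_semi Q {h} u" using bin[OF osM] .
    show "(sum_opp Q u (b s), b (opp_semi M s)) \<in> R\<^sup>*"
    proof (cases "s \<in> X")
      case True
      then show ?thesis using oppX[OF True] XU[of s] XU[of "opp_semi M s"] by (simp add: b_def)
    next
      case False
      then have sU: "s \<in> semi U" using s M(1) by auto
      then have oU: "opp_semi U s \<in> semi U" "opp_semi M s = opp_semi U s"
        using surface_map_in(2)[OF cU] oppU by auto
      show ?thesis
      proof (cases "s \<in> root_face U")
        case True
        \<comment> \<open>From the outer side of a hole edge the walk enters the hole, passes to the
          filling and crosses the edge there. If that edge has both sides on the boundary of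
          \<open>U\<close>, \<open>reach\<close> supplies the further step that leaves the filling
          again.\<close>
        then obtain i where i: "s = ?t i" using face_eq_funpow[OF cU] unfolding root_face_def by blast
        have "sum_opp Q u (b s) = Inl (?h i)"
          using True bt[of i] oo i by (simp add: b_def)
        then show ?thesis
          using Rh[of i] reach[OF oU(1)] i oU(2) by (metis converse_rtrancl_into_rtrancl)
      next
        case False
        then have "sum_opp Q u (b s) = Inr (h, opp_semi U s)" using sU by (simp add: b_def uh)
        then show ?thesis using reach[OF oU(1)] oU(2) by simp
      qed
    qed
  qed
  have nxt: "sum_nxt Q u (b s) = b (next_semi M s)" if s: "s \<in> semi M" for s
  proof (cases "s \<in> semi U - root_face U")
    case True
    have "next_semi U s \<notin> root_face U"
    proof
      assume "next_semi U s \<in> root_face U"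
      then have "face_at U (next_semi U s) = root_face U"
        using face_at_eq[OF cU] by (simp add: root_face_def)
      moreover have "face_at U (next_semi U s) = face_at U s"
        using face_at_eq[OF cU next_in_face[OF cU self_in_face[OF cU]]] .
      ultimately show False using True self_in_face[OF cU, of s] by auto
    qed
    then show ?thesis using True nextU[OF True] surface_map_in(1)[OF cU, of s] by (simp add: b_def uh)
  next
    case False
    then have "s \<in> root_face U \<union> X" using s M(1) by auto
    from nextX[OF this] show ?thesis using False XU by (auto simp: b_def)
  qed
  have "iso_via b M (glue Q {h} u)"
    unfolding iso_via_def
  proof (intro conjI ballI)
    show "bij_betw b (semi M) (semi (glue Q {h} u))"
    proof -
      have 1: "bij_betw b (root_face U \<union> X) (Inl ` (semi Q - W))"
      proof -
        have "bij_betw (Inl \<circ> b0 :: _ \<Rightarrow> 'd + 'd \<times> 'e) (root_face U \<union> X) (Inl ` (semi Q - W))"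
          by (rule bij_betw_trans[OF b0(1)]) (auto simp: bij_betw_def W_def)
        then show ?thesis
          by (rule bij_betw_cong[THEN iffD1, rotated]) (use XU in \<open>auto simp: b_def\<close>)
      qed
      have 2: "bij_betw b (semi U - root_face U) (Inr ` ({h} \<times> (semi U - root_face U)))"
        by (auto simp: bij_betw_def inj_on_def b_def image_def)
      have "bij_betw b ((root_face U \<union> X) \<union> (semi U - root_face U)) (semi (glue Q {h} u))"
        unfolding glue_def cmap.simps gs by (rule bij_betw_combine[OF 1 2]) auto
      moreover have "(root_face U \<union> X) \<union> (semi U - root_face U) = semi M" using M(1) rsub by auto
      ultimately show ?thesis by simp
    qed
    show "b (root_semi M) = root_semi (glue Q {h} u)"
      using M(3) XU b0(2) by (simp add: b_def glue_def)
    fix s assume s: "s \<in> semi M"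
    show "b (opp_semi M s) = opp_semi (glue Q {h} u) (b s)"
      using bin[OF s] opp[OF s] by (simp add: glue_def)
    show "b (next_semi M s) = next_semi (glue Q {h} u) (b s)"
      using bin[OF s] nxt[OF s] by (simp add: glue_def)
  qed
  then show ?thesis using isomorphic_iff by blast
qed

subsection \<open>Cycles\<close>

text \<open>The semi-edges \<open>0, \<dots>, n - 1\<close> form the root face, and \<open>n + i\<close> is opposite to \<open>i\<close>.\<close>

definition cycle_map :: "nat \<Rightarrow> nat cmap" where
  "cycle_map n = \<lparr>semi = {..<2 * n},
     opp_semi = (\<lambda>s. if s < n then s + n else if s < 2 * n then s - n else s),
     next_semi = (\<lambda>s. if s < n then (if s + 1 = n then 0 else s + 1)
                     else if s < 2 * n then (if s = n then 2 * n - 1 else s - 1) else s),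
     root_semi = 0\<rparr>"

lemma cycle_next_inv:
  assumes "0 < n"
  shows "next_semi (cycle_map n) permutes semi (cycle_map n)"
    and "inv (next_semi (cycle_map n)) = (\<lambda>s. if s < n then (if s = 0 then n - 1 else s - 1)
                     else if s < 2 * n then (if s + 1 = 2 * n then n else s + 1) else s)"
      (is "_ = ?prev")
proof -
  have 1: "next_semi (cycle_map n) (?prev s) = s" "?prev (next_semi (cycle_map n) s) = s" for s
    using assms by (auto simp: cycle_map_def)
  show "next_semi (cycle_map n) permutes semi (cycle_map n)"
  proof (rule bij_imp_permutes)
    show "bij_betw (next_semi (cycle_map n)) (semi (cycle_map n)) (semi (cycle_map n))"
      by (rule bij_betw_byWitness[where f' = ?prev]) (use 1 assms in \<open>auto simp: cycle_map_def\<close>)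
  qed (auto simp: cycle_map_def)
  show "inv (next_semi (cycle_map n)) = ?prev"
    by (rule inv_equality) (use 1 in auto)
qed

lemma cycle_closed:
  assumes "0 < n"
  shows "surface_map (cycle_map n)"
proof -
  have "opp_semi (cycle_map n) permutes semi (cycle_map n)"
  proof (rule bij_imp_permutes)
    show "bij_betw (opp_semi (cycle_map n)) (semi (cycle_map n)) (semi (cycle_map n))"
      by (rule bij_betw_byWitness[where f' = "opp_semi (cycle_map n)"]) (use assms in \<open>auto simp: cycle_map_def\<close>)
  qed (auto simp: cycle_map_def)
  then show ?thesis
    using cycle_next_inv(1)[OF assms] assms by (auto simp: surface_map_def cycle_map_def)
qed

text \<open>Walking backwards around the inner face keeps pace with walking forwards around the root
  face on the other side of the cycle, so the seam of the hole marked at \<open>n\<close> matches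
  positions counted from the root 0.\<close>

lemma cycle_opp_funpow:
  assumes "0 < n"
  shows "opp_semi (cycle_map n) ((inv (next_semi (cycle_map n)) ^^ i) n) = (next_semi (cycle_map n) ^^ i) 0"
proof -
  let ?g = "inv (next_semi (cycle_map n))"
  have "(?g ^^ i) n \<in> {n..<2 * n} \<and> opp_semi (cycle_map n) ((?g ^^ i) n) = (next_semi (cycle_map n) ^^ i) 0"
  proof (induction i)
    case 0
    then show ?case using assms by (simp add: cycle_map_def)
  next
    case (Suc i)
    define s where "s = (?g ^^ i) n"
    have sn: "n \<le> s" "s < 2 * n" using Suc by (auto simp: s_def)
    then have "?g s \<in> {n..<2 * n}" "opp_semi (cycle_map n) (?g s) = next_semi (cycle_map n) (opp_semi (cycle_map n) s)"
      unfolding cycle_next_inv(2)[OF assms] by (auto simp: cycle_map_def)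
    then show ?case using Suc by (simp add: s_def)
  qed
  then show ?thesis by simp
qed

lemma cycle_faces:
  assumes "0 < n"
  shows "face_at (cycle_map n) 0 = {..<n}" "face_at (cycle_map n) n = {n..<2 * n}"
proof -
  let ?f = "next_semi (cycle_map n)" and ?g = "inv (next_semi (cycle_map n))"
  have f: "(?f ^^ i) 0 = i" if "i < n" for i
    using that by (induction i) (auto simp: cycle_map_def)
  have "(?f ^^ n) 0 = 0"
  proof -
    obtain k where k: "n = Suc k" using assms not0_implies_Suc by blast
    then show ?thesis using f[of k] by (simp add: cycle_map_def)
  qed
  from orbit_altdef_bounded[OF this assms] show "face_at (cycle_map n) 0 = {..<n}"
    using f by (force simp: face_at_def)
  have g: "(?g ^^ i) n = n + i" if "i < n" for i
    using that by (induction i) (auto simp: cycle_next_inv(2)[OF assms])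
  have "(?g ^^ n) n = n"
  proof -
    obtain k where k: "n = Suc k" using assms not0_implies_Suc by blast
    then have "(?g ^^ Suc k) n = ?g (n + k)" using g[of k] by simp
    also have "\<dots> = n" using k unfolding cycle_next_inv(2)[OF assms] by simp
    finally show ?thesis using k by simp
  qed
  then have "face_at (cycle_map n) n = {(?g ^^ i) n |i. i < n}"
    unfolding face_inv[OF cycle_closed[OF assms]] by (rule orbit_altdef_bounded[OF _ assms])
  also have "\<dots> = {n + i |i. i < n}"
    by (intro Collect_cong ex_cong1) (auto simp: g)
  also have "\<dots> = {n..<2 * n}" by auto presburger
  finally show "face_at (cycle_map n) n = {n..<2 * n}" .
qed

lemma cycle_map_faces:
  assumes n: "0 < n"
  shows "faces (cycle_map n) = {{..<n}, {n..<2 * n}}"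
proof -
  let ?N = "cycle_map n"
  note c = cycle_closed[OF n] and f = cycle_faces[OF n]
  have fs: "face_at ?N s = (if s < n then {..<n} else {n..<2 * n})" if "s < 2 * n" for s
    using face_at_eq[OF c, of s 0] face_at_eq[OF c, of s n] f that by auto
  have semi: "semi ?N = {..<2 * n}" by (simp add: cycle_map_def)
  have "face_at ?N 0 \<in> faces ?N" "face_at ?N n \<in> faces ?N"
    unfolding faces_def by (rule imageI; use n semi in simp)+
  moreover have "X \<in> {{..<n}, {n..<2 * n}}" if X: "X \<in> faces ?N" for X
  proof -
    obtain s where "s < 2 * n" "X = face_at ?N s" using X unfolding faces_def semi by blast
    then show ?thesis using fs[of s] by simp
  qed
  ultimately show ?thesis using f by auto
qed

lemma cycle_planar:
  assumes n: "0 < n"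
  shows "planar_cmap (cycle_map n)"
proof -
  let ?N = "cycle_map n"
  note c = cycle_closed[OF n] and f = cycle_faces[OF n]
  have fs: "face_at ?N s = (if s < n then {..<n} else {n..<2 * n})" if "s < 2 * n" for s
    using face_at_eq[OF c, of s 0] face_at_eq[OF c, of s n] f that by auto
  have semi: "semi ?N = {..<2 * n}" by (simp add: cycle_map_def)
  have "faces ?N = {{..<n}, {n..<2 * n}}" by (rule cycle_map_faces[OF n])
  moreover have "{..<n} \<noteq> {n..<2 * n}" using n by (metis atLeastLessThan_iff lessThan_iff not_le)
  ultimately have F: "card (faces ?N) = 2" by simp
  have E: "2 * card (edges ?N) = 2 * n" using card_edges[OF c] semi by simp
  have V: "2 * card (vertices ?N) = 2 * n"
  proof -
    let ?nu = "next_semi ?N \<circ> opp_semi ?N"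
    have nu: "?nu s \<noteq> s" "?nu (?nu s) = s" if "s < 2 * n" for s
      using that by (auto simp: cycle_map_def)
    \<comment> \<open>All vertices have degree 2, so the rotation \<open>?nu\<close> is a
      fixed-point-free involution. In the place of \<open>opp_semi\<close> it turns vertices into
      edges, and \<open>card_edges\<close> counts them.\<close>
    have "surface_map (?N\<lparr>opp_semi := ?nu\<rparr>)"
      using surface_map_permutes[OF c] nu by (simp add: surface_map_def semi)
    from card_edges[OF this] have "2 * card ((\<lambda>s. {s, ?nu s}) ` semi ?N) = 2 * n"
      by (simp add: edges_def semi)
    moreover have "orbit ?nu s = {s, ?nu s}" if "s \<in> semi ?N" for s
    proof -
      have "(?nu ^^ 2) s = s" using nu(2) that semi by (simp add: numeral_2_eq_2)
      from orbit_altdef_bounded[OF this] have "orbit ?nu s = (\<lambda>m. (?nu ^^ m) s) ` {..<2}" by auto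
      also have "{..<2} = {0, 1 :: nat}" by auto
      finally show ?thesis by (simp add: comp_def)
    qed
    then have "vertices ?N = (\<lambda>s. {s, ?nu s}) ` semi ?N"
      unfolding vertices_def by (rule image_cong[OF refl])
    ultimately show ?thesis by simp
  qed
  have "connected_map ?N"
    unfolding connected_map_iff[OF c]
  proof (intro allI impI)
    fix A assume A: "A \<subseteq> semi ?N" "A \<noteq> {}" "\<forall>s\<in>A. opp_semi ?N s \<in> A \<and> next_semi ?N s \<in> A"
    have orb: "face_at ?N s \<subseteq> A" if "s \<in> A" for s
    proof
      fix z assume "z \<in> face_at ?N s"
      then show "z \<in> A" unfolding face_at_def by induction (use that A in auto)
    qed
    obtain s where s: "s \<in> A" "s < 2 * n" using A semi by auto
    have o: "opp_semi ?N s \<in> A" "opp_semi ?N s < 2 * n" "opp_semi ?N s < n \<longleftrightarrow> \<not> s < n"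
      using s A by (auto simp: cycle_map_def)
    have "{..<n} \<union> {n..<2 * n} \<subseteq> A"
      using orb[OF s(1)] orb[OF o(1)] fs[OF s(2)] fs[OF o(2)] o(3) by (auto split: if_splits)
    moreover have "{..<n} \<union> {n..<2 * n} = {..<2 * n}" by auto
    ultimately show "A = semi ?N" using A(1) semi by auto
  qed
  then show ?thesis
    unfolding planar_cmap_iff using c F E V n by (simp add: cycle_map_def)
qed

text \<open>Equal perimeters give both walks from the root the same period, so sending a position on
  one boundary to the same position on the other does not depend on how the position is
  counted.\<close>

lemma root_faces_matching:
  assumes U: "planar_cmap U" and N: "planar_cmap N" and per: "perimeter U = perimeter N"
  obtains b where "bij_betw b (root_face U) (root_face N)"
    "\<And>i. b ((next_semi U ^^ i) (root_semi U)) = (next_semi N ^^ i) (root_semi N)"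
proof -
  let ?t = "\<lambda>i. (next_semi U ^^ i) (root_semi U)" and ?s = "\<lambda>i. (next_semi N ^^ i) (root_semi N)"
  have cU: "surface_map U" and cN: "surface_map N" using U N planar_surface_map by auto
  have eq: "?t i = ?t j \<longleftrightarrow> ?s i = ?s j" for i j
  proof -
    have "root_semi U \<in> orbit (next_semi U) (root_semi U)" "root_semi N \<in> orbit (next_semi N) (root_semi N)"
      using self_in_face[OF cU] self_in_face[OF cN] by (auto simp: face_at_def)
    then show ?thesis
      using funpow_eq_iff_mod per by (metis perimeter_def root_face_def face_at_def)
  qed
  define b where "b z = ?s (SOME i. z = ?t i)" for z
  have bt: "b (?t i) = ?s i" for i
  proof -
    have "?t i = ?t (SOME j. ?t i = ?t j)" by (rule someI[of "\<lambda>j. ?t i = ?t j"]) simp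
    then show ?thesis unfolding b_def using eq by metis
  qed
  have rU: "root_face U = range ?t" and rN: "root_face N = range ?s"
    using face_eq_funpow[OF cU] funpow_in_face[OF cU] face_eq_funpow[OF cN] funpow_in_face[OF cN]
    unfolding root_face_def by blast+
  have "bij_betw b (root_face U) (root_face N)"
    unfolding bij_betw_def
  proof
    show "inj_on b (root_face U)" unfolding rU by (rule inj_onI) (use bt eq in force)
    show "b ` root_face U = root_face N" unfolding rU rN image_image using bt by simp
  qed
  then show ?thesis using that bt by blast
qed

text \<open>This is the common core of the two gluings: \<open>M\<close> arises from
  \<open>U\<close>, and \<open>Q\<close> from the cycle, by one edge inserted in the same way in the
  root face. The hole is the inner face of the cycle, marked at \<open>n\<close>. The matching of
  the two boundaries is constructed only inside the proof, so \<open>nextX\<close> is demanded for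
  every matching.\<close>

lemma glue_cycle:
  assumes U: "planar_cmap U" "x \<notin> semi U" "y \<notin> semi U" "x \<noteq> y" "perimeter U = n" "0 < n"
    and M: "semi M = insert x (insert y (semi U))" "root_semi M = x" "opp_semi M x = y" "opp_semi M y = x"
      "\<forall>s. s \<notin> {x, y} \<longrightarrow> opp_semi M s = opp_semi U s"
      "\<forall>s\<in>semi U - root_face U. next_semi M s = next_semi U s"
    and new: "x' \<notin> semi (cycle_map n)" "y' \<notin> semi (cycle_map n)" "x' \<noteq> y'"
    and Q: "surface_map Q" "semi Q = insert x' (insert y' (semi (cycle_map n)))" "root_semi Q = x'"
      "opp_semi Q x' = y'" "opp_semi Q y' = x'"
      "\<forall>s. s \<notin> {x', y'} \<longrightarrow> opp_semi Q s = opp_semi (cycle_map n) s"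
      "\<forall>s\<in>semi (cycle_map n) - root_face (cycle_map n). next_semi Q s = next_semi (cycle_map n) s"
    and nextX: "\<forall>b. b x = x' \<and> b y = y' \<and>
      bij_betw b (root_face U \<union> {x, y}) (root_face (cycle_map n) \<union> {x', y'}) \<and>
      (\<forall>i. b ((next_semi U ^^ i) (root_semi U)) = (next_semi (cycle_map n) ^^ i) 0) \<longrightarrow>
      (\<forall>s\<in>root_face U \<union> {x, y}.
        next_semi M s \<in> root_face U \<union> {x, y} \<and> b (next_semi M s) = next_semi Q (b s))"
    and un: "u n = U"
  shows "isomorphic M (glue Q {n} u)" and "face_at Q n = {n..<2 * n}"
proof -
  let ?N = "cycle_map n"
  note cf = cycle_faces[OF U(6)] and cN = cycle_closed[OF U(6)] and plN = cycle_planar[OF U(6)]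
  have rN: "root_semi ?N = 0" "semi ?N = {..<2 * n}" by (simp_all add: cycle_map_def)
  have rfN: "root_face ?N = {..<n}" using cf rN by (simp add: root_face_def)
  have perN: "perimeter U = perimeter ?N" using U(5) rfN by (simp add: perimeter_def)
  obtain b1 where b1: "bij_betw b1 (root_face U) (root_face ?N)"
    "\<And>i. b1 ((next_semi U ^^ i) (root_semi U)) = (next_semi ?N ^^ i) 0"
    using root_faces_matching[OF U(1) plN perN] rN by metis
  define b where "b = b1(x := x', y := y')"
  have cU: "surface_map U" using planar_surface_map[OF U(1)] .
  have rsub: "root_face U \<subseteq> semi U"
    using face_at_subset[OF cU planar_root[OF U(1)]] by (simp add: root_face_def)
  have rsubN: "root_face ?N \<subseteq> semi ?N" using rfN rN by auto
  have bx: "b x = x'" "b y = y'" using U(4) by (auto simp: b_def)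
  have bb1: "b s = b1 s" if "s \<in> root_face U" for s using that rsub U(2,3) by (auto simp: b_def)
  have bij: "bij_betw b (root_face U \<union> {x, y}) (root_face ?N \<union> {x', y'})"
  proof (rule bij_betw_combine)
    show "bij_betw b (root_face U) (root_face ?N)" using b1(1) bb1 by (metis bij_betw_cong)
    show "bij_betw b {x, y} {x', y'}" using bx new(3) U(4) by (auto simp: bij_betw_def)
    show "root_face ?N \<inter> {x', y'} = {}" using rsubN new by auto
  qed
  have bt: "b ((next_semi U ^^ i) (root_semi U)) = (next_semi ?N ^^ i) 0" for i
    using b1(2)[of i] bb1 funpow_in_face[OF cU] by (simp add: root_face_def)
  have hf: "next_semi Q s = next_semi ?N s" if "s \<in> {n..<2 * n}" for s
    using that Q(7) rN rfN by auto
  have fQ: "face_at Q n = face_at ?N n"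
    unfolding face_at_def
  proof (rule orbit_cong)
    show "n \<in> orbit (next_semi ?N) n" using self_in_face[OF cN] by (simp add: face_at_def)
    show "next_semi Q s = next_semi ?N s" if "s \<in> orbit (next_semi ?N) n" for s
      using that hf cf by (simp add: face_at_def)
  qed
  then show fQ': "face_at Q n = {n..<2 * n}" using cf by simp
  \<comment> \<open>Backward steps from \<open>n\<close> stay in the hole, where \<open>Q\<close>
    and the cycle agree, so the seam is the one computed for the cycle.\<close>
  have inv: "(inv (next_semi Q) ^^ i) n = (inv (next_semi ?N) ^^ i) n \<and> (inv (next_semi ?N) ^^ i) n \<in> {n..<2 * n}" for i
  proof (induction i)
    case (Suc i)
    define z where "z = (inv (next_semi ?N) ^^ i) n"
    define w where "w = inv (next_semi ?N) z"
    have z: "z \<in> {n..<2 * n}" using Suc by (simp add: z_def)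
    have nw: "next_semi ?N w = z"
      unfolding w_def using cycle_next_inv(1)[OF U(6)] by (meson permutes_inverses(1))
    have w: "w \<in> {n..<2 * n}"
      using z unfolding w_def cycle_next_inv(2)[OF U(6)] by auto
    have "next_semi Q w = z" using hf[OF w] nw by simp
    then have "inv (next_semi Q) z = w"
      using surface_map_permutes(1)[OF Q(1)] by (metis permutes_inverses(2))
    then show ?case using Suc w by (simp add: z_def w_def)
  qed (use U(6) in auto)
  have nxy: "s \<notin> {x', y'}" if "s \<in> {..<2 * n}" for s using that new rN by auto
  show "isomorphic M (glue Q {n} u)"
  proof (rule glue_one_hole[where X = "{x, y}" and ?b0.0 = b and h = n and u = u and U = U, OF Q(1) U(1) un])
    show "card (face_at Q n) = perimeter U" using fQ' U(5) by simp
    show "opp_semi Q s \<notin> face_at Q n" if "s \<in> face_at Q n" for s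
      using that Q(6)[rule_format, of s] nxy[of s] unfolding fQ' by (auto simp: cycle_map_def)
    show "bij_betw b (root_face U \<union> {x, y}) (semi Q - face_at Q n)"
    proof -
      have "semi Q - face_at Q n = root_face ?N \<union> {x', y'}"
      proof -
        have "{..<2 * n} - {n..<2 * n} = {..<n}" by auto
        moreover have "x' \<notin> {n..<2 * n}" "y' \<notin> {n..<2 * n}" using new(1,2) unfolding rN(2) by simp_all
        then have "insert x' (insert y' {..<2 * n}) - {n..<2 * n} = insert x' (insert y' ({..<2 * n} - {n..<2 * n}))"
          by blast
        ultimately show ?thesis unfolding Q(2) fQ' rfN rN(2) by simp
      qed
      then show ?thesis using bij by simp
    qed
    show "b ((next_semi U ^^ i) (root_semi U)) = opp_semi Q ((inv (next_semi Q) ^^ i) n)" for i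
      using inv[of i] cycle_opp_funpow[OF U(6), of i] bt[of i] Q(6)[rule_format, of "(inv (next_semi Q) ^^ i) n"]
        nxy[of "(inv (next_semi Q) ^^ i) n"] by auto
    show "next_semi M s \<in> root_face U \<union> {x, y} \<and> b (next_semi M s) = next_semi Q (b s)"
      if "s \<in> root_face U \<union> {x, y}" for s
      using nextX[rule_format, of b] bx bij bt that by blast
    show "semi M = semi U \<union> {x, y}" "{x, y} \<inter> semi U = {}" "root_semi M \<in> {x, y}"
      using M(1,2) U(2,3) by auto
    show "b (root_semi M) = root_semi Q" using bx M(2) Q(3) by simp
    show "opp_semi M s = opp_semi U s" if "s \<in> semi U" for s using M(5)[rule_format, of s] that U(2,3) by auto
    show "opp_semi M s \<in> {x, y} \<and> b (opp_semi M s) = opp_semi Q (b s)" if "s \<in> {x, y}" for s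
      using that M(3,4) bx Q(4,5) by auto
    show "next_semi M s = next_semi U s" if "s \<in> semi U - root_face U" for s
      using that M(6) by blast
  qed
qed

lemma matching_next:
  assumes U: "planar_cmap U"
    and b: "\<And>i. b ((next_semi U ^^ i) (root_semi U)) = (next_semi N ^^ i) (root_semi N)"
    and s: "s \<in> root_face U"
  shows "next_semi U s \<in> root_face U" "b (next_semi U s) = next_semi N (b s)"
proof -
  have c: "surface_map U" using planar_surface_map[OF U] .
  obtain i where i: "s = (next_semi U ^^ i) (root_semi U)"
    using face_eq_funpow[OF c] s unfolding root_face_def by blast
  show "next_semi U s \<in> root_face U" using next_in_face[OF c] s by (simp add: root_face_def)
  show "b (next_semi U s) = next_semi N (b s)" using b[of i] b[of "Suc i"] i by simp
qed

lemma before_root_in_face: "planar_cmap M \<Longrightarrow> before_root M \<in> root_face M"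
  using face_before_root self_in_face planar_surface_map by metis

lemma matching_before_root:
  assumes U: "planar_cmap U" and N: "surface_map N"
    and b: "\<And>i. b ((next_semi U ^^ i) (root_semi U)) = (next_semi N ^^ i) (root_semi N)"
  shows "b (before_root U) = before_root N"
proof -
  have "next_semi N (b (before_root U)) = b (root_semi U)"
    using matching_next(2)[OF U b before_root_in_face[OF U]] next_before_root[OF planar_surface_map[OF U]] by simp
  then show ?thesis using b[of 0] before_root_eqI[OF N] by simp
qed

text \<open>The test map is the extension of the cycle itself. Filling the cycle gives back
  \<open>U\<close>, with the outer side of the cycle in the role of the boundary of
  \<open>U\<close>; and the places where the new edge is attached are determined by their positions
  relative to the root.\<close>

lemma glue_edge_ext:
  assumes U: "planar_cmap U" "x \<notin> semi U" "y \<notin> semi U" "x \<noteq> y" and n: "perimeter U = n" "n \<ge> 4"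
    and un: "u n = U"
  shows "isomorphic (edge_ext x y U) (glue (edge_ext (2 * n) (Suc (2 * n)) (cycle_map n)) {n} u)" (is ?iso)
    and "face_at (edge_ext (2 * n) (Suc (2 * n)) (cycle_map n)) n = {n..<2 * n}" (is ?face)
proof -
  let ?N = "cycle_map n" and ?x = "2 * n" and ?y = "Suc (2 * n)"
  have n0: "0 < n" using n by simp
  have plN: "planar_cmap ?N" using cycle_planar[OF n0] .
  have r0: "root_semi ?N = 0" by (simp add: cycle_map_def)
  have new: "?x \<notin> semi ?N" "?y \<notin> semi ?N" "?x \<noteq> ?y" by (auto simp: cycle_map_def)
  have perN: "perimeter ?N \<ge> 4"
    using cycle_faces[OF n0] n by (simp add: perimeter_def root_face_def r0)
  have perU: "perimeter U \<ge> 4" using n by simp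
  let ?p = "before_root U" and ?q = "next_semi U (next_semi U (root_semi U))"
  let ?p' = "before_root ?N" and ?q' = "next_semi ?N (next_semi ?N (root_semi ?N))"
  interpret i: edge_insertion U x y ?p ?q using edge_ext_insertion[OF U perU] .
  interpret j: edge_insertion ?N ?x ?y ?p' ?q' using edge_ext_insertion[OF plN new perN] .
  have cU: "surface_map U" using planar_surface_map[OF U(1)] .
  have qf: "?q \<in> root_face U" "?p \<in> root_face U"
    using before_root_in_face[OF U(1)] next_in_face[OF cU] self_in_face[OF cU] by (auto simp: root_face_def)
  have qfN: "?q' \<in> root_face ?N" "?p' \<in> root_face ?N"
    using before_root_in_face[OF plN] next_in_face[OF j.U] self_in_face[OF j.U] by (auto simp: root_face_def)
  have nX: "next_semi i.M s \<in> root_face U \<union> {x, y} \<and> b (next_semi i.M s) = next_semi j.M (b s)"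
    if b: "b x = ?x" "b y = ?y" "bij_betw b (root_face U \<union> {x, y}) (root_face ?N \<union> {?x, ?y})"
      "\<And>i. b ((next_semi U ^^ i) (root_semi U)) = (next_semi ?N ^^ i) 0"
      and s: "s \<in> root_face U \<union> {x, y}" for b s
  proof -
    have bt: "b ((next_semi U ^^ i) (root_semi U)) = (next_semi ?N ^^ i) (root_semi ?N)" for i
      using b(4) r0 by simp
    note bn = matching_next[OF U(1) bt]
    have bp: "b ?p = ?p'" by (rule matching_before_root[OF U(1) j.U bt])
    have bq: "b ?q = ?q'" using bt[of 2] by (simp add: numeral_2_eq_2)
    consider "s = x" | "s = y" | "s = ?p" | "s = ?q" | "s \<in> root_face U" "s \<notin> {?p, ?q, x, y}"
      using s by blast
    then show ?thesis
    proof cases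
      case 1
      then show ?thesis using bn[OF qf(1)] bq b by (simp add: i.next_simps(3) j.next_simps(3))
    next
      case 2
      then show ?thesis using bn[OF qf(2)] bp b by (simp add: i.next_simps(4) j.next_simps(4))
    next
      case 3
      then show ?thesis using bp b by (simp add: i.next_simps(1) j.next_simps(1))
    next
      case 4
      then show ?thesis using bq b by (simp add: i.next_simps(2) j.next_simps(2))
    next
      case 5
      have ne: "b s \<noteq> b z" if "z \<in> root_face U \<union> {x, y}" "z \<noteq> s" for z
        using that 5 inj_onD[OF bij_betw_imp_inj_on[OF b(3)], of s z] by blast
      have "b s \<notin> {?p', ?q', ?x, ?y}"
        using ne[of ?p] ne[of ?q] ne[of x] ne[of y] qf 5 bp bq b(1,2) by auto
      then show ?thesis using 5 bn[OF 5(1)] by (simp add: i.next_simps(5) j.next_simps(5))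
    qed
  qed
  have nM: "\<forall>s\<in>semi U - root_face U. next_semi i.M s = next_semi U s"
    using qf i.new by (intro ballI i.next_simps(5)) auto
  have nQ: "\<forall>s\<in>semi ?N - root_face ?N. next_semi j.M s = next_semi ?N s"
    using qfN j.new by (intro ballI j.next_simps(5)) auto
  have oM: "\<forall>s. s \<notin> {x, y} \<longrightarrow> opp_semi i.M s = opp_semi U s"
    and oQ: "\<forall>s. s \<notin> {?x, ?y} \<longrightarrow> opp_semi j.M s = opp_semi ?N s"
    using i.opp_simps(3) j.opp_simps(3) by blast+
  have nX': "\<forall>b. b x = ?x \<and> b y = ?y \<and> bij_betw b (root_face U \<union> {x, y}) (root_face ?N \<union> {?x, ?y}) \<and>
      (\<forall>i. b ((next_semi U ^^ i) (root_semi U)) = (next_semi ?N ^^ i) 0) \<longrightarrow>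
      (\<forall>s\<in>root_face U \<union> {x, y}.
        next_semi i.M s \<in> root_face U \<union> {x, y} \<and> b (next_semi i.M s) = next_semi j.M (b s))"
    by (intro allI impI ballI nX) auto
  note G = glue_cycle[where u = u and n = n and U = U and M = i.M and Q = j.M and x = x and y = y
        and x' = ?x and y' = ?y, OF U n(1) n0 i.semi_add i.root_add i.opp_simps(1,2) oM nM new j.closed j.semi_add
      j.root_add j.opp_simps(1,2) oQ nQ nX' un]
  show ?iso unfolding edge_ext_def by (rule G(1))
  show ?face unfolding edge_ext_def by (rule G(2))
qed

lemma glue_leaf_ext:
  assumes U: "planar_cmap U" "x \<notin> semi U" "y \<notin> semi U" "x \<noteq> y" and n: "perimeter U = n" "n > 0"
    and un: "u n = U"
  shows "isomorphic (leaf_ext x y U) (glue (leaf_ext (2 * n) (Suc (2 * n)) (cycle_map n)) {n} u)" (is ?iso)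
    and "face_at (leaf_ext (2 * n) (Suc (2 * n)) (cycle_map n)) n = {n..<2 * n}" (is ?face)
proof -
  let ?N = "cycle_map n" and ?x = "2 * n" and ?y = "Suc (2 * n)"
  have plN: "planar_cmap ?N" using cycle_planar[OF n(2)] .
  have r0: "root_semi ?N = 0" by (simp add: cycle_map_def)
  have new: "?x \<notin> semi ?N" "?y \<notin> semi ?N" "?x \<noteq> ?y" by (auto simp: cycle_map_def)
  let ?p = "before_root U" and ?p' = "before_root ?N"
  interpret i: leaf_insertion U x y ?p using leaf_ext_insertion[OF U] .
  interpret j: leaf_insertion ?N ?x ?y ?p' using leaf_ext_insertion[OF plN new] .
  have pf: "?p \<in> root_face U" "?p' \<in> root_face ?N"
    using before_root_in_face U(1) plN by auto
  have nX: "next_semi i.M s \<in> root_face U \<union> {x, y} \<and> b (next_semi i.M s) = next_semi j.M (b s)"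
    if b: "b x = ?x" "b y = ?y" "bij_betw b (root_face U \<union> {x, y}) (root_face ?N \<union> {?x, ?y})"
      "\<And>i. b ((next_semi U ^^ i) (root_semi U)) = (next_semi ?N ^^ i) 0"
      and s: "s \<in> root_face U \<union> {x, y}" for b s
  proof -
    have bt: "b ((next_semi U ^^ i) (root_semi U)) = (next_semi ?N ^^ i) (root_semi ?N)" for i
      using b(4) r0 by simp
    note bn = matching_next[OF U(1) bt]
    have bp: "b ?p = ?p'" by (rule matching_before_root[OF U(1) j.U bt])
    consider "s = x" | "s = y" | "s = ?p" | "s \<in> root_face U" "s \<notin> {?p, x, y}"
      using s by blast
    then show ?thesis
    proof cases
      case 1
      then show ?thesis using bn[OF pf(1)] bp b by (simp add: i.next_simps(3) j.next_simps(3))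
    next
      case 2
      then show ?thesis using b by (simp add: i.next_simps(2) j.next_simps(2))
    next
      case 3
      then show ?thesis using bp b by (simp add: i.next_simps(1) j.next_simps(1))
    next
      case 4
      have ne: "b s \<noteq> b z" if "z \<in> root_face U \<union> {x, y}" "z \<noteq> s" for z
        using that 4 inj_onD[OF bij_betw_imp_inj_on[OF b(3)], of s z] by blast
      have "b s \<notin> {?p', ?x, ?y}"
        using ne[of ?p] ne[of x] ne[of y] pf 4 bp b(1,2) by auto
      then show ?thesis using 4 bn[OF 4(1)] by (simp add: i.next_simps(4) j.next_simps(4))
    qed
  qed
  have nM: "\<forall>s\<in>semi U - root_face U. next_semi i.M s = next_semi U s"
    using pf i.new by (intro ballI i.next_simps(4)) auto
  have nQ: "\<forall>s\<in>semi ?N - root_face ?N. next_semi j.M s = next_semi ?N s"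
    using pf j.new by (intro ballI j.next_simps(4)) auto
  have oM: "\<forall>s. s \<notin> {x, y} \<longrightarrow> opp_semi i.M s = opp_semi U s"
    and oQ: "\<forall>s. s \<notin> {?x, ?y} \<longrightarrow> opp_semi j.M s = opp_semi ?N s"
    using i.opp_simps(3) j.opp_simps(3) by blast+
  have nX': "\<forall>b. b x = ?x \<and> b y = ?y \<and> bij_betw b (root_face U \<union> {x, y}) (root_face ?N \<union> {?x, ?y}) \<and>
      (\<forall>i. b ((next_semi U ^^ i) (root_semi U)) = (next_semi ?N ^^ i) 0) \<longrightarrow>
      (\<forall>s\<in>root_face U \<union> {x, y}.
        next_semi i.M s \<in> root_face U \<union> {x, y} \<and> b (next_semi i.M s) = next_semi j.M (b s))"
    by (intro allI impI ballI nX) auto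
  note G = glue_cycle[where u = u and n = n and U = U and M = i.M and Q = j.M and x = x and y = y
        and x' = ?x and y' = ?y, OF U n i.semi_add i.root_add i.opp_simps(1,2) oM nM new j.closed j.semi_add
      j.root_add j.opp_simps(1,2) oQ nQ nX' un]
  show ?iso unfolding leaf_ext_def by (rule G(1))
  show ?face unfolding leaf_ext_def by (rule G(2))
qed

section \<open>The two test maps with one hole\<close>

lemma glues_to_iff:
  assumes "planar_cmap M" "isomorphic M (glue q H (\<lambda>h. rep_planar_map (u h)))"
  shows "glues_to q H u p \<longleftrightarrow> p = abs_planar_map M"
proof
  assume "glues_to q H u p"
  then have "isomorphic (rep_planar_map p) M"
    unfolding glues_to_def using isomorphic_trans isomorphic_sym[OF assms] by blast
  then show "p = abs_planar_map M" using eq_absI[OF assms(1)] by blast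
next
  assume "p = abs_planar_map M"
  then show "glues_to q H u p"
    unfolding glues_to_def using rep_abs[OF assms(1)] assms(2) isomorphic_trans by blast
qed

lemma abs_eq_iff:
  "planar_cmap M \<Longrightarrow> planar_cmap N \<Longrightarrow> abs_planar_map M = abs_planar_map N \<longleftrightarrow> isomorphic M N"
  using Quotient3_rel[OF Quotient3_planar_map, of M N] isomorphic_refl by blast

lemma plus_edge_inj:
  assumes "u \<in> Quad (Suc l)" "u' \<in> Quad (Suc l)" "l \<ge> 1" "plus_edge u = plus_edge u'"
  shows "u = u'"
proof -
  have "perimeter (rep_planar_map u) \<ge> 4" "perimeter (rep_planar_map u') \<ge> 4"
    using assms Quad_rep by fastforce+
  note V = fresh_rep[of u] this(1) and V' = fresh_rep[of u'] this(2)
  have "isomorphic (rep_planar_map u) (rep_planar_map u')"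
    using assms(4) unfolding plus_edge_def Let_def
      abs_eq_iff[OF edge_ext_planar[OF V] edge_ext_planar[OF V']] isomorphic_edge_ext_iff[OF V V'] .
  then show ?thesis using abs_eqI[OF V(1) V'(1)] by (simp add: abs_rep)
qed

lemma plus_leaf_inj:
  assumes "plus_leaf u = plus_leaf u'"
  shows "u = u'"
proof -
  note V = fresh_rep[of u] and V' = fresh_rep[of u']
  have "isomorphic (rep_planar_map u) (rep_planar_map u')"
    using assms unfolding plus_leaf_def Let_def
      abs_eq_iff[OF leaf_ext_planar[OF V] leaf_ext_planar[OF V']] isomorphic_leaf_ext_iff[OF V V'] .
  then show ?thesis using abs_eqI[OF V(1) V'(1)] by (simp add: abs_rep)
qed

lemma fillings_one_hole:
  "hole_degree q h = 2 * k \<Longrightarrow> fillings q {h} = (\<Pi>\<^sub>E g\<in>{h}. Quad k)"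
  unfolding fillings_def by (rule PiE_cong) simp

text \<open>Gluing depends on a filling only through its value at \<open>h\<close>. Injectivity of
  \<open>f\<close> recovers this value, and extensionality of \<open>fillings\<close> the whole
  family.\<close>

lemma gluable_one_hole:
  assumes deg: "hole_degree q h = 2 * k" and f: "inj_on f (Quad k)"
    and g: "\<And>u p. u h \<in> Quad k \<Longrightarrow> glues_to q {h} u p \<longleftrightarrow> p = f (u h)"
  shows "gluable q {h}"
  unfolding gluable_def
proof (intro conjI ballI allI impI)
  fix u u' p
  assume u: "u \<in> fillings q {h}" "u' \<in> fillings q {h}" and p: "glues_to q {h} u p \<and> glues_to q {h} u' p"
  have Q: "u h \<in> Quad k" "u' h \<in> Quad k"
    using u unfolding fillings_one_hole[OF deg] by auto
  then have "f (u h) = f (u' h)" using g p by metis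
  then have "u h = u' h" using f Q by (auto dest: inj_onD)
  then show "u = u'"
    using u unfolding fillings_one_hole[OF deg] by (intro PiE_ext) auto
next
  fix u assume "u \<in> fillings q {h}"
  then have "u h \<in> Quad k" unfolding fillings_one_hole[OF deg] by auto
  then show "\<exists>p. glues_to q {h} u p" using g by blast
qed (use deg in auto)

text \<open>A cycle extended by an edge in its root face has two interior faces, the square cut off
  and the hole. The extension shortens the perimeter by 2, which dictates the length of the
  cycle.\<close>

lemma edge_test:
  assumes l: "l \<ge> 1"
  obtains q :: "nat cmap" and h where "quadrangulation_with_holes q {h}" "perimeter q = 2 * l" "gluable q {h}"
    "hole_degree q h = 2 * Suc l" "\<And>u p. u h \<in> Quad (Suc l) \<Longrightarrow> glues_to q {h} u p \<longleftrightarrow> p = plus_edge (u h)"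
proof -
  define n where "n = 2 * Suc l"
  define q where "q = edge_ext (2 * n) (Suc (2 * n)) (cycle_map n)"
  have n: "n \<ge> 4" "0 < n" using l by (auto simp: n_def)
  let ?N = "cycle_map n"
  have plN: "planar_cmap ?N" using cycle_planar[OF n(2)] .
  have r0: "root_semi ?N = 0" by (simp add: cycle_map_def)
  have new: "2 * n \<notin> semi ?N" "Suc (2 * n) \<notin> semi ?N" "2 * n \<noteq> Suc (2 * n)" by (auto simp: cycle_map_def)
  have rfN: "root_face ?N = {..<n}" using cycle_faces[OF n(2)] by (simp add: root_face_def r0)
  have perN: "perimeter ?N = n" using rfN by (simp add: perimeter_def)
  have e: "planar_cmap ?N" "2 * n \<notin> semi ?N" "Suc (2 * n) \<notin> semi ?N" "2 * n \<noteq> Suc (2 * n)" "perimeter ?N \<ge> 4"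
    using plN new perN n by auto
  have hf: "face_at q n = {n..<2 * n}"
    unfolding q_def using glue_edge_ext(2)[OF e(1-4) perN n(1), of "\<lambda>_. ?N"] by simp
  have deg: "hole_degree q n = 2 * Suc l" using hf by (simp add: hole_degree_def n_def)
  have int: "interior_faces q = insert (face_at q (Suc (2 * n))) {{n..<2 * n}}"
  proof -
    have "interior_faces ?N = {{n..<2 * n}}"
    proof -
      have "faces ?N = {{..<n}, {n..<2 * n}}" by (rule cycle_map_faces[OF n(2)])
      moreover have "{..<n} \<noteq> {n..<2 * n}" using n by (metis atLeastLessThan_iff lessThan_iff not_le)
      ultimately show ?thesis unfolding interior_faces_def rfN by auto
    qed
    then show ?thesis unfolding q_def using edge_ext_interior[OF e] by simp
  qed
  have "quadrangulation_with_holes q {n}"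
    unfolding quadrangulation_with_holes_def
  proof (intro conjI ballI)
    show "planar_cmap q" unfolding q_def by (rule edge_ext_planar[OF e])
    show "{n} \<subseteq> semi q" using n by (simp add: q_def edge_ext_def add_edge_def cycle_map_def)
    have "n \<notin> root_face q" unfolding q_def edge_ext_root_face[OF e] rfN using n by auto
    then show "root_face q \<notin> face_at q ` {n}" using hf n by auto
    show "card F = 4" if "F \<in> interior_faces q - face_at q ` {n}" for F
      using that hf edge_ext_card_other[OF e] unfolding int by (auto simp: q_def)
  qed auto
  moreover have "perimeter q = 2 * l"
  proof -
    have "perimeter q = n - 2" unfolding q_def edge_ext_perimeter[OF e] perN ..
    then show ?thesis by (simp add: n_def)
  qed
  moreover have gl: "glues_to q {n} u p \<longleftrightarrow> p = plus_edge (u n)" if u: "u n \<in> Quad (Suc l)" for u p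
  proof -
    have perU: "perimeter (rep_planar_map (u n)) = n" using Quad_rep[OF u] by (simp add: n_def)
    then have per4: "perimeter (rep_planar_map (u n)) \<ge> 4" using n by simp
    note V = fresh_rep[of "u n"]
    show ?thesis
      unfolding plus_edge_def Let_def q_def
      by (rule glues_to_iff[OF edge_ext_planar[OF V per4] glue_edge_ext(1)[OF V perU n(1)]]) simp
  qed
  moreover have "gluable q {n}"
    by (rule gluable_one_hole[OF deg, of plus_edge]) (use gl plus_edge_inj[OF _ _ l] in \<open>auto intro: inj_onI\<close>)
  ultimately show ?thesis using that deg by blast
qed

text \<open>The hole is the only interior face of a cycle with a pendant edge in its root face; both
  sides of the pendant edge count for the perimeter.\<close>

lemma leaf_test:
  assumes k: "k \<ge> 1"
  obtains q :: "nat cmap" and h where "quadrangulation_with_holes q {h}" "perimeter q = 2 * Suc k" "gluable q {h}"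
    "hole_degree q h = 2 * k" "\<And>u p. u h \<in> Quad k \<Longrightarrow> glues_to q {h} u p \<longleftrightarrow> p = plus_leaf (u h)"
proof -
  define n where "n = 2 * k"
  define q where "q = leaf_ext (2 * n) (Suc (2 * n)) (cycle_map n)"
  have n: "0 < n" using k by (auto simp: n_def)
  let ?N = "cycle_map n"
  have plN: "planar_cmap ?N" using cycle_planar[OF n] .
  have r0: "root_semi ?N = 0" by (simp add: cycle_map_def)
  have rfN: "root_face ?N = {..<n}" using cycle_faces[OF n] by (simp add: root_face_def r0)
  have perN: "perimeter ?N = n" using rfN by (simp add: perimeter_def)
  have e: "planar_cmap ?N" "2 * n \<notin> semi ?N" "Suc (2 * n) \<notin> semi ?N" "2 * n \<noteq> Suc (2 * n)"
    using plN by (auto simp: cycle_map_def)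
  have hf: "face_at q n = {n..<2 * n}"
    unfolding q_def using glue_leaf_ext(2)[OF e perN n, of "\<lambda>_. ?N"] by simp
  have deg: "hole_degree q n = 2 * k" using hf by (simp add: hole_degree_def n_def)
  have int: "interior_faces q = {{n..<2 * n}}"
  proof -
    have "faces ?N = {{..<n}, {n..<2 * n}}" by (rule cycle_map_faces[OF n])
    moreover have "{..<n} \<noteq> {n..<2 * n}" using n by (metis atLeastLessThan_iff lessThan_iff not_le)
    ultimately have "interior_faces ?N = {{n..<2 * n}}" unfolding interior_faces_def rfN by auto
    then show ?thesis unfolding q_def using leaf_ext_interior[OF e] by simp
  qed
  have "quadrangulation_with_holes q {n}"
    unfolding quadrangulation_with_holes_def
  proof (intro conjI ballI)
    show "planar_cmap q" unfolding q_def by (rule leaf_ext_planar[OF e])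
    show "{n} \<subseteq> semi q" using n by (simp add: q_def leaf_ext_def add_leaf_def cycle_map_def)
    have "n \<notin> root_face q" unfolding q_def leaf_ext_root_face[OF e] rfN using n by auto
    then show "root_face q \<notin> face_at q ` {n}" using hf n by auto
    show "card F = 4" if "F \<in> interior_faces q - face_at q ` {n}" for F
      using that hf unfolding int by auto
  qed auto
  moreover have "perimeter q = 2 * Suc k"
  proof -
    have "perimeter q = n + 2" unfolding q_def leaf_ext_perimeter[OF e] perN ..
    then show ?thesis by (simp add: n_def)
  qed
  moreover have gl: "glues_to q {n} u p \<longleftrightarrow> p = plus_leaf (u n)" if u: "u n \<in> Quad k" for u p
  proof -
    have perU: "perimeter (rep_planar_map (u n)) = n" using Quad_rep[OF u] by (simp add: n_def)
    note V = fresh_rep[of "u n"]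
    show ?thesis
      unfolding plus_leaf_def Let_def q_def
      by (rule glues_to_iff[OF leaf_ext_planar[OF V] glue_leaf_ext(1)[OF V perU n]]) simp
  qed
  moreover have "gluable q {n}"
    by (rule gluable_one_hole[OF deg, of plus_leaf]) (use gl plus_leaf_inj in \<open>auto intro: inj_onI\<close>)
  ultimately show ?thesis using that deg by blast
qed

section \<open>The Markov property\<close>

text \<open>Gluing leaves \<open>next_semi\<close> unchanged on surviving semi-edges, and the
  semi-edges that vanish make up whole faces. So the faces of the glued map are those that remain,
  whatever \<open>opp_semi\<close> becomes.\<close>

lemma glue_faces:
  fixes q :: "'d cmap" and u :: "'d \<Rightarrow> 'e cmap"
  assumes q: "quadrangulation_with_holes q H" and u: "\<And>h. h \<in> H \<Longrightarrow> planar_cmap (u h)"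
  defines "G \<equiv> glue q H u"
  shows "root_face G = Inl ` root_face q"
    and "interior_faces G = (`) Inl ` (interior_faces q - face_at q ` H) \<union>
           (\<Union>h\<in>H. (`) (\<lambda>s. Inr (h, s)) ` interior_faces (u h))"
proof -
  have plq: "planar_cmap q" and Hq: "H \<subseteq> semi q" and rnh: "root_face q \<notin> face_at q ` H"
    using q by (auto simp: quadrangulation_with_holes_def)
  have c: "surface_map q" using planar_surface_map[OF plq] .
  have gs: "semi G = glue_semi q H u" by (simp add: G_def glue_def)
  have inl: "Inl s \<in> glue_semi q H u \<longleftrightarrow> s \<in> semi q \<and> face_at q s \<notin> face_at q ` H" for s
  proof -
    have "s \<in> face_at q h \<longleftrightarrow> face_at q s = face_at q h" for h
      using face_at_eq[OF c, of s h] self_in_face[OF c, of s] by auto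
    then show ?thesis by (auto simp: glue_semi_def)
  qed
  have inr: "Inr (h, s) \<in> glue_semi q H u \<longleftrightarrow> h \<in> H \<and> s \<in> semi (u h) \<and> s \<notin> root_face (u h)" for h s
    by (auto simp: glue_semi_def)
  have fl: "face_at G (Inl s) = Inl ` face_at q s" if s: "Inl s \<in> glue_semi q H u" for s
  proof -
    have "Inl ` orbit (next_semi q) s = orbit (next_semi G) (Inl s)"
    proof (rule orbit_inverse)
      show "s \<in> orbit (next_semi q) s" using self_in_face[OF c] by (simp add: face_at_def)
      show "next_semi G (Inl z) = Inl (next_semi q z)" if "z \<in> orbit (next_semi q) s" for z
      proof -
        have z: "z \<in> face_at q s" using that by (simp add: face_at_def)
        then have "Inl z \<in> glue_semi q H u"
          using s face_at_eq[OF c z] face_at_subset[OF c, of s] unfolding inl by auto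
        then show ?thesis by (simp add: G_def glue_def)
      qed
    qed
    then show ?thesis by (simp add: face_at_def)
  qed
  have fr: "face_at G (Inr (h, s)) = (\<lambda>z. Inr (h, z)) ` face_at (u h) s" if s: "Inr (h, s) \<in> glue_semi q H u" for h s
  proof -
    have h: "h \<in> H" using s inr by auto
    have cu: "surface_map (u h)" using planar_surface_map[OF u[OF h]] .
    have "(\<lambda>z. Inr (h, z)) ` orbit (next_semi (u h)) s = orbit (next_semi G) (Inr (h, s))"
    proof (rule orbit_inverse)
      show "s \<in> orbit (next_semi (u h)) s" using self_in_face[OF cu] by (simp add: face_at_def)
      show "next_semi G (Inr (h, z)) = Inr (h, next_semi (u h) z)" if "z \<in> orbit (next_semi (u h)) s" for z
      proof -
        have z: "z \<in> face_at (u h) s" using that by (simp add: face_at_def)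
        have "z \<notin> root_face (u h)"
        proof
          assume "z \<in> root_face (u h)"
          then have "face_at (u h) z = root_face (u h)" using face_at_eq[OF cu] by (simp add: root_face_def)
          then show False using face_at_eq[OF cu z] self_in_face[OF cu, of s] s inr by auto
        qed
        then have "Inr (h, z) \<in> glue_semi q H u"
          using s z face_at_subset[OF cu, of s] unfolding inr by auto
        then show ?thesis by (simp add: G_def glue_def)
      qed
    qed
    then show ?thesis by (simp add: face_at_def)
  qed
  have rq: "Inl (root_semi q) \<in> glue_semi q H u"
    using planar_root[OF plq] rnh by (simp add: inl root_face_def)
  show rG: "root_face G = Inl ` root_face q"
    unfolding root_face_def using fl[OF rq] by (simp add: G_def glue_def)
  have int: "interior_faces M = face_at M ` {s \<in> semi M. s \<notin> root_face M}" if "surface_map M" for M :: "'e cmap"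
    using face_at_eq[OF that] self_in_face[OF that] unfolding interior_faces_def faces_def root_face_def
    by (auto; metis image_eqI)
  have "faces G = (\<lambda>s. Inl ` face_at q s) ` {s \<in> semi q. face_at q s \<notin> face_at q ` H} \<union>
      (\<Union>h\<in>H. (\<lambda>s. (\<lambda>z. Inr (h, z)) ` face_at (u h) s) ` {s \<in> semi (u h). s \<notin> root_face (u h)})"
    (is "_ = ?A \<union> ?B")
  proof (intro subset_antisym subsetI)
    fix X assume "X \<in> faces G"
    then obtain g where g: "g \<in> glue_semi q H u" "X = face_at G g" unfolding faces_def gs by auto
    show "X \<in> ?A \<union> ?B"
    proof (cases g)
      case (Inl s)
      then show ?thesis using g fl[of s] inl[of s] by auto
    next
      case (Inr z)
      obtain h s where z: "z = (h, s)" by (cases z)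
      then have "X = (\<lambda>z. Inr (h, z)) ` face_at (u h) s" "h \<in> H" "s \<in> {s \<in> semi (u h). s \<notin> root_face (u h)}"
        using g Inr fr[of h s] inr[of h s] by auto
      then have "X \<in> ?B" by blast
      then show ?thesis by blast
    qed
  next
    fix X assume "X \<in> ?A \<union> ?B"
    then show "X \<in> faces G"
    proof
      assume "X \<in> ?A"
      then obtain s where "s \<in> semi q" "face_at q s \<notin> face_at q ` H" "X = Inl ` face_at q s" by auto
      then show ?thesis using fl[of s] inl[of s] unfolding faces_def gs by (metis imageI)
    next
      assume "X \<in> ?B"
      then obtain h s where "h \<in> H" "s \<in> semi (u h)" "s \<notin> root_face (u h)" "X = (\<lambda>z. Inr (h, z)) ` face_at (u h) s" by auto
      then show ?thesis using fr[of h s] inr[of h s] unfolding faces_def gs by (metis imageI)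
    qed
  qed
  also have "?A = (`) Inl ` (faces q - face_at q ` H)"
    by (auto simp: faces_def)
  also have "?B = (\<Union>h\<in>H. (`) (\<lambda>s. Inr (h, s)) ` interior_faces (u h))"
    using int[OF planar_surface_map[OF u]] by (intro SUP_cong) (auto simp: image_image)
  finally have fG: "faces G = (`) Inl ` (faces q - face_at q ` H) \<union>
      (\<Union>h\<in>H. (`) (\<lambda>s. Inr (h, s)) ` interior_faces (u h))" .
  have ne: "root_face q \<noteq> {}" using self_in_face[OF c] by (auto simp: root_face_def)
  have "(`) Inl ` (faces q - face_at q ` H) - {Inl ` root_face q :: ('d + 'd \<times> 'e) set} = (`) Inl ` (interior_faces q - face_at q ` H)"
    by (auto simp: interior_faces_def inj_image_eq_iff)
  moreover have "(Inl ` root_face q :: ('d + 'd \<times> 'e) set) \<notin> (\<Union>h\<in>H. (`) (\<lambda>s. Inr (h, s)) ` interior_faces (u h))"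
    using ne by auto
  ultimately show "interior_faces G = (`) Inl ` (interior_faces q - face_at q ` H) \<union>
      (\<Union>h\<in>H. (`) (\<lambda>s. Inr (h, s)) ` interior_faces (u h))"
    unfolding interior_faces_def[of G] rG fG Un_Diff by (simp only: Diff_insert0 Diff_empty not_False_eq_True)
qed

lemma finite_interior: "planar_cmap M \<Longrightarrow> finite (interior_faces M)"
  using surface_map_permutes(3)[OF planar_surface_map] by (auto simp: interior_faces_def faces_def)

lemma glue_quadrangulation:
  fixes q :: "nat cmap"
  assumes q: "quadrangulation_with_holes q H" "perimeter q = 2 * l"
    and u: "u \<in> fillings q H" and p: "glues_to q H u p"
  shows "p \<in> Quad l"
    and "num_faces p = card (interior_faces q - face_at q ` H) + (\<Sum>h\<in>H. num_faces (u h))"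
proof -
  let ?u = "\<lambda>h. rep_planar_map (u h)"
  let ?G = "glue q H ?u"
  have plq: "planar_cmap q" and Hq: "H \<subseteq> semi q" and q4: "\<And>F. F \<in> interior_faces q - face_at q ` H \<Longrightarrow> card F = 4"
    using q by (auto simp: quadrangulation_with_holes_def)
  have finH: "finite H" using Hq surface_map_permutes(3)[OF planar_surface_map[OF plq]] finite_subset by blast
  note gf = glue_faces[OF q(1), of ?u, OF rep_planar]
  have iso: "isomorphic (rep_planar_map p) ?G" using p by (simp add: glues_to_def)
  note inv = isomorphic_invariants[OF iso rep_planar]
  have "perimeter ?G = 2 * l"
    using q(2) unfolding perimeter_def gf(1) by (simp add: card_image)
  moreover have "\<forall>F\<in>interior_faces ?G. card F = 4"
  proof
    fix F assume "F \<in> interior_faces ?G"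
    then consider X where "X \<in> interior_faces q - face_at q ` H" "F = Inl ` X"
      | h X where "h \<in> H" "X \<in> interior_faces (?u h)" "F = (\<lambda>s. Inr (h, s)) ` X"
      unfolding gf(2) by blast
    then show "card F = 4"
    proof cases
      case 1
      then show ?thesis using q4[of X] by (simp add: card_image)
    next
      case 2
      then have "u h \<in> Quad (hole_degree q h div 2)" using u by (auto simp: fillings_def)
      then have "card X = 4" using 2 by (auto simp: Quad_def quadrangulation_def)
      moreover have "card F = card X" unfolding 2(3) by (rule card_image) (auto simp: inj_on_def)
      ultimately show ?thesis by simp
    qed
  qed
  ultimately show "p \<in> Quad l"
    using inv rep_planar by (simp add: Quad_def quadrangulation_def)
  have "num_faces p = card (interior_faces ?G)" using inv(2) by (simp add: num_faces_def)
  also have "\<dots> = card ((`) Inl ` (interior_faces q - face_at q ` H) :: (nat + nat \<times> nat) set set) +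
      card (\<Union>h\<in>H. (`) (\<lambda>s. Inr (h, s)) ` interior_faces (?u h) :: (nat + nat \<times> nat) set set)"
    unfolding gf(2)
  proof (rule card_Un_disjoint)
    have ne: "X \<noteq> {}" if "X \<in> interior_faces q" for X
      using that self_in_face[OF planar_surface_map[OF plq]] by (auto simp: interior_faces_def faces_def)
    show "(`) Inl ` (interior_faces q - face_at q ` H) \<inter>
        (\<Union>h\<in>H. (`) (\<lambda>s. Inr (h, s)) ` interior_faces (?u h)) = {}"
      using ne by auto
  qed (use finite_interior plq rep_planar finH in auto)
  also have "card ((`) Inl ` (interior_faces q - face_at q ` H) :: (nat + nat \<times> nat) set set) =
      card (interior_faces q - face_at q ` H)"
    by (rule card_image) (auto simp: inj_on_def inj_image_eq_iff)
  also have "card (\<Union>h\<in>H. (`) (\<lambda>s. Inr (h, s)) ` interior_faces (?u h) :: (nat + nat \<times> nat) set set) =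
      (\<Sum>h\<in>H. card ((`) (\<lambda>s. Inr (h, s) :: nat + nat \<times> nat) ` interior_faces (?u h)))"
  proof (rule card_UN_disjoint)
    have ne: "X \<noteq> {}" if "X \<in> interior_faces (?u h)" for X h
      using that self_in_face[OF planar_surface_map[OF rep_planar]] by (auto simp: interior_faces_def faces_def)
    show "\<forall>i\<in>H. \<forall>j\<in>H. i \<noteq> j \<longrightarrow> (`) (\<lambda>s. Inr (i, s) :: nat + nat \<times> nat) ` interior_faces (?u i) \<inter>
        (`) (\<lambda>s. Inr (j, s)) ` interior_faces (?u j) = {}"
    proof (intro ballI impI equals0I)
      fix i j F
      assume ij: "i \<noteq> j" and "F \<in> (`) (\<lambda>s. Inr (i, s) :: nat + nat \<times> nat) ` interior_faces (?u i) \<inter>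
        (`) (\<lambda>s. Inr (j, s)) ` interior_faces (?u j)"
      then obtain X Y where X: "X \<in> interior_faces (?u i)" "F = (\<lambda>s. Inr (i, s)) ` X" "F = (\<lambda>s. Inr (j, s)) ` Y"
        by blast
      obtain z where "z \<in> X" using ne[OF X(1)] by blast
      then have "Inr (i, z) \<in> F" unfolding X(2) by (rule imageI)
      then show False using ij unfolding X(3) by blast
    qed
  qed (use finite_interior rep_planar finH in auto)
  also have "\<dots> = (\<Sum>h\<in>H. num_faces (u h))"
  proof (rule sum.cong[OF refl])
    fix h
    have "inj (\<lambda>s. Inr (h, s) :: nat + nat \<times> nat)" by (auto simp: inj_on_def)
    then show "card ((`) (\<lambda>s. Inr (h, s) :: nat + nat \<times> nat) ` interior_faces (?u h)) = num_faces (u h)"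
      unfolding num_faces_def by (intro card_image) (auto simp: inj_on_def inj_image_eq_iff)
  qed
  finally show "num_faces p = card (interior_faces q - face_at q ` H) + (\<Sum>h\<in>H. num_faces (u h))" .
qed

section \<open>Conditional laws, and the Markov property of Boltzmann laws\<close>

lemma glues_to_unique:
  assumes "glues_to q H u p" "glues_to q H u p'"
  shows "p = p'"
proof -
  have "isomorphic (rep_planar_map p) (rep_planar_map p')"
    using assms isomorphic_trans isomorphic_sym[OF rep_planar] unfolding glues_to_def by blast
  then show ?thesis using abs_eqI[OF rep_planar rep_planar] by (simp add: abs_rep)
qed

lemma hole_maps_eq:
  assumes "gluable q H" "u \<in> fillings q H" "glues_to q H u p"
  shows "hole_maps q H p = u"
  unfolding hole_maps_def using assms unfolding gluable_def by (intro the_equality) blast+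

text \<open>For a gluable \<open>q\<close>, fillings correspond bijectively to the maps that contain
  \<open>q\<close>. The law of the filling is therefore the conditional law transported along this
  bijection, and a family that is no filling gets no mass.\<close>

lemma pmf_hole_maps:
  fixes P :: "planar_map pmf"
  assumes g: "gluable q H" and pos: "measure_pmf.prob P {p. submap q H p} > 0"
  shows "u \<in> fillings q H \<Longrightarrow> glues_to q H u p \<Longrightarrow>
      pmf (map_pmf (hole_maps q H) (cond_pmf P {p. submap q H p})) u = pmf P p / measure_pmf.prob P {p. submap q H p}"
    and "u \<notin> fillings q H \<Longrightarrow> pmf (map_pmf (hole_maps q H) (cond_pmf P {p. submap q H p})) u = 0"
proof -
  let ?S = "{p. submap q H p}"
  have ne: "set_pmf P \<inter> ?S \<noteq> {}"
  proof
    assume "set_pmf P \<inter> ?S = {}"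
    then have "measure_pmf.prob P ?S = 0" by (subst measure_Int_set_pmf[symmetric]) (simp add: Int_commute)
    then show False using pos by simp
  qed
  let ?C = "cond_pmf P ?S"
  have set: "set_pmf ?C = set_pmf P \<inter> ?S" by (rule set_cond_pmf[OF ne])
  show "pmf (map_pmf (hole_maps q H) ?C) u = pmf P p / measure_pmf.prob P ?S"
    if u: "u \<in> fillings q H" and p: "glues_to q H u p"
  proof -
    have "hole_maps q H -` {u} \<inter> set_pmf ?C = {p} \<inter> set_pmf ?C"
    proof (intro subset_antisym subsetI)
      fix r assume r: "r \<in> hole_maps q H -` {u} \<inter> set_pmf ?C"
      then obtain v where "v \<in> fillings q H" "glues_to q H v r" using set by (auto simp: submap_def)
      then have "glues_to q H u r" using hole_maps_eq[OF g] r by auto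
      then show "r \<in> {p} \<inter> set_pmf ?C" using glues_to_unique p r by auto
    qed (use hole_maps_eq[OF g u p] in auto)
    then have "pmf (map_pmf (hole_maps q H) ?C) u = pmf ?C p"
      unfolding pmf_map by (metis measure_Int_set_pmf measure_pmf_single)
    moreover have "p \<in> ?S" using u p by (auto simp: submap_def)
    ultimately show ?thesis using pmf_cond[OF ne] by simp
  qed
  show "pmf (map_pmf (hole_maps q H) ?C) u = 0" if u: "u \<notin> fillings q H"
  proof -
    have "u \<notin> hole_maps q H ` set_pmf ?C"
      using u set hole_maps_eq[OF g] by (auto simp: submap_def)
    then show ?thesis by (simp add: pmf_eq_0_set_pmf)
  qed
qed

text \<open>Both total masses are 1, which forces \<open>C = 1\<close>. This spares computing the
  probability that a Boltzmann map contains \<open>q\<close>.\<close>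

lemma pmf_eq_of_proportional:
  assumes "\<And>x. pmf p x = C * pmf q x"
  shows "p = q"
proof -
  obtain x where x: "x \<in> set_pmf p" using set_pmf_not_empty[of p] by blast
  then have "0 < C * pmf q x" using assms pmf_positive by metis
  \<comment> \<open>Nonnegativity, read off at a point of positive mass, allows the constant to be
    carried over to \<open>ennreal\<close>.\<close>
  then have C: "C \<ge> 0" by (metis pmf_nonneg not_less zero_less_mult_iff order.strict_implies_order)
  have "1 = (\<integral>\<^sup>+x. ennreal (pmf p x) \<partial>count_space UNIV)"
    using nn_integral_pmf[where p = p and A = UNIV] by (simp add: measure_pmf.emeasure_space_1[simplified])
  also have "\<dots> = (\<integral>\<^sup>+x. ennreal C * ennreal (pmf q x) \<partial>count_space UNIV)"
    using assms C by (simp add: ennreal_mult)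
  also have "\<dots> = ennreal C * (\<integral>\<^sup>+x. ennreal (pmf q x) \<partial>count_space UNIV)"
    by (rule nn_integral_cmult) simp
  also have "\<dots> = ennreal C"
    using nn_integral_pmf[where p = q and A = UNIV] by (simp add: measure_pmf.emeasure_space_1[simplified])
  finally have "C = 1" using C by (metis ennreal_1 ennreal_inj zero_le_one)
  then show ?thesis using assms by (intro pmf_eqI) simp
qed

lemma has_sum_pmf:
  assumes "set_pmf p \<subseteq> A"
  shows "(pmf p has_sum 1) A"
proof -
  have "Infinite_Sum.abs_summable_on (pmf p) A"
    unfolding abs_summable_equivalent by (rule pmf_abs_summable)
  then have "pmf p summable_on A" by (rule abs_summable_summable)
  moreover have "infsum (pmf p) A = 1"
    using infsetsum_infsum[OF pmf_abs_summable] infsetsum_pmf_eq_1[OF assms] by metis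
  ultimately show ?thesis using has_sum_infsum by metis
qed

text \<open>Some map is charged by \<open>p\<close>, and a positive quotient with a positive
  numerator has a positive denominator.\<close>

lemma boltzmann_partition_pos:
  assumes "boltzmann x l p" "x > 0"
  shows "partition_function x l > 0"
proof -
  obtain m where m: "m \<in> set_pmf p" using set_pmf_not_empty[of p] by blast
  then have "0 < pmf p m" "m \<in> Quad l" using assms pmf_positive by (auto simp: boltzmann_def)
  then have "0 < x ^ num_faces m / partition_function x l" using assms by (simp add: boltzmann_def)
  then show ?thesis using assms(2) by (simp add: zero_less_divide_iff)
qed

text \<open>Additivity of the number of faces makes the weight of a glued map the product of the
  weights in the holes, times a power of \<open>x\<close> that depends only on \<open>q\<close>. As
  a function of the filling, the conditional law is thus proportional to the product law.\<close>

lemma boltzmann_markov: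
  assumes x: "x > 0" and B: "\<And>l. l \<ge> 1 \<Longrightarrow> boltzmann x l (P l)"
  shows "markov_property P"
  unfolding markov_property_def
proof (intro allI impI)
  fix l and q :: "nat cmap" and H
  assume l: "1 \<le> l" and "quadrangulation_with_holes q H \<and> perimeter q = 2 * l \<and> gluable q H"
  then have q: "quadrangulation_with_holes q H" "perimeter q = 2 * l" and g: "gluable q H" by auto
  have plq: "planar_cmap q" and Hq: "H \<subseteq> semi q"
    using q by (auto simp: quadrangulation_with_holes_def)
  have c: "surface_map q" using planar_surface_map[OF plq] .
  have finH: "finite H" using Hq surface_map_permutes(3)[OF c] finite_subset by blast
  let ?k = "\<lambda>h. hole_degree q h div 2"
  \<comment> \<open>A hole has at least one edge and, by \<open>gluable\<close>, even degree; the
    hypothesis on \<open>P\<close> covers only half-perimeters from 1 on.\<close>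
  have k: "?k h \<ge> 1" if "h \<in> H" for h
  proof -
    have "hole_degree q h > 0"
      using self_in_face[OF c, of h] finite_face[OF c, of h] by (auto simp: hole_degree_def card_gt_0_iff)
    moreover have "even (hole_degree q h)" using g that by (simp add: gluable_def)
    ultimately show ?thesis by auto
  qed
  let ?W = "partition_function x"
  let ?c = "card (interior_faces q - face_at q ` H)"
  have W: "?W j > 0" if "j \<ge> 1" for j using boltzmann_partition_pos[OF B[OF that] x] .
  have val: "pmf (P l) p = x ^ ?c / ?W l * (\<Prod>h\<in>H. x ^ num_faces (u h))"
    if u: "u \<in> fillings q H" and p: "glues_to q H u p" for u p
    using B[OF l] glue_quadrangulation[OF q u p]
    by (simp add: boltzmann_def power_add power_sum)
  let ?S = "{p. submap q H p}"
  have pos: "measure_pmf.prob (P l) ?S > 0"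
  proof -
    define u where "u = (\<lambda>h\<in>H. SOME m. m \<in> Quad (?k h))"
    have "\<exists>m. m \<in> Quad (?k h)" if "h \<in> H" for h
      using B[OF k[OF that]] set_pmf_not_empty[of "P (?k h)"] by (auto simp: boltzmann_def)
    then have u: "u \<in> fillings q H" by (auto simp: u_def fillings_def intro: someI_ex)
    then obtain p where p: "glues_to q H u p" using g by (auto simp: gluable_def)
    have "0 < pmf (P l) p" unfolding val[OF u p] using x W[OF l] by (simp add: prod_pos)
    also have "\<dots> = measure_pmf.prob (P l) {p}" by (simp add: measure_pmf_single)
    also have "\<dots> \<le> measure_pmf.prob (P l) ?S"
      using u p by (intro measure_pmf.finite_measure_mono) (auto simp: submap_def)
    finally show ?thesis .
  qed
  \<comment> \<open>All factors that do not depend on the filling.\<close>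
  define C where "C = x ^ ?c / ?W l * (\<Prod>h\<in>H. ?W (?k h)) / measure_pmf.prob (P l) ?S"
  have "map_pmf (hole_maps q H) (cond_pmf (P l) ?S) = Pi_pmf H undefined (\<lambda>h. P (?k h))"
  proof (rule pmf_eq_of_proportional)
    fix u
    show "pmf (map_pmf (hole_maps q H) (cond_pmf (P l) ?S)) u = C * pmf (Pi_pmf H undefined (\<lambda>h. P (?k h))) u"
    proof (cases "u \<in> fillings q H")
      case True
      then obtain p where p: "glues_to q H u p" using g by (auto simp: gluable_def)
      have "pmf (Pi_pmf H undefined (\<lambda>h. P (?k h))) u = (\<Prod>h\<in>H. pmf (P (?k h)) (u h))"
        using True finH by (subst pmf_Pi') (auto simp: fillings_def PiE_def extensional_def)
      also have "\<dots> = (\<Prod>h\<in>H. x ^ num_faces (u h) / ?W (?k h))"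
        using B[OF k] True by (intro prod.cong) (auto simp: boltzmann_def fillings_def)
      also have "\<dots> = (\<Prod>h\<in>H. x ^ num_faces (u h)) / (\<Prod>h\<in>H. ?W (?k h))"
        by (rule prod_dividef)
      finally have R: "pmf (Pi_pmf H undefined (\<lambda>h. P (?k h))) u = \<dots>" .
      have "(\<Prod>h\<in>H. ?W (?k h)) > 0" using W[OF k] by (intro prod_pos) auto
      then show ?thesis
        unfolding pmf_hole_maps(1)[OF g pos True p] val[OF True p] R C_def by simp
    next
      case False
      \<comment> \<open>A family that is no filling fails either at a hole, where the factor is
        supported on \<open>Quad\<close>, or outside \<open>H\<close>, where the product law
        prescribes \<open>undefined\<close>.\<close>
      have "pmf (Pi_pmf H undefined (\<lambda>h. P (?k h))) u = 0"
      proof (cases "\<forall>h. h \<notin> H \<longrightarrow> u h = undefined")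
        case True
        then obtain h where h: "h \<in> H" "u h \<notin> Quad (?k h)"
          using False by (auto simp: fillings_def PiE_def extensional_def)
        then have "pmf (P (?k h)) (u h) = 0"
          using B[OF k[OF h(1)]] by (auto simp: boltzmann_def pmf_eq_0_set_pmf)
        then show ?thesis using True h finH by (subst pmf_Pi') auto
      next
        case False
        then show ?thesis using finH by (subst pmf_Pi) auto
      qed
      then show ?thesis using pmf_hole_maps(2)[OF g pos False] by simp
    qed
  qed
  with pos show "0 < measure_pmf.prob (P l) ?S \<and>
      map_pmf (hole_maps q H) (cond_pmf (P l) ?S) = Pi_pmf H undefined (\<lambda>h. P (?k h))" by simp
qed

text \<open>The constant is the probability that the random map contains \<open>q\<close>; given
  this event, the filling of the hole has law \<open>P k\<close>.\<close>

lemma markov_one_hole: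
  fixes q :: "nat cmap"
  assumes P: "markov_property P" and l: "l \<ge> 1"
    and q: "quadrangulation_with_holes q {h}" "perimeter q = 2 * l" "gluable q {h}" "hole_degree q h = 2 * k"
    and f: "\<And>u p. u h \<in> Quad k \<Longrightarrow> glues_to q {h} u p \<longleftrightarrow> p = f (u h)"
  obtains a where "a > 0" "\<And>m. m \<in> Quad k \<Longrightarrow> pmf (P l) (f m) = a * pmf (P k) m"
proof -
  let ?S = "{p. submap q {h} p}"
  have pos: "measure_pmf.prob (P l) ?S > 0"
    and eq: "map_pmf (hole_maps q {h}) (cond_pmf (P l) ?S) = Pi_pmf {h} undefined (\<lambda>h. P (hole_degree q h div 2))"
    using P l q unfolding markov_property_def by blast+
  have "pmf (P l) (f m) = measure_pmf.prob (P l) ?S * pmf (P k) m" if m: "m \<in> Quad k" for m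
  proof -
    \<comment> \<open>Restricted to the hole, since both \<open>fillings\<close> and the product law
      take the value \<open>undefined\<close> elsewhere.\<close>
    define u where "u = (\<lambda>g\<in>{h}. m)"
    have u: "u \<in> fillings q {h}" "u h = m"
      unfolding fillings_one_hole[OF q(4)] using m by (auto simp: u_def)
    have gl: "glues_to q {h} u (f m)" using f[of u "f m"] u m by simp
    have "pmf (P l) (f m) / measure_pmf.prob (P l) ?S = pmf (Pi_pmf {h} undefined (\<lambda>h. P (hole_degree q h div 2))) u"
      using pmf_hole_maps(1)[OF q(3) pos u(1) gl] unfolding eq by simp
    also have "\<dots> = pmf (P k) m"
      using q(4) u(2) by (subst pmf_Pi') (auto simp: u_def)
    finally show ?thesis using pos by (simp add: field_simps)
  qed
  then show ?thesis using that pos by blast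
qed

section \<open>From the Markov property and rerooting invariance to Boltzmann weights\<close>

lemma glue_no_holes:
  assumes M: "planar_cmap M"
  shows "isomorphic M (glue M {} u)"
proof -
  have c: "surface_map M" using planar_surface_map[OF M] .
  have opp: "glue_opp M {} u (Inl s) = Inl (opp_semi M s)" if "s \<in> semi M" for s
    unfolding glue_opp_def
    using that surface_map_in(2)[OF c, of s] by (intro the_equality) (auto simp: seam_def glue_semi_def)
  have "iso_via Inl M (glue M {} u)"
    using opp by (auto simp: iso_via_def glue_def glue_semi_def bij_betw_def)
  then show ?thesis using isomorphic_iff by blast
qed

lemma single_edge_faces:
  defines "E \<equiv> \<lparr>semi = {0, 1 :: nat}, opp_semi = tr 0 1, next_semi = tr 0 1, root_semi = 0\<rparr>"
  shows "planar_cmap E" "root_face E = {0, 1}" "interior_faces E = {}"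
proof -
  show pl: "planar_cmap E" unfolding E_def by (rule planar_cmap_single_edge)
  have c: "surface_map E" by (rule planar_surface_map[OF pl])
  have f: "face_at E s = root_face E" if "s \<in> semi E" for s
  proof -
    have "s = 0 \<or> s = next_semi E 0" using that by (auto simp: E_def)
    then have "s \<in> face_at E 0" using self_in_face[OF c, of 0] next_in_face[OF c] by auto
    then show ?thesis using face_at_eq[OF c] by (simp add: root_face_def E_def)
  qed
  then show "interior_faces E = {}" by (auto simp: interior_faces_def faces_def)
  have "semi E \<subseteq> root_face E" using f self_in_face[OF c] by blast
  moreover have "root_face E \<subseteq> semi E"
    using face_at_subset[OF c planar_root[OF pl]] by (simp add: root_face_def)
  ultimately show "root_face E = {0, 1}" by (auto simp: E_def)
qed

lemma single_edge:
  shows "num_faces single_edge = 0" "single_edge \<in> Quad 1"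
  unfolding single_edge_def
  using abs_in_Quad[OF single_edge_faces(1)] single_edge_faces(2,3)
  by (simp_all add: perimeter_def)

text \<open>With the empty set of holes, containing the single edge means being equal to it, and
  \<open>markov_property\<close> makes this event one of positive probability.\<close>

lemma markov_single_edge:
  assumes P: "markov_property P"
  shows "pmf (P 1) single_edge > 0"
proof -
  let ?E = "\<lparr>semi = {0, 1 :: nat}, opp_semi = tr 0 1, next_semi = tr 0 1, root_semi = 0\<rparr>"
  note E = single_edge_faces
  have gl: "glues_to ?E {} u p \<longleftrightarrow> p = single_edge" for u p
    unfolding single_edge_def by (rule glues_to_iff[OF E(1) glue_no_holes[OF E(1)]])
  have "quadrangulation_with_holes ?E {}" "perimeter ?E = 2 * 1"
    using E by (simp_all add: quadrangulation_with_holes_def perimeter_def)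
  moreover have "gluable ?E {}"
    using gl by (simp add: gluable_def fillings_def)
  ultimately have "measure_pmf.prob (P 1) {p. submap ?E {} p} > 0"
    using P unfolding markov_property_def by blast
  moreover have "{p. submap ?E {} p} \<subseteq> {single_edge}" using gl by (auto simp: submap_def)
  ultimately show ?thesis
    using measure_pmf.finite_measure_mono[of "{p. submap ?E {} p}" "{single_edge}" "P 1"]
    by (simp add: measure_pmf_single)
qed

lemma markov_rerooting_boltzmann:
  assumes supp: "\<And>l. l \<ge> 1 \<Longrightarrow> set_pmf (P l) \<subseteq> Quad l"
    and P: "markov_property P" and R: "\<And>l. l \<ge> 1 \<Longrightarrow> rerooting_invariant l (P l)"
  shows "\<exists>x>0. \<forall>l\<ge>1. boltzmann x l (P l)"
proof -
  have "\<exists>a>0. \<forall>m\<in>Quad (Suc l). pmf (P l) (plus_edge m) = a * pmf (P (Suc l)) m" if l: "l \<ge> 1" for l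
  proof -
    obtain q :: "nat cmap" and h where t: "quadrangulation_with_holes q {h}" "perimeter q = 2 * l" "gluable q {h}"
      "hole_degree q h = 2 * Suc l" "\<And>u p. u h \<in> Quad (Suc l) \<Longrightarrow> glues_to q {h} u p \<longleftrightarrow> p = plus_edge (u h)"
      using edge_test[OF l] by metis
    show ?thesis by (rule markov_one_hole[OF P l t]) auto
  qed
  then obtain a where a: "\<And>l. l \<ge> 1 \<Longrightarrow> a l > 0"
    "\<And>l m. l \<ge> 1 \<Longrightarrow> m \<in> Quad (Suc l) \<Longrightarrow> pmf (P l) (plus_edge m) = a l * pmf (P (Suc l)) m"
    by metis
  have "\<exists>b>0. \<forall>m\<in>Quad k. pmf (P (Suc k)) (plus_leaf m) = b * pmf (P k) m" if k: "k \<ge> 1" for k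
  proof -
    obtain q :: "nat cmap" and h where t: "quadrangulation_with_holes q {h}" "perimeter q = 2 * Suc k" "gluable q {h}"
      "hole_degree q h = 2 * k" "\<And>u p. u h \<in> Quad k \<Longrightarrow> glues_to q {h} u p \<longleftrightarrow> p = plus_leaf (u h)"
      using leaf_test[OF k] by metis
    show ?thesis by (rule markov_one_hole[OF P _ t]) auto
  qed
  then obtain b where b: "\<And>k. k \<ge> 1 \<Longrightarrow> b k > 0"
    "\<And>k m. k \<ge> 1 \<Longrightarrow> m \<in> Quad k \<Longrightarrow> pmf (P (Suc k)) (plus_leaf m) = b k * pmf (P k) m"
    by metis
  \<comment> \<open>\<open>W\<close> is chosen so that the weight \<open>w\<close> is unchanged by \<^const>\<open>plus_leaf\<close>; then \<open>r l\<close> is the weight of a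
    square added to a map of half-perimeter \<open>Suc l\<close>.\<close>
  define W where "W l = 1 / (pmf (P 1) single_edge * (\<Prod>k=1..<l. b k))" for l
  have Wpos: "W l > 0" for l
    unfolding W_def using markov_single_edge[OF P] b(1) by (auto intro!: mult_pos_pos prod_pos)
  have WSuc: "W (Suc l) * b l = W l" if "l \<ge> 1" for l
    unfolding W_def using that b(1)[OF that] by (simp add: prod.atLeastLessThan_Suc)
  define w where "w l m = W l * pmf (P l) m" for l m
  define r where "r l = a l * W l / W (Suc l)" for l
  have w_leaf: "w (Suc k) (plus_leaf m) = w k m" if "k \<ge> 1" "m \<in> Quad k" for k m
    using b(2)[OF that] WSuc[OF that(1)] by (simp add: w_def mult.assoc[symmetric])
  have w_edge: "w l (plus_edge m) = r l * w (Suc l) m" if "l \<ge> 1" "m \<in> Quad (Suc l)" for l m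
    using a(2)[OF that] Wpos[of "Suc l"] by (simp add: w_def r_def)
  have w_reroot: "w l m = w l m'" if "l \<ge> 1" "m \<in> Quad l" "m' \<in> Quad l" "rerooting_of m m'" for l m m'
    using R[OF that(1)] that(2-4) by (simp add: w_def rerooting_invariant_def)
  have r_Suc: "r (Suc l) = r l" if l: "l \<ge> 1" for l
  proof -
    \<comment> \<open>Any map of positive weight serves, as the weight is cancelled at the end; one
      exists because \<open>P (Suc l)\<close> is a probability law on
      \<open>Quad (Suc l)\<close>.\<close>
    obtain u where "u \<in> set_pmf (P (Suc l))" using set_pmf_not_empty[of "P (Suc l)"] by blast
    then have u: "u \<in> Quad (Suc l)" "w (Suc l) u > 0"
      using supp[of "Suc l"] Wpos by (auto simp: w_def intro!: mult_pos_pos pmf_positive)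
    obtain u' where u': "u' \<in> Quad (Suc (Suc l))" "rerooting_of (plus_leaf u) u'"
      "rerooting_of (plus_leaf (plus_edge u)) (plus_edge u')"
      by (rule edge_leaf_commute[OF u(1)]) (use l in simp)
    note e = plus_edge(1)[OF u(1) l]
    have "r l * w (Suc l) u = w (Suc l) (plus_leaf (plus_edge u))"
      using w_edge[OF l u(1)] w_leaf[OF l e] by simp
    also have "\<dots> = w (Suc l) (plus_edge u')"
      using w_reroot[OF _ plus_leaf(1)[OF e] plus_edge(1)[OF u'(1)] u'(3)] by simp
    also have "\<dots> = r (Suc l) * w (Suc (Suc l)) (plus_leaf u)"
      using w_edge[OF _ u'(1)] w_reroot[OF _ plus_leaf(1)[OF u(1)] u'(1,2)] by simp
    also have "\<dots> = r (Suc l) * w (Suc l) u"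
      using w_leaf[OF _ u(1)] by simp
    finally show ?thesis using u(2) by simp
  qed
  define x where "x = r 1"
  have r: "r l = x" if "l \<ge> 1" for l
    using that by (induction l rule: dec_induct) (simp_all add: x_def r_Suc)
  \<comment> \<open>The factor \<open>a 1\<close> is positive because \<open>markov_property\<close>
    gives positive probability to containing the test map with a square; this rules out the laws on
    plane trees.\<close>
  have xpos: "x > 0"
    using a(1)[of 1] Wpos by (simp add: x_def r_def)
  have main: "w l m = x ^ num_faces m" if "l \<ge> 1" "m \<in> Quad l" for l m
    using that
  proof (induction "card (semi (rep_planar_map m))" arbitrary: l m rule: less_induct)
    case less
    obtain m' where m': "m' \<in> Quad l" "rerooting_of m m'"
      "(\<exists>u\<in>Quad (Suc l). m' = plus_edge u \<and> card (semi (rep_planar_map u)) < card (semi (rep_planar_map m)))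
      \<or> (\<exists>k u. k \<ge> 1 \<and> l = Suc k \<and> u \<in> Quad k \<and> m' = plus_leaf u \<and>
              card (semi (rep_planar_map u)) < card (semi (rep_planar_map m)))
      \<or> m' = single_edge \<and> l = 1"
      using peeling[OF less.prems(2,1)] by blast
    have "w l m' = x ^ num_faces m'"
      using m'(3)
    proof (elim disjE bexE exE conjE)
      fix u assume u: "u \<in> Quad (Suc l)" "m' = plus_edge u" "card (semi (rep_planar_map u)) < card (semi (rep_planar_map m))"
      then have "w (Suc l) u = x ^ num_faces u" using less.hyps by simp
      then show ?thesis
        using u w_edge[OF less.prems(1) u(1)] plus_edge(2)[OF u(1) less.prems(1)] r[OF less.prems(1)] by simp
    next
      fix k u assume u: "k \<ge> 1" "l = Suc k" "u \<in> Quad k" "m' = plus_leaf u"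
        "card (semi (rep_planar_map u)) < card (semi (rep_planar_map m))"
      then have "w k u = x ^ num_faces u" using less.hyps by simp
      then show ?thesis using u w_leaf[OF u(1,3)] plus_leaf(2)[OF u(3)] by simp
    next
      \<comment> \<open>For \<open>l = 1\<close> the product in \<open>W\<close> is empty, so
        \<open>W 1\<close> is the inverse of the probability of the single edge, whose weight is
        then 1 = \<open>x ^ 0\<close>.\<close>
      assume "m' = single_edge" "l = 1"
      then show ?thesis using single_edge(1) markov_single_edge[OF P] by (simp add: w_def W_def)
    qed
    then show ?case
      using w_reroot[OF less.prems m'(1,2)] num_faces_rerooting[OF m'(2) less.prems(2) m'(1)] by simp
  qed
  have "boltzmann x l (P l)" if l: "l \<ge> 1" for l
  proof -
    have val: "x ^ num_faces m = W l * pmf (P l) m" if "m \<in> Quad l" for m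
      using main[OF l that] by (simp add: w_def)
    \<comment> \<open>Total mass 1 shows at once that the weights are summable and that the
      normalisation \<open>W l\<close>, built from the constants of the pendant edges, is the
      partition function.\<close>
    have "(pmf (P l) has_sum 1) (Quad l)" by (rule has_sum_pmf[OF supp[OF l]])
    then have "((\<lambda>m. W l * pmf (P l) m) has_sum W l * 1) (Quad l)" by (rule has_sum_cmult_right)
    then have hs: "((\<lambda>m. x ^ num_faces m) has_sum W l) (Quad l)"
      using has_sum_cong[of "Quad l" "\<lambda>m. x ^ num_faces m"] val by simp
    then have "partition_function x l = W l"
      unfolding partition_function_def by (rule infsumI)
    then show ?thesis
      unfolding boltzmann_def using hs supp[OF l] val Wpos[of l] by (auto simp: summable_on_def)
  qed
  with xpos show ?thesis by blast
qed

lemma boltzmann_uniform: "boltzmann x l p \<Longrightarrow> uniform_given_faces l p"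
  by (auto simp: boltzmann_def uniform_given_faces_def Quad_faces_def)

lemma uniform_rerooting: "uniform_given_faces l p \<Longrightarrow> rerooting_invariant l p"
  using num_faces_rerooting unfolding uniform_given_faces_def rerooting_invariant_def Quad_faces_def
  by (metis (mono_tags, lifting) mem_Collect_eq)

theorem theorem3p20:
  fixes P :: "nat \<Rightarrow> planar_map pmf"
  assumes "\<And>l. l \<ge> 1 \<Longrightarrow> set_pmf (P l) \<subseteq> Quad l"
  shows "((\<exists>x>0. \<forall>l\<ge>1. boltzmann x l (P l)) \<longleftrightarrow>
            markov_property P \<and> (\<forall>l\<ge>1. uniform_given_faces l (P l))) \<and>
         (markov_property P \<and> (\<forall>l\<ge>1. uniform_given_faces l (P l)) \<longleftrightarrow>
            markov_property P \<and> (\<forall>l\<ge>1. rerooting_invariant l (P l)))"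
proof -
  have 12: "markov_property P \<and> (\<forall>l\<ge>1. uniform_given_faces l (P l))"
    if "\<exists>x>0. \<forall>l\<ge>1. boltzmann x l (P l)"
    using that boltzmann_markov boltzmann_uniform by blast
  have 23: "\<forall>l\<ge>1. rerooting_invariant l (P l)" if "\<forall>l\<ge>1. uniform_given_faces l (P l)"
    using that uniform_rerooting by blast
  have 31: "\<exists>x>0. \<forall>l\<ge>1. boltzmann x l (P l)"
    if "markov_property P" "\<forall>l\<ge>1. rerooting_invariant l (P l)"
    using markov_rerooting_boltzmann[OF assms] that by blast
  show ?thesis using 12 23 31 by blast
qed

end
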